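(* Let $\lambda>0$, $1<p<\infty$, $\Lambda\in(0,1)$, $\mathcal S$ a $\Lambda$-sparse family of dyadic cubes in $(\mathbb R_+,|\cdot|,\mu)$, and $b\in{\rm BMO}_{\triangle_\lambda}(\mathbb R_+)$. Then for every $w\in\widetilde A_{p,\lambda-\frac12}$, $$\|\mathcal A_{\mathcal S,b}\|_{L^p(w\,dx)\to L^p(w\,dx)},\ \|\mathcal A^*_{\mathcal S,b}\|_{L^p(w\,dx)\to L^p(w\,dx)}\le C\,\|b\|_{{\rm BMO}_{\triangle_\lambda}(\mathbb R_+)}\,[w]_{\widetilde A_{p,\lambda-\frac12}}^{2\max\{1,\frac1{p-1}\}},$$ with $C$ depending only on $p,\lambda,\Lambda$ (and the dyadic system).
   Context: Fix $\lambda>0$. On $\mathbb R_+=(0,\infty)$ let $d\mu(x)=x^{2\lambda}dx$; intervals are $B=(a,b)\subset\mathbb R_+$; $p'=p/(p-1)$; $L^p(w\,dx)=L^p(\mathbb R_+,w\,dx)$. For $1<p<\infty$, $w\ge0$ measurable belongs to $\widetilde A_{p,\lambda-\frac12}$ if $[w]_{\widetilde A_{p,\lambda-\frac12}}:=\sup_{B}\big(\frac1{\mu(B)}\int_B w(t)dt\big)\big(\frac1{\mu(B)}\int_B t^{2\lambda p'}w(t)^{-\frac1{p-1}}dt\big)^{p-1}<\infty$. ${\rm BMO}_{\triangle_\lambda}(\mathbb R_+)$ is the set of $f\in L^1_{loc}(\mathbb R_+,\mu)$ with $\|f\|_{{\rm BMO}_{\triangle_\lambda}}:=\sup_B\frac1{\mu(B)}\int_B|f-f_B|\,d\mu<\infty$,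 $f_B=\frac1{\mu(B)}\int_Bf\,d\mu$. $\mathcal D$ is a fixed system of dyadic cubes on the space of homogeneous type $(\mathbb R_+,|\cdot|,\mu)$. $\mathcal S\subset\mathcal D$ is $\Lambda$-sparse if for each $Q\in\mathcal S$ there is measurable $E_Q\subset Q$ with $\mu(E_Q)\ge\Lambda\mu(Q)$ and the $E_Q$ have finite overlap. $\mathcal A_{\mathcal S,b}f(x)=\sum_{Q\in\mathcal S}\frac{1}{\mu(Q)}|b(x)-b_Q|\int_Q f\,d\mu\cdot\chi_Q(x)$ and $\mathcal A^*_{\mathcal S,b}f(x)=\sum_{Q\in\mathcal S}\frac1{\mu(Q)}\int_Q|b(t)-b_Q|f(t)\,d\mu(t)\cdot\chi_Q(x)$.
   Formalization: "Finite overlap" is read as: each point lies in at most N of the sets E_Q, and C may also depend on N (with unrestricted overlap no such C exists); integrals in the adjoint operator that fail to converge are read as 0, which a truncation argument shows does not occur. *)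

theory Defs
  imports "HOL-Analysis.Analysis"
begin

definition mu_lam :: "real \<Rightarrow> real measure" where
  "mu_lam lam = density lborel (\<lambda>t. ennreal (indicator {0<..} t * t powr (2 * lam)))"

definition avg_mu :: "real \<Rightarrow> real set \<Rightarrow> (real \<Rightarrow> real) \<Rightarrow> real" where
  "avg_mu lam B f = (\<integral>t\<in>B. f t \<partial>mu_lam lam) / measure (mu_lam lam) B"

definition intervals_Rplus :: "real set set" where
  "intervals_Rplus = {{a<..<b} | a b. 0 \<le> a \<and> a < b}"

definition bmo_norm :: "real \<Rightarrow> (real \<Rightarrow> real) \<Rightarrow> real" where
  "bmo_norm lam f = (SUP B\<in>intervals_Rplus. avg_mu lam B (\<lambda>t. \<bar>f t - avg_mu lam B f\<bar>))"

definition in_BMO :: "real \<Rightarrow> (real \<Rightarrow> real) \<Rightarrow> bool" where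
  "in_BMO lam f \<longleftrightarrow> f \<in> borel_measurable borel
     \<and> (\<forall>B\<in>intervals_Rplus. set_integrable (mu_lam lam) B f)
     \<and> bdd_above ((\<lambda>B. avg_mu lam B (\<lambda>t. \<bar>f t - avg_mu lam B f\<bar>)) ` intervals_Rplus)"

definition Ap_char :: "real \<Rightarrow> real \<Rightarrow> (real \<Rightarrow> real) \<Rightarrow> real set \<Rightarrow> real" where
  "Ap_char lam p w B =
     ((\<integral>t\<in>B. w t \<partial>lborel) / measure (mu_lam lam) B) *
     ((\<integral>t\<in>B. t powr (2 * lam * (p / (p - 1))) * w t powr (- 1 / (p - 1)) \<partial>lborel)
        / measure (mu_lam lam) B) powr (p - 1)"

definition Ap_const :: "real \<Rightarrow> real \<Rightarrow> (real \<Rightarrow> real) \<Rightarrow> real" where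
  "Ap_const lam p w = (SUP B\<in>intervals_Rplus. Ap_char lam p w B)"

text \<open>Membership: w is a nonnegative measurable function, positive a.e. on R_+
  (otherwise w^(-1/(p-1)) would be infinite on a set of positive measure), both
  integrals in the characteristic are finite on every interval, and the supremum is finite.\<close>
definition in_Ap_tilde :: "real \<Rightarrow> real \<Rightarrow> (real \<Rightarrow> real) \<Rightarrow> bool" where
  "in_Ap_tilde lam p w \<longleftrightarrow> w \<in> borel_measurable borel
     \<and> (\<forall>t>0. w t \<ge> 0)
     \<and> (AE t in lborel. t > 0 \<longrightarrow> w t > 0)
     \<and> (\<forall>B\<in>intervals_Rplus. set_integrable lborel B w
          \<and> set_integrable lborel B (\<lambda>t. t powr (2 * lam * (p / (p - 1))) * w t powr (- 1 / (p - 1))))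
     \<and> bdd_above (Ap_char lam p w ` intervals_Rplus)"

definition dyadic_system ::
  "real \<Rightarrow> real \<Rightarrow> real \<Rightarrow> (int \<Rightarrow> real set set) \<Rightarrow> bool" where
  "dyadic_system \<delta> c0 C0 D \<longleftrightarrow>
     0 < \<delta> \<and> \<delta> < 1 \<and> 0 < c0 \<and> c0 \<le> C0
     \<and> (\<forall>k. \<forall>Q\<in>D k. Q \<subseteq> {0<..} \<and> Q \<in> sets borel)
     \<and> (\<forall>k. \<Union>(D k) = {0<..})
     \<and> (\<forall>k. \<forall>Q\<in>D k. \<forall>Q'\<in>D k. Q \<noteq> Q' \<longrightarrow> Q \<inter> Q' = {})
     \<and> (\<forall>k l. k \<le> l \<longrightarrow> (\<forall>Q\<in>D l. \<forall>P\<in>D k. Q \<subseteq> P \<or> Q \<inter> P = {}))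
     \<and> (\<forall>k. \<forall>Q\<in>D k. \<exists>z\<in>Q. ball z (c0 * \<delta> powi k) \<inter> {0<..} \<subseteq> Q
                              \<and> Q \<subseteq> ball z (C0 * \<delta> powi k))"

definition dyadic_cubes :: "(int \<Rightarrow> real set set) \<Rightarrow> real set set" where
  "dyadic_cubes D = (\<Union>k. D k)"

definition sparse :: "real \<Rightarrow> real \<Rightarrow> nat \<Rightarrow> (int \<Rightarrow> real set set) \<Rightarrow> real set set \<Rightarrow> bool" where
  "sparse lam \<Lambda> N D S \<longleftrightarrow> S \<subseteq> dyadic_cubes D \<and>
     (\<exists>E. (\<forall>Q\<in>S. E Q \<subseteq> Q \<and> E Q \<in> sets borel
                  \<and> measure (mu_lam lam) (E Q) \<ge> \<Lambda> * measure (mu_lam lam) Q)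
        \<and> (\<forall>x. finite {Q\<in>S. x \<in> E Q} \<and> card {Q\<in>S. x \<in> E Q} \<le> N))"

definition comm_term :: "real \<Rightarrow> (real \<Rightarrow> real) \<Rightarrow> (real \<Rightarrow> real) \<Rightarrow> real \<Rightarrow> real set \<Rightarrow> real" where
  "comm_term lam b f x Q =
      (1 / measure (mu_lam lam) Q) * \<bar>b x - avg_mu lam Q b\<bar> * (\<integral>t\<in>Q. f t \<partial>mu_lam lam)
      * indicator Q x"

definition comm_adj_term :: "real \<Rightarrow> (real \<Rightarrow> real) \<Rightarrow> (real \<Rightarrow> real) \<Rightarrow> real \<Rightarrow> real set \<Rightarrow> real" where
  "comm_adj_term lam b f x Q =
      (1 / measure (mu_lam lam) Q) * (\<integral>t\<in>Q. \<bar>b t - avg_mu lam Q b\<bar> * f t \<partial>mu_lam lam)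
      * indicator Q x"

definition sparse_comm :: "real \<Rightarrow> real set set \<Rightarrow> (real \<Rightarrow> real) \<Rightarrow> (real \<Rightarrow> real) \<Rightarrow> real \<Rightarrow> real" where
  "sparse_comm lam S b f x = (\<Sum>\<^sub>\<infinity>Q\<in>S. comm_term lam b f x Q)"

definition sparse_comm_adj :: "real \<Rightarrow> real set set \<Rightarrow> (real \<Rightarrow> real) \<Rightarrow> (real \<Rightarrow> real) \<Rightarrow> real \<Rightarrow> real" where
  "sparse_comm_adj lam S b f x = (\<Sum>\<^sub>\<infinity>Q\<in>S. comm_adj_term lam b f x Q)"

definition in_Lp_w :: "real \<Rightarrow> (real \<Rightarrow> real) \<Rightarrow> (real \<Rightarrow> real) \<Rightarrow> bool" where
  "in_Lp_w p w f \<longleftrightarrow> f \<in> borel_measurable borel \<and>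
     (\<integral>\<^sup>+x\<in>{0<..}. ennreal (\<bar>f x\<bar> powr p * w x) \<partial>lborel) < \<infinity>"

definition Lp_w_pow :: "real \<Rightarrow> (real \<Rightarrow> real) \<Rightarrow> (real \<Rightarrow> real) \<Rightarrow> ennreal" where
  "Lp_w_pow p w f = (\<integral>\<^sup>+x\<in>{0<..}. ennreal (\<bar>f x\<bar> powr p * w x) \<partial>lborel)"

end

theory Submission
  imports Defs
begin

text \<open>
  With \<open>v(x) = w(x) x\<^sup>-\<^sup>2\<^sup>\<lambda>\<close> one has \<open>w dx = v d\<mu>\<close>, and the modified condition on \<open>w\<close> is the ordinary \<open>A\<^sub>p\<close> condition
  for \<open>v\<close> with respect to \<open>\<mu>\<close>, with dual weight \<open>s\<close> satisfying \<open>v\<^sup>1\<^sup>/\<^sup>p s\<^sup>1\<^sup>/\<^sup>q = 1\<close>. By duality it suffices to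
  bound bilinear forms by \<open>L\<^sup>p(v)\<close> and \<open>L\<^sup>q(s)\<close> norms.

  The form of a sparse averaging operator is bounded by the characteristic to the power
  \<open>max 1 (1/(p-1))\<close>: for \<open>p \<ge> 2\<close> the masses of a cube are traded for those of its sparse part, and Hoelder's
  inequality with the Carleson embedding for both weights concludes; \<open>p < 2\<close> follows by symmetry.

  For a finite family \<open>F\<close> of cubes let \<open>T\<close> be the stopping cubes of \<open>b\<close> generated by the maximal cubes of \<open>F\<close>
  (stop when the mean of \<open>b\<close> has moved by twice the oscillation bound). Then \<open>T\<close> is sparse and
  \<open>|b - b\<^sub>Q|\<close> is dominated on \<open>Q \<in> F\<close> by the norm of \<open>b\<close> times one plus the number of cubes of \<open>T\<close> inside
  \<open>Q\<close> around the point. Hence the adjoint commutator form is at most a multiple of the norm of \<open>b\<close> times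
  \<open>\<langle>A\<^sub>F f, g\<rangle> + \<langle>A\<^sub>F A\<^sub>T f, g\<rangle>\<close>, which produces the square of the sparse bound; the other operator has the
  transposed form.
\<close>

section \<open>Powers and Hoelder's inequality for extended nonnegative reals\<close>

text \<open>Only positive exponents are meaningful at infinity: \<open>top epowr p = top\<close> for every \<open>p\<close>.\<close>

definition epowr :: "ennreal \<Rightarrow> real \<Rightarrow> ennreal" (infixr "epowr" 80) where
  "x epowr p = (if x = top then top else ennreal (enn2real x powr p))"

lemma epowr_ennreal [simp]: "0 \<le> x \<Longrightarrow> ennreal x epowr p = ennreal (x powr p)"
  by (simp add: epowr_def)

lemma epowr_top [simp]: "top epowr p = top"
  by (simp add: epowr_def)

lemma epowr_zero [simp]: "0 epowr p = 0"
  by (simp add: epowr_def)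

lemma one_epowr [simp]: "1 epowr p = 1"
  by (simp add: epowr_def)

lemma epowr_one [simp]: "x epowr 1 = x"
  by (cases x) auto

lemma epowr_eq_0_iff [simp]: "x epowr p = 0 \<longleftrightarrow> x = 0"
  by (cases x) (auto simp: powr_eq_0_iff ennreal_eq_0_iff)

lemma epowr_eq_top_iff [simp]: "x epowr p = top \<longleftrightarrow> x = top"
  by (cases x) auto

lemma epowr_less_top_iff [simp]: "x epowr p < top \<longleftrightarrow> x < top"
  by (cases x) auto

lemma epowr_mono: "0 \<le> p \<Longrightarrow> x \<le> y \<Longrightarrow> x epowr p \<le> y epowr p"
  by (cases x; cases y) (auto simp: top_unique intro!: ennreal_leI powr_mono2)

lemma epowr_mult: "(x * y) epowr p = x epowr p * y epowr p"
proof (cases x; cases y)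
  fix a b :: real assume "0 \<le> a" "x = ennreal a" "0 \<le> b" "y = ennreal b"
  then show ?thesis
    by (simp add: powr_mult flip: ennreal_mult)
qed (auto simp: epowr_def ennreal_mult_top ennreal_top_mult)

lemma epowr_add: "x epowr (a + b) = x epowr a * x epowr b"
  by (cases x) (auto simp: powr_add ennreal_mult)

lemma epowr_epowr: "(x epowr a) epowr b = x epowr (a * b)"
  by (cases x) (auto simp: powr_powr)

lemma epowr_powr_inverse [simp]:
  assumes "p \<noteq> 0"
  shows "(x epowr p) epowr (1 / p) = x" and "(x epowr (1 / p)) epowr p = x"
  using assms by (simp_all add: epowr_epowr)

lemma le_epowr_conjugate:
  fixes a K :: ennreal
  assumes "a < top" and p: "1 < p" and conj: "1 / p + 1 / q = 1" and a_le: "a \<le> K * a epowr (1 / q)"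
  shows "a \<le> K epowr p"
proof (cases "a = 0")
  case False
  let ?c = "a epowr (1 / q)"
  have c: "0 < ?c" "?c < top" using assms(1) False by (auto simp: zero_less_iff_neq_zero)
  have "a = a epowr (1 / p + 1 / q)" using conj by simp
  then have "?c * a epowr (1 / p) \<le> ?c * K" using a_le by (simp add: epowr_add mult.commute)
  then have "a epowr (1 / p) \<le> K"
    using c by (subst (asm) ennreal_mult_le_mult_iff) auto
  then have "(a epowr (1 / p)) epowr p \<le> K epowr p"
    using p by (intro epowr_mono) auto
  then show ?thesis using p by simp
qed simp

lemma borel_measurable_epowr [measurable (raw)]:
  assumes [measurable]: "f \<in> borel_measurable M"
  shows "(\<lambda>x. f x epowr p) \<in> borel_measurable M"
  unfolding epowr_def by measurable

lemma epowr_Youngs_inequality: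
  assumes "1 < p" "1 < q" "1 / p + 1 / q = 1"
  shows "a * b \<le> ennreal (1 / p) * a epowr p + ennreal (1 / q) * b epowr q"
proof (cases a; cases b)
  fix x y assume "0 \<le> x" "a = ennreal x" "0 \<le> y" "b = ennreal y"
  then show ?thesis
    using Youngs_inequality[OF assms, of x y] assms
    by (simp flip: ennreal_mult ennreal_plus)
qed (use assms in \<open>auto simp: ennreal_mult_top\<close>)

definition nn_Lp_norm :: "'a measure \<Rightarrow> real \<Rightarrow> ('a \<Rightarrow> ennreal) \<Rightarrow> ennreal" where
  "nn_Lp_norm M p f = (\<integral>\<^sup>+x. f x epowr p \<partial>M) epowr (1 / p)"

lemma nn_Lp_norm_powr: "p \<noteq> 0 \<Longrightarrow> nn_Lp_norm M p f epowr p = (\<integral>\<^sup>+x. f x epowr p \<partial>M)"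
  by (simp add: nn_Lp_norm_def)

lemma nn_Lp_norm_cmult:
  assumes "p \<noteq> 0" and [measurable]: "f \<in> borel_measurable M"
  shows "nn_Lp_norm M p (\<lambda>x. c * f x) = c * nn_Lp_norm M p f"
  using assms(1) by (simp add: nn_Lp_norm_def epowr_mult nn_integral_cmult)

lemma nn_Lp_norm_eq_0_imp_AE:
  assumes "p \<noteq> 0" and [measurable]: "f \<in> borel_measurable M" and "nn_Lp_norm M p f = 0"
  shows "AE x in M. f x = 0"
  using assms by (simp add: nn_Lp_norm_def nn_integral_0_iff_AE)

theorem nn_integral_Holder:
  assumes exponents: "1 < p" "1 < q" "1 / p + 1 / q = 1"
    and [measurable]: "f \<in> borel_measurable M" "g \<in> borel_measurable M"
  shows "(\<integral>\<^sup>+x. f x * g x \<partial>M) \<le> nn_Lp_norm M p f * nn_Lp_norm M q g"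
proof -
  let ?A = "nn_Lp_norm M p f" and ?B = "nn_Lp_norm M q g"
  consider "?A = 0 \<or> ?B = 0" | "?A \<noteq> 0" "?B \<noteq> 0" "?A = top \<or> ?B = top"
    | "?A \<noteq> 0" "?B \<noteq> 0" "?A < top" "?B < top"
    by (metis less_top)
  then show ?thesis
  proof cases
    case 1
    then have "AE x in M. f x * g x = 0"
      using nn_Lp_norm_eq_0_imp_AE[of p f M] nn_Lp_norm_eq_0_imp_AE[of q g M] exponents by auto
    then have "(\<integral>\<^sup>+x. f x * g x \<partial>M) = 0" by (simp add: nn_integral_0_iff_AE)
    then show ?thesis by simp
  next
    case 2
    then show ?thesis by (auto simp: ennreal_mult_top ennreal_top_mult)
  next
    case 3
    let ?f = "\<lambda>x. inverse ?A * f x" and ?g = "\<lambda>x. inverse ?B * g x"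
    have "inverse ?A * ?A = 1" "inverse ?B * ?B = 1"
      using 3 by (simp_all add: mult.commute flip: divide_ennreal_def)
    then have norm1: "(\<integral>\<^sup>+x. ?f x epowr p \<partial>M) = 1" "(\<integral>\<^sup>+x. ?g x epowr q \<partial>M) = 1"
      using exponents nn_Lp_norm_cmult[of p f M "inverse ?A"] nn_Lp_norm_cmult[of q g M "inverse ?B"]
      by (simp_all flip: nn_Lp_norm_powr)
    have "(\<integral>\<^sup>+x. ?f x * ?g x \<partial>M)
        \<le> (\<integral>\<^sup>+x. ennreal (1 / p) * ?f x epowr p + ennreal (1 / q) * ?g x epowr q \<partial>M)"
      by (intro nn_integral_mono epowr_Youngs_inequality exponents)
    also have "\<dots> = 1"
      using exponents norm1 by (simp add: nn_integral_add nn_integral_cmult flip: ennreal_plus)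
    finally have "?A * ?B * (\<integral>\<^sup>+x. ?f x * ?g x \<partial>M) \<le> ?A * ?B * 1"
      by (rule mult_left_mono) simp
    moreover have "f x * g x = ?A * ?B * (?f x * ?g x)" for x
      using \<open>inverse ?A * ?A = 1\<close> \<open>inverse ?B * ?B = 1\<close>
      by (metis (no_types, lifting) mult.assoc mult.commute mult_1)
    ultimately show ?thesis by (simp add: nn_integral_cmult)
  qed
qed

corollary sum_Holder_ennreal:
  fixes a b :: "'i \<Rightarrow> ennreal"
  assumes "1 < p" "1 < q" "1 / p + 1 / q = 1" and "finite F"
  shows "(\<Sum>i\<in>F. a i * b i) \<le> (\<Sum>i\<in>F. a i epowr p) epowr (1 / p) * (\<Sum>i\<in>F. b i epowr q) epowr (1 / q)"
  using nn_integral_Holder[OF assms(1-3), of a "count_space F" b] assms(4)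
  by (simp add: nn_Lp_norm_def nn_integral_count_space_finite)

lemma ennreal_less_2_mult_iff: "ennreal t < 2 * y \<longleftrightarrow> ennreal (t / 2) < y"
proof (cases y)
  case (real r)
  then have "2 * y = ennreal (2 * r)" by (simp add: ennreal_mult)
  then show ?thesis using real by (cases "0 \<le> t") (auto simp: ennreal_less_iff ennreal_neg)
qed (simp add: ennreal_mult_top)

lemma nn_integral_powr_Ioo:
  fixes a r :: real
  assumes "0 < a" "0 \<le> r"
  shows "(\<integral>\<^sup>+t\<in>{0<..<r}. ennreal (t powr (a - 1)) \<partial>lborel) = ennreal (r powr a / a)"
proof (rule nn_integral_has_integral_lebesgue')
  show "((\<lambda>t. t powr (a - 1)) has_integral (r powr a / a)) {0<..<r}"
    using has_integral_powr_from_0[of "a - 1" r] assms by (simp add: has_integral_Icc_iff_Ioo)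
qed simp

lemma nn_integral_powr_below:
  fixes a :: real and y :: ennreal
  assumes a: "0 < a"
  shows "(\<integral>\<^sup>+t\<in>{t. 0 < t \<and> ennreal t < y}. ennreal (t powr (a - 1)) \<partial>lborel) = ennreal (1 / a) * y epowr a"
proof (cases y)
  case (real r)
  then have "{t. 0 < t \<and> ennreal t < y} = {0<..<r}" by (auto simp: ennreal_less_iff)
  then show ?thesis
    using nn_integral_powr_Ioo[of a r] real a by (simp flip: ennreal_mult)
next
  case top
  let ?I = "\<integral>\<^sup>+t\<in>{t. 0 < t \<and> ennreal t < y}. ennreal (t powr (a - 1)) \<partial>lborel"
  have "of_nat n \<le> ?I" for n
  proof -
    let ?r = "(real n * a) powr (1 / a)"
    have "of_nat n = ennreal (?r powr a / a)"
      using a by (simp add: powr_powr ennreal_of_nat_eq_real_of_nat)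
    also have "\<dots> = (\<integral>\<^sup>+t\<in>{0<..<?r}. ennreal (t powr (a - 1)) \<partial>lborel)"
      using a by (simp add: nn_integral_powr_Ioo)
    also have "\<dots> \<le> ?I"
      unfolding top by (intro nn_set_integral_set_mono) auto
    finally show ?thesis .
  qed
  then have "(SUP n. of_nat n) \<le> ?I" by (intro SUP_least)
  then have "?I = top" by (simp add: ennreal_SUP_of_nat_eq_top top_unique)
  then show ?thesis using top a by (simp add: ennreal_mult_top)
qed

section \<open>Laminar families and the Carleson embedding\<close>

lemma nn_integral_count_space_mono_set:
  "A \<subseteq> B \<Longrightarrow> (\<integral>\<^sup>+i. h i \<partial>count_space A) \<le> (\<integral>\<^sup>+i. h i \<partial>count_space B)"
  by (auto simp: nn_integral_count_space_indicator intro!: nn_integral_mono split: split_indicator)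

lemma nn_integral_count_space_le_finite_sums:
  fixes h :: "'i \<Rightarrow> ennreal"
  assumes "countable S" and finite_sums_le: "\<And>F. finite F \<Longrightarrow> F \<subseteq> S \<Longrightarrow> (\<Sum>i\<in>F. h i) \<le> C"
  shows "(\<integral>\<^sup>+i. h i \<partial>count_space S) \<le> C"
proof (cases "finite S")
  case True
  then show ?thesis using finite_sums_le by (simp add: nn_integral_count_space_finite)
next
  case False
  then have bij: "bij_betw (from_nat_into S) UNIV S"
    using assms(1) by (intro bij_betw_from_nat_into) auto
  then have inj: "inj (from_nat_into S)" by (rule bij_betw_imp_inj_on)
  have "(\<integral>\<^sup>+i. h i \<partial>count_space S) = (\<Sum>n. h (from_nat_into S n))"
    by (simp add: nn_integral_bij_count_space[OF bij, symmetric] nn_integral_count_space_nat)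
  also have "\<dots> \<le> C"
  proof (rule suminf_le_const)
    fix n
    have "(\<Sum>i<n. h (from_nat_into S i)) = (\<Sum>i\<in>from_nat_into S ` {..<n}. h i)"
      by (subst sum.reindex) (auto intro: inj_on_subset[OF inj])
    also have "\<dots> \<le> C"
      using bij by (intro finite_sums_le) (auto simp: bij_betw_def)
    finally show "(\<Sum>i<n. h (from_nat_into S i)) \<le> C" .
  qed simp
  finally show ?thesis .
qed

lemma borel_measurable_nn_integral_count_space:
  assumes "countable I" and h: "\<And>i. i \<in> I \<Longrightarrow> h i \<in> borel_measurable M"
  shows "(\<lambda>x. \<integral>\<^sup>+i. h i x \<partial>count_space I) \<in> borel_measurable M"
proof -
  interpret sigma_finite_measure "count_space I"
    using assms(1) by (rule sigma_finite_measure_count_space_countable)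
  have "(\<lambda>z. h (snd z) (fst z)) \<in> borel_measurable (M \<Otimes>\<^sub>M count_space I)"
    by (intro measurable_compose_countable'[where g = snd and I = I and f = "\<lambda>i z. h i (fst z)"]
        measurable_compose[OF measurable_fst] h measurable_snd assms(1))
  then show ?thesis
    by (intro borel_measurable_nn_integral) (simp add: case_prod_beta')
qed

lemma emeasure_Union_disjoint:
  assumes "countable I" "disjoint I" "I \<subseteq> sets M"
  shows "emeasure M (\<Union>I) = (\<integral>\<^sup>+Q. emeasure M Q \<partial>count_space I)"
  using emeasure_UN_countable[of I "\<lambda>Q. Q" M] assms disjoint_image_disjoint_family_on[of "\<lambda>Q. Q" I]
  by auto

lemma nn_integral_Union_disjoint:
  assumes "countable I" "disjoint I" "I \<subseteq> sets M" "h \<in> borel_measurable M"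
  shows "(\<integral>\<^sup>+x\<in>\<Union>I. h x \<partial>M) = (\<integral>\<^sup>+Q. set_nn_integral M Q h \<partial>count_space I)"
proof -
  have "(\<integral>\<^sup>+x\<in>\<Union>I. h x \<partial>M) = emeasure (density M h) (\<Union>I)"
    using assms by (intro emeasure_density[symmetric] sets.countable_Union)
  also have "\<dots> = (\<integral>\<^sup>+Q. emeasure (density M h) Q \<partial>count_space I)"
    using assms by (intro emeasure_Union_disjoint) auto
  also have "\<dots> = (\<integral>\<^sup>+Q. set_nn_integral M Q h \<partial>count_space I)"
    using assms by (intro nn_integral_cong emeasure_density) auto
  finally show ?thesis .
qed

definition laminar :: "'a set set \<Rightarrow> bool" where
  "laminar S \<longleftrightarrow> (\<forall>P\<in>S. \<forall>Q\<in>S. P \<subseteq> Q \<or> Q \<subseteq> P \<or> P \<inter> Q = {})"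

lemma laminarD: "laminar S \<Longrightarrow> P \<in> S \<Longrightarrow> Q \<in> S \<Longrightarrow> P \<subseteq> Q \<or> Q \<subseteq> P \<or> P \<inter> Q = {}"
  by (simp add: laminar_def)

lemma laminar_subset: "laminar S \<Longrightarrow> F \<subseteq> S \<Longrightarrow> laminar F"
  unfolding laminar_def by (meson subsetD)

definition maximal_members :: "'a set set \<Rightarrow> 'a set set" where
  "maximal_members F = {Q\<in>F. \<forall>P\<in>F. Q \<subseteq> P \<longrightarrow> P = Q}"

lemma maximal_members_subset: "maximal_members F \<subseteq> F"
  by (auto simp: maximal_members_def)

lemma disjoint_maximal_members: "laminar F \<Longrightarrow> disjoint (maximal_members F)"
proof (rule disjointI)
  fix P Q assume "laminar F" and PQ: "P \<in> maximal_members F" "Q \<in> maximal_members F" "P \<noteq> Q"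
  moreover from PQ have "P \<in> F" "Q \<in> F" "\<not> P \<subseteq> Q" "\<not> Q \<subseteq> P"
    by (auto simp: maximal_members_def)
  ultimately show "P \<inter> Q = {}" using laminarD by blast
qed

lemma maximal_member_above:
  assumes "Q \<in> F" "finite {P\<in>F. Q \<subseteq> P}"
  obtains P where "P \<in> maximal_members F" "Q \<subseteq> P"
proof -
  from finite_has_maximal2[OF assms(2), of Q] assms(1)
  obtain P where P: "P \<in> F" "Q \<subseteq> P" and "\<forall>R\<in>{P\<in>F. Q \<subseteq> P}. P \<subseteq> R \<longrightarrow> P = R"
    by blast
  then have "P \<in> maximal_members F" by (auto simp: maximal_members_def)
  with P that show ?thesis by blast
qed

lemma Union_maximal_members:
  assumes "\<And>Q. Q \<in> F \<Longrightarrow> finite {P\<in>F. Q \<subseteq> P}"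
  shows "\<Union>(maximal_members F) = \<Union>F"
proof
  show "\<Union>F \<subseteq> \<Union>(maximal_members F)"
  proof (rule Union_least)
    fix Q assume "Q \<in> F"
    then obtain P where "P \<in> maximal_members F" "Q \<subseteq> P"
      using assms maximal_member_above by metis
    then show "Q \<subseteq> \<Union>(maximal_members F)" by blast
  qed
qed (use maximal_members_subset in blast)

definition cube_family :: "'a measure \<Rightarrow> 'a set set \<Rightarrow> bool" where
  "cube_family M S \<longleftrightarrow> countable S \<and> laminar S \<and> S \<subseteq> sets M
     \<and> (\<forall>Q\<in>S. 0 < emeasure M Q \<and> emeasure M Q < top)"

lemma cube_familyD:
  assumes "cube_family M S"
  shows "countable S" "laminar S" "S \<subseteq> sets M"
    and "Q \<in> S \<Longrightarrow> Q \<in> sets M" "Q \<in> S \<Longrightarrow> 0 < emeasure M Q" "Q \<in> S \<Longrightarrow> emeasure M Q < top"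
  using assms by (auto simp: cube_family_def)

lemma cube_family_subset: "cube_family M S \<Longrightarrow> F \<subseteq> S \<Longrightarrow> cube_family M F"
  unfolding cube_family_def by (meson countable_subset laminar_subset subset_iff)

definition bounded_overlap :: "nat \<Rightarrow> 'i set \<Rightarrow> ('i \<Rightarrow> 'a set) \<Rightarrow> bool" where
  "bounded_overlap N S E \<longleftrightarrow> (\<forall>x. finite {Q\<in>S. x \<in> E Q} \<and> card {Q\<in>S. x \<in> E Q} \<le> N)"

lemma bounded_overlap_subset:
  assumes "bounded_overlap N S E" "F \<subseteq> S"
  shows "bounded_overlap N F E"
  unfolding bounded_overlap_def
proof (intro allI conjI)
  fix x
  have members_subset: "{Q\<in>F. x \<in> E Q} \<subseteq> {Q\<in>S. x \<in> E Q}" using assms(2) by auto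
  have finite_members: "finite {Q\<in>S. x \<in> E Q}" and card_le: "card {Q\<in>S. x \<in> E Q} \<le> N"
    using assms(1) by (auto simp: bounded_overlap_def)
  show "finite {Q\<in>F. x \<in> E Q}" using members_subset finite_members by (rule finite_subset)
  show "card {Q\<in>F. x \<in> E Q} \<le> N" using card_mono[OF finite_members members_subset] card_le by simp
qed

lemma bounded_overlap_if_disjoint_family_on:
  assumes "disjoint_family_on E S"
  shows "bounded_overlap 1 S E"
  unfolding bounded_overlap_def
proof (rule allI)
  fix x
  show "finite {Q\<in>S. x \<in> E Q} \<and> card {Q\<in>S. x \<in> E Q} \<le> 1"
  proof (cases "\<exists>P\<in>S. x \<in> E P")
    case True
    then obtain P where "P \<in> S" "x \<in> E P" by blast
    then have "{Q\<in>S. x \<in> E Q} = {P}" using assms by (auto simp: disjoint_family_on_def)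
    then show ?thesis by simp
  next
    case False
    then have "{Q\<in>S. x \<in> E Q} = {}" by blast
    then show ?thesis by (simp only:) simp
  qed
qed

lemma sum_emeasure_le_bounded_overlap:
  assumes finite_G: "finite G" and X: "X \<in> sets M" and E: "\<And>Q. Q \<in> G \<Longrightarrow> E Q \<in> sets M" "\<And>Q. Q \<in> G \<Longrightarrow> E Q \<subseteq> X"
    and overlap: "bounded_overlap N G E"
  shows "(\<Sum>Q\<in>G. emeasure M (E Q)) \<le> of_nat N * emeasure M X"
proof -
  have "(\<Sum>Q\<in>G. emeasure M (E Q)) = (\<integral>\<^sup>+x. (\<Sum>Q\<in>G. indicator (E Q) x) \<partial>M)"
    using E by (simp add: nn_integral_sum)
  also have "\<dots> \<le> (\<integral>\<^sup>+x. of_nat N * indicator X x \<partial>M)"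
  proof (rule nn_integral_mono)
    fix x
    have "(\<Sum>Q\<in>G. indicator (E Q) x :: ennreal) = of_nat (card {Q\<in>G. x \<in> E Q})"
      using finite_G by (simp add: indicator_def sum.If_cases Int_def)
    also have "\<dots> \<le> of_nat N * indicator X x"
    proof (cases "x \<in> X")
      case False
      then have "{Q\<in>G. x \<in> E Q} = {}" using E by blast
      then show ?thesis by (simp only: card.empty of_nat_0 zero_le)
    qed (use overlap in \<open>simp add: bounded_overlap_def\<close>)
    finally show "(\<Sum>Q\<in>G. indicator (E Q) x :: ennreal) \<le> of_nat N * indicator X x" .
  qed
  also have "\<dots> = of_nat N * emeasure M X"
    using X by (rule nn_integral_cmult_indicator)
  finally show ?thesis .
qed

definition nn_average :: "'a measure \<Rightarrow> 'a set \<Rightarrow> ('a \<Rightarrow> ennreal) \<Rightarrow> ennreal" where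
  "nn_average M Q f = set_nn_integral M Q f / emeasure M Q"

lemma nn_average_times_emeasure:
  "0 < emeasure M Q \<Longrightarrow> emeasure M Q < top \<Longrightarrow> nn_average M Q f * emeasure M Q = set_nn_integral M Q f"
  by (simp add: nn_average_def ennreal_divide_times)

definition upper_truncation :: "ennreal \<Rightarrow> ('a \<Rightarrow> ennreal) \<Rightarrow> 'a \<Rightarrow> ennreal" where
  "upper_truncation c f x = (if c < f x then f x else 0)"

lemma borel_measurable_upper_truncation [measurable]:
  assumes [measurable]: "f \<in> borel_measurable M"
  shows "upper_truncation c f \<in> borel_measurable M"
  unfolding upper_truncation_def[abs_def] by measurable

lemma emeasure_le_upper_truncation_integral:
  assumes [measurable]: "Q \<in> sets M" "f \<in> borel_measurable M"
    and Q: "0 < emeasure M Q" "emeasure M Q < top" and t: "0 < t" "ennreal t < nn_average M Q f"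
  shows "emeasure M Q \<le> ennreal (2 / t) * (\<integral>\<^sup>+x\<in>Q. upper_truncation (ennreal (t / 2)) f x \<partial>M)"
    (is "_ \<le> _ * ?J")
proof -
  obtain m where m: "emeasure M Q = ennreal m" "0 < m"
    using Q by (cases "emeasure M Q") auto
  have "ennreal t * emeasure M Q \<le> nn_average M Q f * emeasure M Q"
    using t by (intro mult_right_mono) auto
  also have "\<dots> = set_nn_integral M Q f"
    using Q by (rule nn_average_times_emeasure)
  also have "\<dots> \<le> (\<integral>\<^sup>+x\<in>Q. upper_truncation (ennreal (t / 2)) f x + ennreal (t / 2) \<partial>M)"
    by (intro nn_integral_mono) (auto simp: upper_truncation_def indicator_def)
  also have "\<dots> = ?J + ennreal (t / 2) * emeasure M Q"
    by (simp add: nn_set_integral_add nn_integral_cmult_indicator)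
  finally have split: "ennreal t * emeasure M Q \<le> ?J + ennreal (t / 2) * emeasure M Q" .
  show ?thesis
  proof (cases ?J)
    case (real j)
    with split t m have "t * m \<le> j + t / 2 * m"
      by (simp flip: ennreal_plus ennreal_mult)
    then have "m \<le> 2 / t * j" using t by (simp add: field_simps)
    then show ?thesis using real t m by (simp flip: ennreal_mult)
  next
    case top
    then show ?thesis using t by (simp add: ennreal_mult_top)
  qed
qed

text \<open>At height \<open>t\<close> only the maximal members with average above \<open>t\<close> matter, and on each of those the
  part of \<open>f\<close> above \<open>t / 2\<close> carries at least half of the average.\<close>

lemma carleson_level_set:
  assumes F: "finite F" "cube_family M F"
    and E: "\<And>Q. Q \<in> F \<Longrightarrow> E Q \<in> sets M" "\<And>Q. Q \<in> F \<Longrightarrow> E Q \<subseteq> Q" "bounded_overlap N F E"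
    and f [measurable]: "f \<in> borel_measurable M" and t: "0 < t"
  shows "(\<Sum>Q\<in>{Q\<in>F. ennreal t < nn_average M Q f}. emeasure M (E Q))
      \<le> of_nat N * (ennreal (2 / t) * (\<integral>\<^sup>+x. upper_truncation (ennreal (t / 2)) f x \<partial>M))"
proof -
  define G where "G = {Q\<in>F. ennreal t < nn_average M Q f}"
  let ?X = "maximal_members G" and ?h = "upper_truncation (ennreal (t / 2)) f"
  note cubes = cube_familyD[OF F(2)]
  have G: "G \<subseteq> F" "finite G" using F(1) by (auto simp: G_def)
  have X: "?X \<subseteq> G" by (rule maximal_members_subset)
  then have X_fin: "finite ?X" using G(2) by (rule finite_subset)
  have X_disjoint: "disjoint ?X"
    by (intro disjoint_maximal_members laminar_subset[OF cubes(2) G(1)])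
  have cover: "\<Union>?X = \<Union>G" using G(2) by (intro Union_maximal_members) simp
  have X_sets: "?X \<subseteq> sets M" using X G(1) cubes(3) by blast
  have X_count: "countable ?X" using X_fin by (rule countable_finite)
  have "(\<Sum>Q\<in>G. emeasure M (E Q)) \<le> of_nat N * emeasure M (\<Union>?X)"
  proof (rule sum_emeasure_le_bounded_overlap)
    show "\<Union>?X \<in> sets M" using X_sets X_count by auto
    show "E Q \<subseteq> \<Union>?X" if "Q \<in> G" for Q
      unfolding cover using that E(2) G(1) by blast
  qed (use G E bounded_overlap_subset in auto)
  also have "emeasure M (\<Union>?X) = (\<Sum>Q\<in>?X. emeasure M Q)"
    using emeasure_Union_disjoint[OF X_count X_disjoint X_sets] X_fin
    by (simp add: nn_integral_count_space_finite)
  also have "\<dots> \<le> (\<Sum>Q\<in>?X. ennreal (2 / t) * set_nn_integral M Q ?h)"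
  proof (rule sum_mono)
    fix Q assume "Q \<in> ?X"
    then have "Q \<in> F" "ennreal t < nn_average M Q f" using X by (auto simp: G_def)
    then show "emeasure M Q \<le> ennreal (2 / t) * set_nn_integral M Q ?h"
      using cubes t by (intro emeasure_le_upper_truncation_integral) auto
  qed
  also have "\<dots> = ennreal (2 / t) * set_nn_integral M (\<Union>?X) ?h"
    using X_fin nn_integral_Union_disjoint[OF X_count X_disjoint X_sets, of ?h]
    by (simp add: nn_integral_count_space_finite sum_distrib_left)
  also have "\<dots> \<le> ennreal (2 / t) * (\<integral>\<^sup>+x. ?h x \<partial>M)"
    by (intro mult_left_mono nn_integral_mono) (auto simp: indicator_def)
  finally show ?thesis by (simp add: G_def mult_left_mono)
qed

lemma epowr_eq_nn_integral_below:
  assumes "0 < p"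
  shows "y epowr p = (\<integral>\<^sup>+t. ennreal (p * t powr (p - 1)) * indicator {t. 0 < t \<and> ennreal t < y} t \<partial>lborel)"
proof -
  have "y epowr p = ennreal p * (ennreal (1 / p) * y epowr p)"
    using assms by (simp flip: ennreal_mult mult.assoc)
  also have "\<dots> = (\<integral>\<^sup>+t. ennreal p
      * (ennreal (t powr (p - 1)) * indicator {t. 0 < t \<and> ennreal t < y} t) \<partial>lborel)"
    using assms by (simp add: nn_integral_powr_below nn_integral_cmult)
  finally show ?thesis using assms by (simp add: ennreal_mult mult.assoc)
qed

lemma nn_integral_upper_truncation_layers:
  assumes "sigma_finite_measure M" and [measurable]: "f \<in> borel_measurable M" and p: "1 < p"
  shows "(\<integral>\<^sup>+t\<in>{0<..}. ennreal (t powr (p - 2)) * (\<integral>\<^sup>+x. upper_truncation (ennreal (t / 2)) f x \<partial>M) \<partial>lborel)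
    = ennreal (2 powr (p - 1) / (p - 1)) * (\<integral>\<^sup>+x. f x epowr p \<partial>M)"
proof -
  interpret sigma_finite_measure M by fact
  interpret pair_sigma_finite M lborel ..
  let ?B = "\<lambda>x t. f x * (ennreal (t powr (p - 1 - 1)) * indicator {t. 0 < t \<and> ennreal t < 2 * f x} t)"
  have "(\<integral>\<^sup>+t\<in>{0<..}. ennreal (t powr (p - 2)) * (\<integral>\<^sup>+x. upper_truncation (ennreal (t / 2)) f x \<partial>M) \<partial>lborel)
      = (\<integral>\<^sup>+t. \<integral>\<^sup>+x. ?B x t \<partial>M \<partial>lborel)"
  proof (rule nn_integral_cong)
    fix t :: real
    have "(\<integral>\<^sup>+x. ?B x t \<partial>M)
        = (\<integral>\<^sup>+x. ennreal (t powr (p - 2)) * upper_truncation (ennreal (t / 2)) f x * indicator {0<..} t \<partial>M)"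
      by (intro nn_integral_cong)
        (auto simp: ennreal_less_2_mult_iff upper_truncation_def indicator_def
          mult.commute[of _ "ennreal (t powr (p - 2))"])
    then show "ennreal (t powr (p - 2))
        * (\<integral>\<^sup>+x. upper_truncation (ennreal (t / 2)) f x \<partial>M) * indicator {0<..} t
        = (\<integral>\<^sup>+x. ?B x t \<partial>M)"
      by (simp add: nn_integral_cmult nn_integral_multc)
  qed
  also have "\<dots> = (\<integral>\<^sup>+x. \<integral>\<^sup>+t. ?B x t \<partial>lborel \<partial>M)"
    by (rule Fubini') (unfold indicator_def mem_Collect_eq, measurable)
  also have "\<dots> = (\<integral>\<^sup>+x. ennreal (2 powr (p - 1) / (p - 1)) * f x epowr p \<partial>M)"
  proof (rule nn_integral_cong)
    fix x
    have "(\<integral>\<^sup>+t. ?B x t \<partial>lborel) = f x * (ennreal (1 / (p - 1)) * (2 * f x) epowr (p - 1))"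
      using p nn_integral_powr_below[of "p - 1" "2 * f x"] by (simp add: nn_integral_cmult)
    also have "(2 * f x) epowr (p - 1) = ennreal (2 powr (p - 1)) * f x epowr (p - 1)"
      using epowr_mult[of 2 "f x" "p - 1"] epowr_ennreal[of 2 "p - 1"] by simp
    also have "f x * (ennreal (1 / (p - 1)) * (ennreal (2 powr (p - 1)) * f x epowr (p - 1)))
        = ennreal (2 powr (p - 1)) * ennreal (1 / (p - 1)) * (f x * f x epowr (p - 1))"
      by (simp only: mult_ac)
    also have "\<dots> = ennreal (2 powr (p - 1) / (p - 1)) * f x epowr p"
      using p epowr_add[of "f x" 1 "p - 1"] by (simp flip: ennreal_mult)
    finally show "(\<integral>\<^sup>+t. ?B x t \<partial>lborel) = ennreal (2 powr (p - 1) / (p - 1)) * f x epowr p" .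
  qed
  also have "\<dots> = ennreal (2 powr (p - 1) / (p - 1)) * (\<integral>\<^sup>+x. f x epowr p \<partial>M)"
    by (rule nn_integral_cmult) measurable
  finally show ?thesis .
qed

lemma carleson_layer_le:
  fixes t :: real
  assumes p: "1 < p" and F: "finite F" "cube_family M F"
    and E: "\<And>Q. Q \<in> F \<Longrightarrow> E Q \<in> sets M" "\<And>Q. Q \<in> F \<Longrightarrow> E Q \<subseteq> Q" "bounded_overlap N F E"
    and f: "f \<in> borel_measurable M"
  shows "(\<Sum>Q\<in>F. emeasure M (E Q)
        * (ennreal (p * t powr (p - 1)) * indicator {t. 0 < t \<and> ennreal t < nn_average M Q f} t))
    \<le> ennreal (2 * p * N)
        * (ennreal (t powr (p - 2)) * (\<integral>\<^sup>+x. upper_truncation (ennreal (t / 2)) f x \<partial>M) * indicator {0<..} t)"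
    (is "?sum \<le> _ * (_ * ?H * _)")
proof (cases "0 < t")
  case True
  have "?sum = ennreal (p * t powr (p - 1)) * (\<Sum>Q\<in>{Q\<in>F. ennreal t < nn_average M Q f}. emeasure M (E Q))"
    unfolding sum_distrib_left using True F(1)
    by (intro sum.mono_neutral_cong_right) (auto simp: mult_ac indicator_def)
  also have "\<dots> \<le> ennreal (p * t powr (p - 1)) * (of_nat N * (ennreal (2 / t) * ?H))"
    by (intro mult_left_mono carleson_level_set F E f True zero_le)
  also have "\<dots> = ennreal (p * N * (t powr (p - 1) * (2 / t))) * ?H"
    using p True by (simp add: ennreal_mult ennreal_of_nat_eq_real_of_nat mult_ac
        del: times_divide_eq_right times_divide_eq_left)
  also have "p * N * (t powr (p - 1) * (2 / t)) = 2 * p * N * t powr (p - 2)"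
    using True powr_diff[of t "p - 1" 1] by simp
  finally show ?thesis using p True by (simp add: ennreal_mult mult_ac)
qed simp

definition carleson_const :: "real \<Rightarrow> nat \<Rightarrow> real" where
  "carleson_const p N = real N * 2 powr p * p / (p - 1)"

theorem carleson_embedding:
  assumes M: "sigma_finite_measure M" and p: "1 < p" and F: "finite F" "cube_family M F"
    and E: "\<And>Q. Q \<in> F \<Longrightarrow> E Q \<in> sets M" "\<And>Q. Q \<in> F \<Longrightarrow> E Q \<subseteq> Q" "bounded_overlap N F E"
    and f [measurable]: "f \<in> borel_measurable M"
  shows "(\<Sum>Q\<in>F. emeasure M (E Q) * nn_average M Q f epowr p)
     \<le> ennreal (carleson_const p N) * (\<integral>\<^sup>+x. f x epowr p \<partial>M)"
proof -
  interpret sigma_finite_measure M by fact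
  let ?H = "\<lambda>t. \<integral>\<^sup>+x. upper_truncation (ennreal (t / 2)) f x \<partial>M"
  have [measurable]: "?H \<in> borel_measurable lborel"
    unfolding upper_truncation_def by measurable
  have "(\<Sum>Q\<in>F. emeasure M (E Q) * nn_average M Q f epowr p)
      = (\<integral>\<^sup>+t. (\<Sum>Q\<in>F. emeasure M (E Q)
          * (ennreal (p * t powr (p - 1)) * indicator {t. 0 < t \<and> ennreal t < nn_average M Q f} t)) \<partial>lborel)"
    using p by (simp add: epowr_eq_nn_integral_below nn_integral_sum nn_integral_cmult)
  also have "\<dots> \<le> (\<integral>\<^sup>+t. ennreal (2 * p * N)
      * (ennreal (t powr (p - 2)) * ?H t * indicator {0<..} t) \<partial>lborel)"
    using p F E f by (intro nn_integral_mono carleson_layer_le)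
  also have "\<dots> = ennreal (2 * p * N) * (ennreal (2 powr (p - 1) / (p - 1)) * (\<integral>\<^sup>+x. f x epowr p \<partial>M))"
    by (simp add: nn_integral_cmult nn_integral_upper_truncation_layers[OF M f p])
  also have "\<dots> = ennreal (2 * p * N * (2 powr (p - 1) / (p - 1))) * (\<integral>\<^sup>+x. f x epowr p \<partial>M)"
    using p by (simp add: ennreal_mult mult.assoc del: times_divide_eq_right)
  also have "2 * p * N * (2 powr (p - 1) / (p - 1)) = carleson_const p N"
    using p by (simp add: carleson_const_def powr_diff field_simps)
  finally show ?thesis .
qed

section \<open>Sparse operators and dual weights\<close>

definition sparse_parts :: "'a measure \<Rightarrow> real \<Rightarrow> nat \<Rightarrow> 'a set set \<Rightarrow> ('a set \<Rightarrow> 'a set) \<Rightarrow> bool" where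
  "sparse_parts M \<Lambda> N S E \<longleftrightarrow> bounded_overlap N S E \<and>
     (\<forall>Q\<in>S. E Q \<in> sets M \<and> E Q \<subseteq> Q \<and> ennreal \<Lambda> * emeasure M Q \<le> emeasure M (E Q))"

definition sparse_family :: "'a measure \<Rightarrow> real \<Rightarrow> nat \<Rightarrow> 'a set set \<Rightarrow> bool" where
  "sparse_family M \<Lambda> N S \<longleftrightarrow> cube_family M S \<and> (\<exists>E. sparse_parts M \<Lambda> N S E)"

lemma sparse_family_subset:
  assumes "sparse_family M \<Lambda> N S" "F \<subseteq> S"
  shows "sparse_family M \<Lambda> N F"
proof -
  obtain E where "sparse_parts M \<Lambda> N S E" using assms(1) by (auto simp: sparse_family_def)
  then have "sparse_parts M \<Lambda> N F E"
    using assms(2) bounded_overlap_subset by (auto simp: sparse_parts_def)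
  then show ?thesis
    using assms cube_family_subset by (auto simp: sparse_family_def)
qed

definition weighted_sparse_op ::
  "'a measure \<Rightarrow> 'a set set \<Rightarrow> ('a set \<Rightarrow> 'a \<Rightarrow> ennreal) \<Rightarrow> ('a set \<Rightarrow> 'a \<Rightarrow> ennreal)
     \<Rightarrow> ('a \<Rightarrow> ennreal) \<Rightarrow> 'a \<Rightarrow> ennreal" where
  "weighted_sparse_op M S k h f x =
     (\<integral>\<^sup>+Q. nn_average M Q (\<lambda>t. k Q t * f t) * (h Q x * indicator Q x) \<partial>count_space S)"

definition weighted_sparse_form ::
  "'a measure \<Rightarrow> 'a set set \<Rightarrow> ('a set \<Rightarrow> 'a \<Rightarrow> ennreal) \<Rightarrow> ('a set \<Rightarrow> 'a \<Rightarrow> ennreal)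
     \<Rightarrow> ('a \<Rightarrow> ennreal) \<Rightarrow> ('a \<Rightarrow> ennreal) \<Rightarrow> ennreal" where
  "weighted_sparse_form M S k h f g =
     (\<integral>\<^sup>+Q. (\<integral>\<^sup>+t\<in>Q. k Q t * f t \<partial>M) * (\<integral>\<^sup>+t\<in>Q. h Q t * g t \<partial>M) / emeasure M Q \<partial>count_space S)"

abbreviation sparse_op :: "'a measure \<Rightarrow> 'a set set \<Rightarrow> ('a \<Rightarrow> ennreal) \<Rightarrow> 'a \<Rightarrow> ennreal" where
  "sparse_op M S \<equiv> weighted_sparse_op M S (\<lambda>_ _. 1) (\<lambda>_ _. 1)"

abbreviation sparse_form :: "'a measure \<Rightarrow> 'a set set \<Rightarrow> ('a \<Rightarrow> ennreal) \<Rightarrow> ('a \<Rightarrow> ennreal) \<Rightarrow> ennreal" where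
  "sparse_form M S \<equiv> weighted_sparse_form M S (\<lambda>_ _. 1) (\<lambda>_ _. 1)"

lemma weighted_sparse_form_commute: "weighted_sparse_form M S k h f g = weighted_sparse_form M S h k g f"
  by (simp add: weighted_sparse_form_def mult.commute)

lemma weighted_sparse_form_mono_set:
  "F \<subseteq> S \<Longrightarrow> weighted_sparse_form M F k h f g \<le> weighted_sparse_form M S k h f g"
  unfolding weighted_sparse_form_def by (rule nn_integral_count_space_mono_set)

lemma weighted_sparse_form_finite:
  "finite F \<Longrightarrow> weighted_sparse_form M F k h f g
    = (\<Sum>Q\<in>F. (\<integral>\<^sup>+t\<in>Q. k Q t * f t \<partial>M) * (\<integral>\<^sup>+t\<in>Q. h Q t * g t \<partial>M) / emeasure M Q)"
  by (simp add: weighted_sparse_form_def nn_integral_count_space_finite)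

lemma weighted_sparse_form_le_finite_subfamilies:
  assumes "countable S"
    and finite_le: "\<And>F. finite F \<Longrightarrow> F \<subseteq> S \<Longrightarrow> weighted_sparse_form M F k h f g \<le> C"
  shows "weighted_sparse_form M S k h f g \<le> C"
  unfolding weighted_sparse_form_def using assms(1)
proof (rule nn_integral_count_space_le_finite_sums)
  fix F assume F: "finite F" "F \<subseteq> S"
  show "(\<Sum>Q\<in>F. (\<integral>\<^sup>+t\<in>Q. k Q t * f t \<partial>M) * (\<integral>\<^sup>+t\<in>Q. h Q t * g t \<partial>M) / emeasure M Q) \<le> C"
    using finite_le[OF F] by (simp only: weighted_sparse_form_finite[OF F(1)])
qed

lemma nn_integral_count_space_kernel:
  fixes c :: "'i \<Rightarrow> ennreal"
  assumes S: "countable S" and h: "\<And>i. i \<in> S \<Longrightarrow> h i \<in> borel_measurable M" and g: "g \<in> borel_measurable M"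
  shows "(\<integral>\<^sup>+x. (\<integral>\<^sup>+i. c i * h i x \<partial>count_space S) * g x \<partial>M)
       = (\<integral>\<^sup>+i. c i * (\<integral>\<^sup>+x. h i x * g x \<partial>M) \<partial>count_space S)"
proof -
  have "(\<integral>\<^sup>+x. (\<integral>\<^sup>+i. c i * h i x \<partial>count_space S) * g x \<partial>M)
      = (\<integral>\<^sup>+x. \<integral>\<^sup>+i. c i * (h i x * g x) \<partial>count_space S \<partial>M)"
    by (subst nn_integral_multc[symmetric]) (auto simp: mult.assoc)
  also have "\<dots> = (\<integral>\<^sup>+i. \<integral>\<^sup>+x. c i * (h i x * g x) \<partial>M \<partial>count_space S)"
    using h g by (intro nn_integral_count_space_nn_integral S borel_measurable_times_ennreal) auto
  also have "\<dots> = (\<integral>\<^sup>+i. c i * (\<integral>\<^sup>+x. h i x * g x \<partial>M) \<partial>count_space S)"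
    using h g by (intro nn_integral_cong nn_integral_cmult borel_measurable_times_ennreal) auto
  finally show ?thesis .
qed

lemma borel_measurable_weighted_sparse_op:
  assumes "countable S" "S \<subseteq> sets M" "\<And>Q. Q \<in> S \<Longrightarrow> h Q \<in> borel_measurable M"
  shows "weighted_sparse_op M S k h f \<in> borel_measurable M"
  unfolding weighted_sparse_op_def[abs_def] using assms
  by (intro borel_measurable_nn_integral_count_space borel_measurable_times_ennreal
      borel_measurable_const borel_measurable_indicator) auto

lemma nn_integral_weighted_sparse_op:
  assumes S: "countable S" "S \<subseteq> sets M" and h: "\<And>Q. Q \<in> S \<Longrightarrow> h Q \<in> borel_measurable M"
    and g: "g \<in> borel_measurable M"
  shows "(\<integral>\<^sup>+x. weighted_sparse_op M S k h f x * g x \<partial>M) = weighted_sparse_form M S k h f g"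
proof -
  have "(\<integral>\<^sup>+x. weighted_sparse_op M S k h f x * g x \<partial>M)
      = (\<integral>\<^sup>+Q. nn_average M Q (\<lambda>t. k Q t * f t) * (\<integral>\<^sup>+x. h Q x * indicator Q x * g x \<partial>M) \<partial>count_space S)"
    unfolding weighted_sparse_op_def using S h
    by (intro nn_integral_count_space_kernel g borel_measurable_times_ennreal
        borel_measurable_indicator) auto
  also have "\<dots> = weighted_sparse_form M S k h f g"
    unfolding weighted_sparse_form_def nn_average_def
    by (intro nn_integral_cong) (simp add: divide_ennreal_def mult_ac)
  finally show ?thesis .
qed

lemma (in sigma_finite_measure) nn_integral_le_of_finite_minorants:
  assumes [measurable]: "F \<in> borel_measurable M"
    and minorant_le: "\<And>G. G \<in> borel_measurable M \<Longrightarrow> (\<And>x. G x \<le> F x)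
      \<Longrightarrow> (\<integral>\<^sup>+x. G x \<partial>M) < top \<Longrightarrow> (\<integral>\<^sup>+x. G x \<partial>M) \<le> C"
  shows "(\<integral>\<^sup>+x. F x \<partial>M) \<le> C"
proof -
  obtain u :: "'a \<Rightarrow> real" where u [measurable]: "u \<in> borel_measurable M" and u_pos: "\<And>x. 0 < u x"
    and u_int: "integrable M u"
    using obtain_positive_integrable_function by metis
  let ?G = "\<lambda>n x. inf (F x) (of_nat n * ennreal (u x))"
  have "(SUP n. of_nat n * ennreal (u x)) = top" for x
    using u_pos[of x]
    by (simp add: SUP_mult_right_ennreal[symmetric] ennreal_SUP_of_nat_eq_top ennreal_top_mult)
  then have "F x = (SUP n. ?G n x)" for x
    by (simp only: inf_SUP[symmetric] inf_top_right)
  then have "(\<integral>\<^sup>+x. F x \<partial>M) = (\<integral>\<^sup>+x. (SUP n. ?G n x) \<partial>M)" by simp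
  also have "\<dots> = (SUP n. \<integral>\<^sup>+x. ?G n x \<partial>M)"
    by (intro nn_integral_monotone_convergence_SUP)
      (auto simp: incseq_def le_fun_def intro!: le_infI2 mult_right_mono)
  also have "\<dots> \<le> C"
  proof (intro SUP_least minorant_le)
    fix n
    have "(\<integral>\<^sup>+x. ?G n x \<partial>M) \<le> (\<integral>\<^sup>+x. of_nat n * ennreal (u x) \<partial>M)"
      by (intro nn_integral_mono) simp
    also have "\<dots> < top"
      using u_int u_pos
      by (simp add: nn_integral_cmult nn_integral_eq_integral less_imp_le ennreal_mult_less_top of_nat_less_top)
    finally show "(\<integral>\<^sup>+x. ?G n x \<partial>M) < top" .
  qed auto
  finally show ?thesis .
qed

locale dual_weights = sigma_finite_measure M for M :: "'a measure" +
  fixes p q :: real and v s :: "'a \<Rightarrow> ennreal"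
  assumes p_gt_1: "1 < p" and q_gt_1: "1 < q" and conjugate_exponents: "1 / p + 1 / q = 1"
    and v_measurable [measurable]: "v \<in> borel_measurable M"
    and s_measurable [measurable]: "s \<in> borel_measurable M"
    and dual: "\<And>x. v x epowr (1 / p) * s x epowr (1 / q) = 1"

sublocale dual_weights \<subseteq> swap: dual_weights M q p s v
proof unfold_locales
  show "1 / q + 1 / p = 1" using conjugate_exponents by (subst add.commute)
  show "s x epowr (1 / q) * v x epowr (1 / p) = 1" for x using dual by (subst mult.commute)
qed (fact p_gt_1 q_gt_1 s_measurable v_measurable)+

context dual_weights
begin

abbreviation \<nu> :: "'a measure" where "\<nu> \<equiv> density M v"

abbreviation \<sigma> :: "'a measure" where "\<sigma> \<equiv> density M s"

definition form_bounded :: "(('a \<Rightarrow> ennreal) \<Rightarrow> ('a \<Rightarrow> ennreal) \<Rightarrow> ennreal) \<Rightarrow> ennreal \<Rightarrow> bool" where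
  "form_bounded B C \<longleftrightarrow> (\<forall>f\<in>borel_measurable M. \<forall>g\<in>borel_measurable M.
     B f g \<le> C * (nn_Lp_norm \<nu> p f * nn_Lp_norm \<sigma> q g))"

definition Ap_ratio :: "'a set \<Rightarrow> ennreal" where
  "Ap_ratio Q = emeasure \<nu> Q / emeasure M Q * (emeasure \<sigma> Q / emeasure M Q) epowr (p - 1)"

lemma conjugate_exponent_eqs:
  shows "(p - 1) * (q - 1) = 1" and "p / q = p - 1" and "1 + q / p = q" and "1 / (p - 1) = q - 1"
proof -
  have "p + q = p * q"
    using conjugate_exponents p_gt_1 q_gt_1 by (simp add: field_simps)
  then have products: "(p - 1) * (q - 1) = 1" "p = (p - 1) * q" "q = (q - 1) * p"
    by (simp_all add: algebra_simps)
  show "(p - 1) * (q - 1) = 1" by (fact products(1))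
  show "p / q = p - 1"
    using products(2) q_gt_1 by (simp add: divide_eq_eq)
  have "q / p = q - 1" using products(3) p_gt_1 by (simp add: divide_eq_eq)
  then show "1 + q / p = q" by simp
  show "1 / (p - 1) = q - 1" using products(1) p_gt_1 by (simp add: divide_eq_eq mult.commute)
qed

lemma v_pos: "0 < v x" and v_finite: "v x < top"
proof -
  have "v x \<noteq> 0" "v x \<noteq> top"
    using dual[of x] by (auto simp: ennreal_top_mult split: if_splits)
  then show "0 < v x" "v x < top" by (auto simp: less_top zero_less_iff_neq_zero)
qed

lemma s_mult_v_epowr: "s x * v x epowr (q / p) = 1"
proof -
  have "1 = (v x epowr (1 / p) * s x epowr (1 / q)) epowr q" by (simp add: dual)
  also have "\<dots> = s x * v x epowr (q / p)"
    using q_gt_1 by (simp only: epowr_mult epowr_powr_inverse epowr_epowr) (simp add: mult.commute)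
  finally show ?thesis ..
qed

lemma s_mult_v_epowr_q: "s x * v x epowr q = v x"
proof -
  have "s x * v x epowr q = v x * (s x * v x epowr (q / p))"
    by (metis conjugate_exponent_eqs(3) epowr_add epowr_one mult.left_commute)
  then show ?thesis by (simp add: s_mult_v_epowr)
qed

lemma emeasure_\<nu>_pos:
  assumes "Q \<in> sets M" "0 < emeasure M Q"
  shows "0 < emeasure \<nu> Q"
proof (rule ccontr)
  assume "\<not> 0 < emeasure \<nu> Q"
  then have "(\<integral>\<^sup>+x\<in>Q. v x \<partial>M) = 0" using assms(1) by (simp add: emeasure_density)
  then have "Q \<in> null_sets M"
    using assms(1) v_pos by (intro null_if_pos_func_has_zero_nn_int[of v]) auto
  then show False using assms(2) by (simp add: null_setsD1)
qed

end

context dual_weights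
begin

text \<open>Test against \<open>g = G\<^sup>1\<^sup>/\<^sup>q v\<^sup>1\<^sup>/\<^sup>p\<close> for integrable minorants \<open>G\<close> of \<open>h\<^sup>p v\<close>.\<close>

theorem nn_Lp_norm_le_dual:
  assumes [measurable]: "h \<in> borel_measurable M"
    and bound: "\<And>g. g \<in> borel_measurable M \<Longrightarrow> (\<integral>\<^sup>+x. h x * g x \<partial>M) \<le> K * nn_Lp_norm \<sigma> q g"
  shows "nn_Lp_norm \<nu> p h \<le> K"
proof -
  have "(\<integral>\<^sup>+x. v x * h x epowr p \<partial>M) \<le> K epowr p"
  proof (rule nn_integral_le_of_finite_minorants)
    fix G assume [measurable]: "G \<in> borel_measurable M" and G_le: "\<And>x. G x \<le> v x * h x epowr p"
      and G_fin: "(\<integral>\<^sup>+x. G x \<partial>M) < top"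
    define g where "g x = G x epowr (1 / q) * v x epowr (1 / p)" for x
    have g [measurable]: "g \<in> borel_measurable M" unfolding g_def by measurable
    have "s x * g x epowr q = G x" for x
      using q_gt_1 s_mult_v_epowr[of x] by (simp add: g_def epowr_mult epowr_epowr mult.left_commute)
    then have g_norm: "nn_Lp_norm \<sigma> q g = (\<integral>\<^sup>+x. G x \<partial>M) epowr (1 / q)"
      by (simp add: nn_Lp_norm_def nn_integral_density)
    have "G x \<le> h x * g x" for x
    proof -
      have "G x = G x epowr (1 / p) * G x epowr (1 / q)"
        using conjugate_exponents by (simp flip: epowr_add)
      also have "\<dots> \<le> (v x * h x epowr p) epowr (1 / p) * G x epowr (1 / q)"
        using p_gt_1 G_le by (intro mult_right_mono epowr_mono) auto
      also have "\<dots> = h x * g x"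
        using p_gt_1 by (simp add: g_def epowr_mult mult_ac)
      finally show ?thesis .
    qed
    then have "(\<integral>\<^sup>+x. G x \<partial>M) \<le> (\<integral>\<^sup>+x. h x * g x \<partial>M)" by (rule nn_integral_mono)
    also have "\<dots> \<le> K * (\<integral>\<^sup>+x. G x \<partial>M) epowr (1 / q)"
      using bound[OF g] by (simp add: g_norm)
    finally show "(\<integral>\<^sup>+x. G x \<partial>M) \<le> K epowr p"
      by (rule le_epowr_conjugate[OF G_fin p_gt_1 conjugate_exponents])
  qed measurable
  then have "nn_Lp_norm \<nu> p h \<le> (K epowr p) epowr (1 / p)"
    unfolding nn_Lp_norm_def using p_gt_1 by (intro epowr_mono) (simp_all add: nn_integral_density)
  then show ?thesis using p_gt_1 by simp
qed

lemma form_boundedD: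
  "form_bounded B C \<Longrightarrow> f \<in> borel_measurable M \<Longrightarrow> g \<in> borel_measurable M
    \<Longrightarrow> B f g \<le> C * (nn_Lp_norm \<nu> p f * nn_Lp_norm \<sigma> q g)"
  by (simp add: form_bounded_def)

lemma form_bounded_mono: "form_bounded B C \<Longrightarrow> C \<le> C' \<Longrightarrow> form_bounded B C'"
  unfolding form_bounded_def by (meson mult_right_mono order_trans zero_le)

lemma form_bounded_subset:
  "form_bounded (weighted_sparse_form M S k h) C \<Longrightarrow> F \<subseteq> S \<Longrightarrow> form_bounded (weighted_sparse_form M F k h) C"
  unfolding form_bounded_def by (meson weighted_sparse_form_mono_set order_trans)

lemma form_bounded_finite_subfamilies:
  assumes "countable S"
    and "\<And>F. finite F \<Longrightarrow> F \<subseteq> S \<Longrightarrow> form_bounded (weighted_sparse_form M F k h) C"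
  shows "form_bounded (weighted_sparse_form M S k h) C"
  unfolding form_bounded_def
proof (intro ballI)
  fix f g :: "'a \<Rightarrow> ennreal"
  assume fg: "f \<in> borel_measurable M" "g \<in> borel_measurable M"
  show "weighted_sparse_form M S k h f g \<le> C * (nn_Lp_norm \<nu> p f * nn_Lp_norm \<sigma> q g)"
  proof (rule weighted_sparse_form_le_finite_subfamilies[OF assms(1)])
    fix F assume "finite F" "F \<subseteq> S"
    then show "weighted_sparse_form M F k h f g \<le> C * (nn_Lp_norm \<nu> p f * nn_Lp_norm \<sigma> q g)"
      by (rule form_boundedD[OF assms(2) fg])
  qed
qed

lemma swap_form_bounded_iff:
  "swap.form_bounded (weighted_sparse_form M S k h) C \<longleftrightarrow> form_bounded (weighted_sparse_form M S h k) C"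
  unfolding form_bounded_def swap.form_bounded_def
  by (subst weighted_sparse_form_commute) (auto simp: mult.commute)

lemma nn_Lp_norm_weighted_sparse_op_le:
  assumes S: "countable S" "S \<subseteq> sets M" and h: "\<And>Q. Q \<in> S \<Longrightarrow> h Q \<in> borel_measurable M"
    and bounded: "form_bounded (weighted_sparse_form M S k h) C" and f: "f \<in> borel_measurable M"
  shows "nn_Lp_norm \<nu> p (weighted_sparse_op M S k h f) \<le> C * nn_Lp_norm \<nu> p f"
proof (rule nn_Lp_norm_le_dual)
  show "weighted_sparse_op M S k h f \<in> borel_measurable M"
    using S h by (rule borel_measurable_weighted_sparse_op)
  show "(\<integral>\<^sup>+x. weighted_sparse_op M S k h f x * g x \<partial>M) \<le> C * nn_Lp_norm \<nu> p f * nn_Lp_norm \<sigma> q g"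
    if "g \<in> borel_measurable M" for g
    using form_boundedD[OF bounded f that]
    by (simp add: nn_integral_weighted_sparse_op S h that mult.assoc)
qed

lemma sparse_form_compose_le:
  assumes S: "form_bounded (sparse_form M S) C"
    and T: "countable T" "T \<subseteq> sets M" "form_bounded (sparse_form M T) C'"
    and f: "f \<in> borel_measurable M" and g: "g \<in> borel_measurable M"
  shows "sparse_form M S (sparse_op M T f) g \<le> C * C' * (nn_Lp_norm \<nu> p f * nn_Lp_norm \<sigma> q g)"
proof -
  have "sparse_form M S (sparse_op M T f) g \<le> C * (nn_Lp_norm \<nu> p (sparse_op M T f) * nn_Lp_norm \<sigma> q g)"
    using T g by (intro form_boundedD[OF S] borel_measurable_weighted_sparse_op) auto
  also have "\<dots> \<le> C * (C' * nn_Lp_norm \<nu> p f * nn_Lp_norm \<sigma> q g)"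
    using T f by (intro mult_left_mono mult_right_mono nn_Lp_norm_weighted_sparse_op_le) auto
  finally show ?thesis by (simp only: mult_ac)
qed

lemma emeasure_le_dual_masses:
  assumes [measurable]: "Q \<in> sets M"
  shows "emeasure M Q \<le> emeasure \<nu> Q epowr (1 / p) * emeasure \<sigma> Q epowr (1 / q)"
proof -
  have cutoff_powr: "(w x epowr (1 / r) * indicator Q x) epowr r = w x * indicator Q x"
    if "1 < r" for w r and x :: 'a
    using that by (auto simp: indicator_def)
  have "emeasure M Q = (\<integral>\<^sup>+x. (v x epowr (1 / p) * indicator Q x) * (s x epowr (1 / q) * indicator Q x) \<partial>M)"
    using dual by (auto simp flip: nn_integral_indicator intro!: nn_integral_cong split: split_indicator)
  also have "\<dots> \<le> nn_Lp_norm M p (\<lambda>x. v x epowr (1 / p) * indicator Q x)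
      * nn_Lp_norm M q (\<lambda>x. s x epowr (1 / q) * indicator Q x)"
    by (rule nn_integral_Holder[OF p_gt_1 q_gt_1 conjugate_exponents]) measurable
  finally show ?thesis
    by (simp add: nn_Lp_norm_def cutoff_powr p_gt_1 q_gt_1 emeasure_density)
qed

lemma swap_Ap_ratio: "swap.Ap_ratio Q = Ap_ratio Q epowr (q - 1)"
  using conjugate_exponent_eqs(1)
  by (simp add: Ap_ratio_def swap.Ap_ratio_def epowr_mult epowr_epowr mult.commute)

lemma one_le_Ap_ratio:
  assumes "Q \<in> sets M" "0 < emeasure M Q" "emeasure M Q < top"
  shows "1 \<le> Ap_ratio Q"
proof -
  let ?m = "emeasure M Q"
  have "1 = (?m * inverse ?m) epowr p"
    using assms by (simp flip: divide_ennreal_def)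
  also have "\<dots> \<le> (emeasure \<nu> Q epowr (1 / p) * emeasure \<sigma> Q epowr (1 / q) * inverse ?m) epowr p"
    using p_gt_1 assms(1) by (intro epowr_mono mult_right_mono emeasure_le_dual_masses) auto
  also have "\<dots> = emeasure \<nu> Q * emeasure \<sigma> Q epowr (p - 1) * (inverse ?m epowr (1 + (p - 1)))"
    using p_gt_1 conjugate_exponent_eqs(2) by (simp add: epowr_mult epowr_epowr)
  also have "\<dots> = Ap_ratio Q"
    by (simp only: Ap_ratio_def divide_ennreal_def epowr_mult epowr_add epowr_one mult_ac)
  finally show ?thesis .
qed

lemma Ap_ratio_finite_masses:
  assumes "Q \<in> sets M" "0 < emeasure M Q" "emeasure M Q < top" "Ap_ratio Q < top"
  shows "emeasure \<nu> Q < top" "emeasure \<sigma> Q < top"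
proof -
  have "0 < emeasure \<nu> Q / emeasure M Q" "0 < emeasure \<sigma> Q / emeasure M Q"
    using assms emeasure_\<nu>_pos swap.emeasure_\<nu>_pos by (auto simp: ennreal_zero_less_divide)
  then have "emeasure \<nu> Q / emeasure M Q < top" "emeasure \<sigma> Q / emeasure M Q < top"
    using assms(4) by (auto simp: Ap_ratio_def ennreal_mult_less_top)
  moreover have "y < top" if "y / emeasure M Q < top" for y
    using that assms(3)
    by (cases "y = top") (auto simp: ennreal_top_divide less_top[symmetric] split: if_splits)
  ultimately show "emeasure \<nu> Q < top" "emeasure \<sigma> Q < top" by auto
qed

lemma Ap_ratio_le_doubling:
  assumes sets: "I \<in> sets M" and Q_subset_I: "Q \<subseteq> I"
    and Q: "0 < emeasure M Q" and I: "emeasure M I < top" and doubling: "emeasure M I \<le> \<kappa> * emeasure M Q"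
  shows "Ap_ratio Q \<le> \<kappa> epowr p * Ap_ratio I"
proof -
  have density_le: "emeasure N Q / emeasure M Q \<le> \<kappa> * (emeasure N I / emeasure M I)"
    if "sets N = sets M" for N
  proof (rule divide_le_posI_ennreal[OF Q])
    have "0 < emeasure M I" using Q emeasure_mono[OF Q_subset_I sets] by (rule less_le_trans)
    then have "emeasure N I = emeasure M I * (emeasure N I / emeasure M I)"
      using I by (simp add: ennreal_times_divide mult.commute[of "emeasure M I"] mult_divide_eq_ennreal)
    also have "\<dots> \<le> (\<kappa> * emeasure M Q) * (emeasure N I / emeasure M I)"
      using doubling by (rule mult_right_mono) simp
    finally show "emeasure N Q \<le> emeasure M Q * (\<kappa> * (emeasure N I / emeasure M I))"
      using emeasure_mono[OF Q_subset_I, of N] sets that by (simp add: mult_ac)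
  qed
  have "Ap_ratio Q \<le> \<kappa> * (emeasure \<nu> I / emeasure M I) * (\<kappa> * (emeasure \<sigma> I / emeasure M I)) epowr (p - 1)"
    unfolding Ap_ratio_def using p_gt_1 by (intro mult_mono epowr_mono density_le) auto
  also have "\<dots> = \<kappa> epowr (1 + (p - 1)) * Ap_ratio I"
    by (simp only: Ap_ratio_def epowr_mult epowr_add epowr_one mult_ac)
  finally show ?thesis by simp
qed

lemma sigma_finite_\<sigma>: "sigma_finite_measure \<sigma>"
  using swap.v_finite by (subst sigma_finite_iff_density_finite) (auto simp: less_top)

lemma weighted_carleson_embedding:
  assumes F: "finite F" "cube_family M F" "\<And>Q. Q \<in> F \<Longrightarrow> emeasure \<sigma> Q < top"
    and E: "\<And>Q. Q \<in> F \<Longrightarrow> E Q \<in> sets M" "\<And>Q. Q \<in> F \<Longrightarrow> E Q \<subseteq> Q" "bounded_overlap N F E"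
    and f [measurable]: "f \<in> borel_measurable M"
  shows "(\<Sum>Q\<in>F. emeasure \<sigma> (E Q) * (set_nn_integral M Q f / emeasure \<sigma> Q) epowr p)
    \<le> ennreal (carleson_const p N) * nn_Lp_norm \<nu> p f epowr p"
proof -
  let ?g = "\<lambda>x. f x * v x epowr (q / p)"
  have s_mult: "s x * (?g x * y) = f x * y" for x y
    using s_mult_v_epowr[of x] by (metis mult.assoc mult.commute mult_1)
  have s_mult_powr: "s x * ?g x epowr p = v x * f x epowr p" for x
    using p_gt_1 s_mult_v_epowr_q[of x]
    by (simp add: epowr_mult epowr_epowr mult.commute[of "f x epowr p"] flip: mult.assoc)
  have "cube_family \<sigma> F"
    using F(2,3) swap.emeasure_\<nu>_pos by (auto simp: cube_family_def)
  then have "(\<Sum>Q\<in>F. emeasure \<sigma> (E Q) * nn_average \<sigma> Q ?g epowr p)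
      \<le> ennreal (carleson_const p N) * (\<integral>\<^sup>+x. ?g x epowr p \<partial>\<sigma>)"
    using F(1) E p_gt_1 sigma_finite_\<sigma> by (intro carleson_embedding) auto
  moreover have "nn_average \<sigma> Q ?g = set_nn_integral M Q f / emeasure \<sigma> Q" if "Q \<in> F" for Q
    using cube_familyD(4)[OF F(2) that] by (simp add: nn_average_def nn_integral_density s_mult)
  ultimately show ?thesis
    using p_gt_1 by (simp add: nn_Lp_norm_powr nn_integral_density s_mult_powr)
qed

end

section \<open>Weighted bounds for sparse forms\<close>

text \<open>This is where the \<open>A\<^sub>p\<close> characteristic enters linearly: for \<open>2 \<le> p\<close> the total masses of a cube are
  traded for the masses of its sparse part.\<close>

lemma sparse_mass_inequality:
  fixes u t m uE tE K \<Lambda> p q :: real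
  assumes exponents_pq: "2 \<le> p" "1 / p + 1 / q = 1"
    and pos: "0 < u" "0 < t" "0 < m" "0 < uE" "0 < tE" "0 < \<Lambda>"
    and Ap_le: "u / m * (t / m) powr (p - 1) \<le> K"
    and E: "\<Lambda> * m \<le> uE powr (1 / p) * tE powr (1 / q)" and tE_le: "tE \<le> t"
  shows "u * t / m \<le> \<Lambda> powr (1 - p) * K * (tE powr (1 / p) * uE powr (1 / q))"
proof -
  let ?R = "tE powr (1 / p) * uE powr (1 / q)"
  have q: "1 / q = (p - 1) / p" using exponents_pq by (simp add: field_simps)
  have "(p - 1) / q = (p - 1) * ((p - 1) / p)" unfolding q[symmetric] by simp
  also have "\<dots> = 1 / p + (p - 2)" using exponents_pq(1) by (simp add: field_simps)
  finally have exponents: "(p - 1) / p = 1 / q" "(p - 1) / q = 1 / p + (p - 2)" using q by simp_all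
  have "m \<le> uE powr (1 / p) * tE powr (1 / q) / \<Lambda>"
    using E pos by (simp add: field_simps)
  then have "m powr (p - 1) \<le> (uE powr (1 / p) * tE powr (1 / q) / \<Lambda>) powr (p - 1)"
    using pos exponents_pq by (intro powr_mono2) auto
  also have "\<dots> = \<Lambda> powr (1 - p) * ?R * tE powr (p - 2)"
    using pos powr_minus_divide[of \<Lambda> "p - 1"]
    by (simp add: powr_divide powr_mult powr_powr exponents powr_add mult_ac)
  also have "\<dots> \<le> \<Lambda> powr (1 - p) * ?R * t powr (p - 2)"
    using tE_le pos exponents_pq by (intro mult_left_mono powr_mono2) auto
  finally have m_le: "m powr (p - 1) \<le> \<Lambda> powr (1 - p) * ?R * t powr (p - 2)" .
  have "u * t / m * t powr (p - 2) = u / m * (t / m) powr (p - 1) * m powr (p - 1)"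
    using pos powr_add[of t 1 "p - 2"] by (simp add: powr_divide)
  also have "\<dots> \<le> K * (\<Lambda> powr (1 - p) * ?R * t powr (p - 2))"
    using pos by (intro mult_mono' Ap_le m_le) auto
  finally have "u * t / m * t powr (p - 2) \<le> \<Lambda> powr (1 - p) * K * ?R * t powr (p - 2)"
    by (simp only: mult_ac)
  then show ?thesis using pos by (simp only: mult_le_cancel_right_pos powr_gt_zero)
qed

lemma ennreal_positive_finiteE:
  assumes "0 < x" "x < top"
  obtains r where "0 < r" "x = ennreal r"
  using assms by (cases x) auto

context dual_weights
begin

lemma masses_le_sparse_part:
  assumes p: "2 \<le> p" and Q: "Q \<in> sets M" "0 < emeasure M Q" "emeasure M Q < top"
    and E: "E \<in> sets M" "E \<subseteq> Q" "ennreal \<Lambda> * emeasure M Q \<le> emeasure M E" and \<Lambda>: "0 < \<Lambda>"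
    and Ap: "Ap_ratio Q \<le> K" "K < top"
  shows "emeasure \<nu> Q * emeasure \<sigma> Q / emeasure M Q
    \<le> ennreal (\<Lambda> powr (1 - p)) * K * (emeasure \<sigma> E epowr (1 / p) * emeasure \<nu> E epowr (1 / q))"
proof -
  have finite: "emeasure \<nu> Q < top" "emeasure \<sigma> Q < top"
    using Ap_ratio_finite_masses[OF Q] Ap by auto
  obtain m where m: "0 < m" "emeasure M Q = ennreal m"
    using ennreal_positive_finiteE[OF Q(2,3)] .
  obtain u where u: "0 < u" "emeasure \<nu> Q = ennreal u"
    using ennreal_positive_finiteE[OF emeasure_\<nu>_pos[OF Q(1,2)] finite(1)] .
  obtain t where t: "0 < t" "emeasure \<sigma> Q = ennreal t"
    using ennreal_positive_finiteE[OF swap.emeasure_\<nu>_pos[OF Q(1,2)] finite(2)] .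
  have "0 < ennreal \<Lambda> * emeasure M Q" using \<Lambda> Q(2) by (simp add: ennreal_zero_less_mult_iff)
  then have E_pos: "0 < emeasure M E" using E(3) by (rule less_le_trans)
  have E_le: "emeasure \<nu> E \<le> emeasure \<nu> Q" "emeasure \<sigma> E \<le> emeasure \<sigma> Q"
    using E(2) Q(1) by (auto intro!: emeasure_mono)
  obtain uE where uE: "0 < uE" "emeasure \<nu> E = ennreal uE"
    using ennreal_positive_finiteE[OF emeasure_\<nu>_pos[OF E(1) E_pos] le_less_trans[OF E_le(1) finite(1)]] .
  obtain tE where tE: "0 < tE" "emeasure \<sigma> E = ennreal tE"
    using ennreal_positive_finiteE[OF swap.emeasure_\<nu>_pos[OF E(1) E_pos] le_less_trans[OF E_le(2) finite(2)]] .
  obtain k where k: "0 \<le> k" "K = ennreal k" using Ap(2) by (cases K) auto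
  have "ennreal (\<Lambda> * m) \<le> ennreal (uE powr (1 / p) * tE powr (1 / q))"
    using E(3) emeasure_le_dual_masses[OF E(1)] \<Lambda> m uE tE by (simp add: ennreal_mult)
  then have "\<Lambda> * m \<le> uE powr (1 / p) * tE powr (1 / q)"
    using uE tE by simp
  moreover have "u / m * (t / m) powr (p - 1) \<le> k"
    using Ap(1) m u t k by (simp add: Ap_ratio_def divide_ennreal flip: ennreal_mult)
  ultimately have "u * t / m \<le> \<Lambda> powr (1 - p) * k * (tE powr (1 / p) * uE powr (1 / q))"
    using p conjugate_exponents m u t uE tE \<Lambda> E_le(2) by (intro sparse_mass_inequality) auto
  then have ennreal_mass_le: "ennreal (u * t / m) \<le> ennreal (\<Lambda> powr (1 - p) * k * (tE powr (1 / p) * uE powr (1 / q)))"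
    by (rule ennreal_leI)
  have "emeasure \<nu> Q * emeasure \<sigma> Q / emeasure M Q = ennreal (u * t / m)"
    using m u t by (simp add: divide_ennreal flip: ennreal_mult)
  then show ?thesis
    using ennreal_mass_le uE tE k by (simp add: ennreal_mult)
qed

lemma sparse_term_le:
  assumes p: "2 \<le> p" and Q: "Q \<in> sets M" "0 < emeasure M Q" "emeasure M Q < top"
    and E: "E \<in> sets M" "E \<subseteq> Q" "ennreal \<Lambda> * emeasure M Q \<le> emeasure M E" and \<Lambda>: "0 < \<Lambda>"
    and Ap: "Ap_ratio Q \<le> K" "K < top"
  shows "set_nn_integral M Q f * set_nn_integral M Q g / emeasure M Q
    \<le> ennreal (\<Lambda> powr (1 - p)) * K *
       ((emeasure \<sigma> E epowr (1 / p) * (set_nn_integral M Q f / emeasure \<sigma> Q))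
        * (emeasure \<nu> E epowr (1 / q) * (set_nn_integral M Q g / emeasure \<nu> Q)))"
proof -
  let ?a = "set_nn_integral M Q f / emeasure \<sigma> Q" and ?b = "set_nn_integral M Q g / emeasure \<nu> Q"
  have "emeasure \<nu> Q < top" "emeasure \<sigma> Q < top" "0 < emeasure \<nu> Q" "0 < emeasure \<sigma> Q"
    using Ap_ratio_finite_masses[OF Q] Ap emeasure_\<nu>_pos[OF Q(1,2)] swap.emeasure_\<nu>_pos[OF Q(1,2)] by auto
  then have masses: "?a * emeasure \<sigma> Q = set_nn_integral M Q f" "?b * emeasure \<nu> Q = set_nn_integral M Q g"
    by (simp_all add: ennreal_divide_times)
  have "set_nn_integral M Q f * set_nn_integral M Q g / emeasure M Q
      = (?a * emeasure \<sigma> Q) * (?b * emeasure \<nu> Q) / emeasure M Q"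
    by (simp only: masses)
  also have "\<dots> = ?a * ?b * (emeasure \<nu> Q * emeasure \<sigma> Q / emeasure M Q)"
    by (simp only: divide_ennreal_def mult_ac)
  also have "\<dots> \<le> ?a * ?b
      * (ennreal (\<Lambda> powr (1 - p)) * K * (emeasure \<sigma> E epowr (1 / p) * emeasure \<nu> E epowr (1 / q)))"
    by (intro mult_left_mono masses_le_sparse_part assms) simp
  finally show ?thesis by (simp only: mult_ac)
qed

lemma sparse_part_sum_le:
  assumes F: "finite F" "cube_family M F" "sparse_parts M \<Lambda> N F E" "\<And>Q. Q \<in> F \<Longrightarrow> emeasure \<sigma> Q < top"
    and f: "f \<in> borel_measurable M"
  shows "(\<Sum>Q\<in>F. (emeasure \<sigma> (E Q) epowr (1 / p) * (set_nn_integral M Q f / emeasure \<sigma> Q)) epowr p)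
        epowr (1 / p)
    \<le> ennreal (carleson_const p N powr (1 / p)) * nn_Lp_norm \<nu> p f"
proof -
  have "(\<Sum>Q\<in>F. emeasure \<sigma> (E Q) * (set_nn_integral M Q f / emeasure \<sigma> Q) epowr p)
      \<le> ennreal (carleson_const p N) * nn_Lp_norm \<nu> p f epowr p"
    using F f by (intro weighted_carleson_embedding) (auto simp: sparse_parts_def)
  then have "(\<Sum>Q\<in>F. emeasure \<sigma> (E Q) * (set_nn_integral M Q f / emeasure \<sigma> Q) epowr p) epowr (1 / p)
      \<le> (ennreal (carleson_const p N) * nn_Lp_norm \<nu> p f epowr p) epowr (1 / p)"
    using p_gt_1 by (intro epowr_mono) auto
  then show ?thesis
    using p_gt_1 by (simp add: epowr_mult carleson_const_def)
qed

definition Ap_on :: "'a set set \<Rightarrow> ennreal \<Rightarrow> bool" where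
  "Ap_on S K \<longleftrightarrow> K < top \<and> (\<forall>Q\<in>S. Ap_ratio Q \<le> K)"

lemma Ap_on_subset: "Ap_on S K \<Longrightarrow> F \<subseteq> S \<Longrightarrow> Ap_on F K"
  by (auto simp: Ap_on_def)

end

definition sparse_const :: "real \<Rightarrow> real \<Rightarrow> real \<Rightarrow> nat \<Rightarrow> real" where
  "sparse_const p q \<Lambda> N = max (\<Lambda> powr (1 - p)) (\<Lambda> powr (1 - q))
     * (carleson_const p N powr (1 / p) * carleson_const q N powr (1 / q))"

lemma sparse_const_commute: "sparse_const p q \<Lambda> N = sparse_const q p \<Lambda> N"
  by (simp add: sparse_const_def max.commute mult.commute)

lemma sparse_const_nonneg: "0 \<le> sparse_const p q \<Lambda> N"
  by (simp add: sparse_const_def le_max_iff_disj)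

context dual_weights
begin

lemma swap_Ap_on:
  assumes "Ap_on S K"
  shows "swap.Ap_on S (K epowr (q - 1))"
  using assms q_gt_1 by (auto simp: Ap_on_def swap.Ap_on_def swap_Ap_ratio intro!: epowr_mono)

lemma finite_sparse_form_le:
  assumes p: "2 \<le> p" and F: "finite F" "cube_family M F" "sparse_parts M \<Lambda> N F E"
    and \<Lambda>: "0 < \<Lambda>" and Ap: "Ap_on F K"
    and f: "f \<in> borel_measurable M" and g: "g \<in> borel_measurable M"
  shows "sparse_form M F f g \<le> ennreal (sparse_const p q \<Lambda> N) * K * (nn_Lp_norm \<nu> p f * nn_Lp_norm \<sigma> q g)"
proof -
  let ?a = "\<lambda>Q. set_nn_integral M Q f / emeasure \<sigma> Q" and ?b = "\<lambda>Q. set_nn_integral M Q g / emeasure \<nu> Q"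
  let ?x = "\<lambda>Q. emeasure \<sigma> (E Q) epowr (1 / p) * ?a Q" and ?y = "\<lambda>Q. emeasure \<nu> (E Q) epowr (1 / q) * ?b Q"
  note cubes = cube_familyD(4-6)[OF F(2)]
  have E: "E Q \<in> sets M" "E Q \<subseteq> Q" "ennreal \<Lambda> * emeasure M Q \<le> emeasure M (E Q)" if "Q \<in> F" for Q
    using F(3) that by (auto simp: sparse_parts_def)
  have K: "K < top" "\<And>Q. Q \<in> F \<Longrightarrow> Ap_ratio Q \<le> K" using Ap by (auto simp: Ap_on_def)
  have finite: "emeasure \<nu> Q < top" "emeasure \<sigma> Q < top" if "Q \<in> F" for Q
    using Ap_ratio_finite_masses[of Q] cubes[OF that] le_less_trans[OF K(2)[OF that] K(1)] by auto
  have "(\<Sum>Q\<in>F. ?x Q * ?y Q) \<le> (\<Sum>Q\<in>F. ?x Q epowr p) epowr (1 / p) * (\<Sum>Q\<in>F. ?y Q epowr q) epowr (1 / q)"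
    using F(1) by (intro sum_Holder_ennreal p_gt_1 q_gt_1 conjugate_exponents)
  also have "\<dots> \<le> (ennreal (carleson_const p N powr (1 / p)) * nn_Lp_norm \<nu> p f)
      * (ennreal (carleson_const q N powr (1 / q)) * nn_Lp_norm \<sigma> q g)"
    using F finite f g by (intro mult_mono sparse_part_sum_le swap.sparse_part_sum_le) auto
  finally have sum_le: "(\<Sum>Q\<in>F. ?x Q * ?y Q) \<le> \<dots>" .
  have "sparse_form M F f g = (\<Sum>Q\<in>F. set_nn_integral M Q f * set_nn_integral M Q g / emeasure M Q)"
    using F(1) by (simp add: weighted_sparse_form_finite)
  also have "\<dots> \<le> ennreal (\<Lambda> powr (1 - p)) * K * (\<Sum>Q\<in>F. ?x Q * ?y Q)"
    unfolding sum_distrib_left using cubes E K \<Lambda> by (intro sum_mono sparse_term_le p) auto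
  also have "\<dots> \<le> ennreal (\<Lambda> powr (1 - p)) * K
      * ((ennreal (carleson_const p N powr (1 / p)) * nn_Lp_norm \<nu> p f)
      * (ennreal (carleson_const q N powr (1 / q)) * nn_Lp_norm \<sigma> q g))"
    by (intro mult_left_mono sum_le) simp
  also have "\<dots> =
      ennreal (\<Lambda> powr (1 - p) * (carleson_const p N powr (1 / p) * carleson_const q N powr (1 / q)))
        * K * (nn_Lp_norm \<nu> p f * nn_Lp_norm \<sigma> q g)"
    by (simp add: ennreal_mult mult_ac)
  also have "\<dots> \<le> ennreal (sparse_const p q \<Lambda> N) * K * (nn_Lp_norm \<nu> p f * nn_Lp_norm \<sigma> q g)"
    unfolding sparse_const_def by (intro mult_right_mono ennreal_leI) auto
  finally show ?thesis .
qed

lemma sparse_form_bounded_ge_2: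
  assumes p: "2 \<le> p" and S: "sparse_family M \<Lambda> N S" and \<Lambda>: "0 < \<Lambda>" and Ap: "Ap_on S K"
  shows "form_bounded (sparse_form M S) (ennreal (sparse_const p q \<Lambda> N) * K)"
proof (rule form_bounded_finite_subfamilies)
  show "countable S" using S cube_familyD(1) by (auto simp: sparse_family_def)
  fix F assume F: "finite F" "F \<subseteq> S"
  then obtain E where "cube_family M F" "sparse_parts M \<Lambda> N F E"
    using sparse_family_subset[OF S] by (auto simp: sparse_family_def)
  then show "form_bounded (sparse_form M F) (ennreal (sparse_const p q \<Lambda> N) * K)"
    unfolding form_bounded_def using p F(1) \<Lambda> Ap_on_subset[OF Ap F(2)]
    by (intro ballI finite_sparse_form_le)
qed

end

theorem (in dual_weights) sparse_form_bounded:
  assumes S: "sparse_family M \<Lambda> N S" and \<Lambda>: "0 < \<Lambda>" and Ap: "Ap_on S K"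
  shows "form_bounded (sparse_form M S) (ennreal (sparse_const p q \<Lambda> N) * K epowr max 1 (1 / (p - 1)))"
proof (cases "2 \<le> p")
  case True
  then have "max 1 (1 / (p - 1)) = 1" by simp
  then show ?thesis using sparse_form_bounded_ge_2[OF True S \<Lambda> Ap] by simp
next
  case False
  then have "1 \<le> 1 / (p - 1)" using p_gt_1 by simp
  then have q: "2 \<le> q" "max 1 (1 / (p - 1)) = q - 1"
    using conjugate_exponent_eqs(4) by auto
  have "swap.form_bounded (sparse_form M S) (ennreal (sparse_const q p \<Lambda> N) * K epowr (q - 1))"
    using q(1) S \<Lambda> by (intro swap.sparse_form_bounded_ge_2 swap_Ap_on Ap)
  then show ?thesis
    by (simp add: swap_form_bounded_iff q(2) sparse_const_commute)
qed

section \<open>Dyadic trees and differentiation\<close>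

lemma AE_le_if_set_nn_integral_le:
  assumes h [measurable]: "h \<in> borel_measurable M" and A [measurable]: "A \<in> sets M"
    and A_K_finite: "emeasure M A < top" "K < top"
    and integral_le: "\<And>B. B \<in> sets M \<Longrightarrow> B \<subseteq> A \<Longrightarrow> (\<integral>\<^sup>+x\<in>B. h x \<partial>M) \<le> K * emeasure M B"
  shows "AE x in M. x \<in> A \<longrightarrow> h x \<le> K"
proof -
  define B where "B = {x\<in>space M. x \<in> A \<and> K < h x}"
  have B [measurable]: "B \<in> sets M" unfolding B_def by measurable
  have B_subset_A: "B \<subseteq> A" by (auto simp: B_def)
  have "K * emeasure M B < top"
    using emeasure_mono[OF B_subset_A A] A_K_finite by (auto simp: ennreal_mult_less_top)
  moreover have "K * emeasure M B + (\<integral>\<^sup>+x\<in>B. h x - K \<partial>M) = (\<integral>\<^sup>+x\<in>B. K + (h x - K) \<partial>M)"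
    by (simp add: nn_set_integral_add nn_integral_cmult_indicator)
  moreover have "\<dots> = (\<integral>\<^sup>+x\<in>B. h x \<partial>M)"
    by (intro nn_integral_cong) (auto simp: B_def indicator_def add_diff_inverse_ennreal)
  ultimately have "K * emeasure M B + (\<integral>\<^sup>+x\<in>B. h x - K \<partial>M) \<le> K * emeasure M B + 0" "K * emeasure M B \<noteq> \<infinity>"
    using integral_le[OF B B_subset_A] by auto
  then have "(\<integral>\<^sup>+x\<in>B. h x - K \<partial>M) = 0"
    by (simp only: ennreal_add_left_cancel_le) simp
  then have "B \<in> null_sets M"
    by (intro null_if_pos_func_has_zero_nn_int[of "\<lambda>x. h x - K"]) (auto simp: B_def diff_gr0_ennreal)
  then have "AE x in M. x \<notin> B" by (rule AE_not_in)
  then show ?thesis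
    by (rule AE_mp) (auto simp: B_def not_less)
qed

locale dyadic_tree =
  fixes M :: "'a::{second_countable_topology, complete_space} measure"
    and D :: "int \<Rightarrow> 'a set set" and X :: "'a set" and \<kappa> :: real
  assumes sets_M [measurable_cong, simp]: "sets M = sets borel"
    and cube_sets: "\<And>k Q. Q \<in> D k \<Longrightarrow> Q \<in> sets borel"
    and cube_emeasure_pos: "\<And>k Q. Q \<in> D k \<Longrightarrow> 0 < emeasure M Q"
    and cube_emeasure_finite: "\<And>k Q. Q \<in> D k \<Longrightarrow> emeasure M Q < top"
    and cover: "\<And>k. \<Union>(D k) = X"
    and disjoint_level: "\<And>k P Q. P \<in> D k \<Longrightarrow> Q \<in> D k \<Longrightarrow> P \<noteq> Q \<Longrightarrow> P \<inter> Q = {}"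
    and nested: "\<And>k l P Q. k \<le> l \<Longrightarrow> Q \<in> D l \<Longrightarrow> P \<in> D k \<Longrightarrow> Q \<subseteq> P \<or> Q \<inter> P = {}"
    and countable_level: "\<And>k. countable (D k)"
    and doubling: "\<And>k P Q. P \<in> D (k + 1) \<Longrightarrow> Q \<in> D k \<Longrightarrow> P \<subseteq> Q \<Longrightarrow> emeasure M Q \<le> ennreal \<kappa> * emeasure M P"
    and \<kappa>_ge_1: "1 \<le> \<kappa>"
    and shrink: "\<And>x U. open U \<Longrightarrow> x \<in> U \<Longrightarrow> x \<in> X \<Longrightarrow> \<exists>k. \<forall>j\<ge>k. \<forall>Q\<in>D j. x \<in> Q \<longrightarrow> Q \<subseteq> U"
begin

lemma space_M [simp]: "space M = UNIV"
  using sets_eq_imp_space_eq[OF sets_M] by simp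

definition cubes :: "'a set set" where "cubes = (\<Union>k. D k)"

lemma cubesI: "Q \<in> D k \<Longrightarrow> Q \<in> cubes"
  by (auto simp: cubes_def)

lemma cubesE: assumes "Q \<in> cubes" obtains k where "Q \<in> D k"
  using assms by (auto simp: cubes_def)

lemma finer_subset: "k \<le> l \<Longrightarrow> Q \<in> D l \<Longrightarrow> P \<in> D k \<Longrightarrow> Q \<inter> P \<noteq> {} \<Longrightarrow> Q \<subseteq> P"
  using nested by blast

lemma cube_family_cubes: "cube_family M cubes"
  unfolding cube_family_def
proof (intro conjI ballI)
  show "laminar cubes"
    unfolding laminar_def
  proof (intro ballI)
    fix P Q assume "P \<in> cubes" "Q \<in> cubes"
    then obtain k l where "P \<in> D k" "Q \<in> D l" by (metis cubesE)
    then show "P \<subseteq> Q \<or> Q \<subseteq> P \<or> P \<inter> Q = {}"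
      using nested[of k l Q P] nested[of l k P Q] by (cases "k \<le> l") auto
  qed
qed (auto simp: cubes_def countable_level cube_sets cube_emeasure_pos cube_emeasure_finite)

lemmas countable_cubes = cube_familyD(1)[OF cube_family_cubes]
  and laminar_cubes = cube_familyD(2)[OF cube_family_cubes]
  and cube_emeasure = cube_familyD(5,6)[OF cube_family_cubes]

lemma cube_measurable [measurable]: "Q \<in> cubes \<Longrightarrow> Q \<in> sets borel"
  using cube_familyD(4)[OF cube_family_cubes] by simp

lemma cube_emeasure_eq: "Q \<in> cubes \<Longrightarrow> emeasure M Q = ennreal (measure M Q)"
  using cube_emeasure(2)[of Q] by (intro emeasure_eq_ennreal_measure) auto

lemma cube_measure_pos: "Q \<in> cubes \<Longrightarrow> 0 < measure M Q"
  using cube_emeasure(1)[of Q] cube_emeasure_eq[of Q] by simp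

lemma cube_nonempty: "Q \<in> cubes \<Longrightarrow> Q \<noteq> {}"
  using cube_emeasure(1)[of Q] by auto

lemma cube_subset: "Q \<in> cubes \<Longrightarrow> Q \<subseteq> X"
  using cover by (blast elim: cubesE)

lemma cube_at: assumes "x \<in> X" obtains Q where "Q \<in> D k" "x \<in> Q"
  using assms cover[of k] by blast

lemma finite_cubes_between:
  assumes "P \<in> cubes" "R \<in> cubes"
  shows "finite {Q\<in>cubes. P \<subseteq> Q \<and> Q \<subseteq> R}"
proof -
  obtain k m where k: "P \<in> D k" and m: "R \<in> D m" using assms by (metis cubesE)
  obtain x where x: "x \<in> P" "x \<in> X" using cube_nonempty cube_subset assms(1) by blast
  have "{Q\<in>cubes. P \<subseteq> Q \<and> Q \<subseteq> R} \<subseteq> {P, R} \<union> (\<Union>j\<in>{m..k}. {Q\<in>D j. x \<in> Q})"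
  proof
    fix Q assume "Q \<in> {Q\<in>cubes. P \<subseteq> Q \<and> Q \<subseteq> R}"
    then obtain j where j: "Q \<in> D j" "P \<subseteq> Q" "Q \<subseteq> R" by (auto elim: cubesE)
    consider "j < m" | "k < j" | "m \<le> j" "j \<le> k" by linarith
    then show "Q \<in> {P, R} \<union> (\<Union>j\<in>{m..k}. {Q\<in>D j. x \<in> Q})"
    proof cases
      case 1
      then have "R \<subseteq> Q" using finer_subset[of j m R Q] j m x by auto
      then show ?thesis using j by auto
    next
      case 2
      then have "Q \<subseteq> P" using finer_subset[of k j Q P] j k x by auto
      then show ?thesis using j by auto
    qed (use j x in auto)
  qed
  moreover have "finite {Q\<in>D j. x \<in> Q}" for j
  proof -
    obtain Q where "Q \<in> D j" "x \<in> Q" using cube_at[OF x(2)] .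
    then have "{Q\<in>D j. x \<in> Q} \<subseteq> {Q}" using disjoint_level by blast
    then show ?thesis by (rule finite_subset) simp
  qed
  ultimately show ?thesis by (auto intro: finite_subset)
qed

lemma cube_parent:
  assumes "P \<in> cubes" "R \<in> cubes" "P \<subset> R"
  obtains Q where "Q \<in> cubes" "P \<subset> Q" "Q \<subseteq> R" "emeasure M Q \<le> ennreal \<kappa> * emeasure M P"
proof -
  obtain m where m: "R \<in> D m" using assms(2) by (rule cubesE)
  obtain x where x: "x \<in> P" "x \<in> X" using cube_nonempty cube_subset assms(1) by blast
  have level: "m < j" if "P \<in> D j" for j
    using finer_subset[of j m R P] that m x(1) assms(3) by (cases "m < j") auto
  define n where "n = (LEAST n. P \<in> D (m + int n))"
  obtain j where j: "P \<in> D j" using assms(1) by (rule cubesE)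
  then have "P \<in> D (m + int (nat (j - m)))" using level[OF j] by simp
  then have n: "P \<in> D (m + int n)" unfolding n_def by (rule LeastI)
  then have n_pos: "0 < n" using level[OF n] by simp
  then have not_level: "P \<notin> D (m + int (n - 1))" unfolding n_def by (intro not_less_Least) simp
  obtain Q where Q: "Q \<in> D (m + int (n - 1))" "x \<in> Q" using cube_at[OF x(2)] .
  have succ: "m + int (n - 1) + 1 = m + int n" using n_pos by simp
  have P_subset_Q: "P \<subseteq> Q" using finer_subset[of "m + int (n - 1)" "m + int n" P Q] n Q x by auto
  show ?thesis
  proof (rule that)
    show "Q \<in> cubes" using Q(1) by (rule cubesI)
    show "P \<subset> Q" using P_subset_Q Q(1) not_level by auto
    show "Q \<subseteq> R" using finer_subset[of m "m + int (n - 1)" Q R] m Q x assms(3) by auto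
    show "emeasure M Q \<le> ennreal \<kappa> * emeasure M P"
      using doubling[of P "m + int (n - 1)" Q] n Q P_subset_Q succ by simp
  qed
qed

lemma open_cover_by_disjoint_cubes:
  assumes R: "R \<in> D m" and B: "B \<subseteq> R" "B \<subseteq> U" and U: "open U"
  obtains G where "G \<subseteq> cubes" "disjoint G" "B \<subseteq> \<Union>G" "\<Union>G \<subseteq> U \<inter> R"
    "\<And>Q. Q \<in> G \<Longrightarrow> \<exists>k\<ge>m. Q \<in> D k \<and> Q \<inter> B \<noteq> {}"
proof
  define W where "W = {Q. (\<exists>k\<ge>m. Q \<in> D k) \<and> Q \<subseteq> U \<and> Q \<inter> B \<noteq> {}}"
  have W_cubes: "W \<subseteq> cubes" by (auto simp: W_def intro: cubesI)
  have W_sub: "Q \<subseteq> R" if "Q \<in> W" for Q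
    using that R B(1) finer_subset[of m _ Q R] by (auto simp: W_def)
  have "finite {P\<in>W. Q \<subseteq> P}" if "Q \<in> W" for Q
  proof (rule finite_subset)
    show "{P\<in>W. Q \<subseteq> P} \<subseteq> {P\<in>cubes. Q \<subseteq> P \<and> P \<subseteq> R}" using W_cubes W_sub by blast
    show "finite {P\<in>cubes. Q \<subseteq> P \<and> P \<subseteq> R}"
      using that W_cubes cubesI[OF R] by (intro finite_cubes_between) auto
  qed
  then have Union: "\<Union>(maximal_members W) = \<Union>W" by (rule Union_maximal_members)
  show "maximal_members W \<subseteq> cubes" using maximal_members_subset W_cubes by blast
  show "disjoint (maximal_members W)"
    using laminar_subset[OF laminar_cubes W_cubes] by (rule disjoint_maximal_members)
  show "B \<subseteq> \<Union>(maximal_members W)"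
    unfolding Union
  proof
    fix x assume x: "x \<in> B"
    then have x_in_X: "x \<in> X" using B(1) R cover by blast
    obtain k where k: "\<forall>j\<ge>k. \<forall>Q\<in>D j. x \<in> Q \<longrightarrow> Q \<subseteq> U"
      using shrink[OF U _ x_in_X] B(2) x by blast
    obtain Q where Q: "Q \<in> D (max k m)" "x \<in> Q" using cube_at[OF x_in_X] .
    then have "Q \<subseteq> U" using k by (meson max.cobounded1)
    then have "Q \<in> W" using Q x unfolding W_def by (auto intro: exI[of _ "max k m"])
    then show "x \<in> \<Union>W" using Q(2) by blast
  qed
  show "\<Union>(maximal_members W) \<subseteq> U \<inter> R"
    unfolding Union using W_sub by (auto simp: W_def)
  show "\<exists>k\<ge>m. Q \<in> D k \<and> Q \<inter> B \<noteq> {}" if "Q \<in> maximal_members W" for Q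
  proof -
    have "Q \<in> W" using that maximal_members_subset by blast
    then show ?thesis by (auto simp: W_def)
  qed
qed

lemma set_nn_integral_le_if_averages_le:
  assumes R: "R \<in> D m" and B: "B \<subseteq> R" "B \<in> sets borel" and h [measurable]: "h \<in> borel_measurable borel"
    and K: "0 < K" "K < top"
    and averages_le: "\<And>x k Q. x \<in> B \<Longrightarrow> m \<le> k \<Longrightarrow> Q \<in> D k \<Longrightarrow> x \<in> Q \<Longrightarrow> set_nn_integral M Q h \<le> K * emeasure M Q"
  shows "set_nn_integral M B h \<le> K * emeasure M B"
proof -
  have [measurable]: "R \<in> sets borel" using R by (rule cube_sets)
  define N where "N = density M (indicator R)"
  have N_eq: "emeasure N A = emeasure M (A \<inter> R)" if "A \<in> sets borel" for A
    unfolding N_def using that by (simp add: emeasure_restricted Int_commute)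
  have "set_nn_integral M B h / K \<le> emeasure N U" if U: "B \<subseteq> U" "open U" for U
  proof (rule divide_le_posI_ennreal[OF K(1)])
    obtain G where G: "G \<subseteq> cubes" "disjoint G" "B \<subseteq> \<Union>G" "\<Union>G \<subseteq> U \<inter> R"
      and G_meets: "\<And>Q. Q \<in> G \<Longrightarrow> \<exists>k\<ge>m. Q \<in> D k \<and> Q \<inter> B \<noteq> {}"
      using open_cover_by_disjoint_cubes[OF R B(1) U] by metis
    have G_sets: "G \<subseteq> sets M" and G_count: "countable G"
      using G(1) cube_measurable countable_cubes by (auto intro: countable_subset)
    have "set_nn_integral M B h \<le> set_nn_integral M (\<Union>G) h"
      using G(3) by (rule nn_set_integral_set_mono)
    also have "\<dots> = (\<integral>\<^sup>+Q. set_nn_integral M Q h \<partial>count_space G)"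
      using G_count G(2) G_sets by (intro nn_integral_Union_disjoint) simp_all
    also have "\<dots> \<le> (\<integral>\<^sup>+Q. K * emeasure M Q \<partial>count_space G)"
      using G_meets averages_le by (intro nn_integral_mono) fastforce
    also have "\<dots> = K * emeasure M (\<Union>G)"
      using emeasure_Union_disjoint[OF G_count G(2) G_sets] by (simp add: nn_integral_cmult)
    also have "\<dots> \<le> K * emeasure N U"
      using G(4) U(2) by (auto simp: N_eq intro!: mult_left_mono emeasure_mono)
    finally show "set_nn_integral M B h \<le> K * emeasure N U" .
  qed
  moreover have "emeasure N B = (INF U \<in> {U. B \<subseteq> U \<and> open U}. emeasure N U)"
    using N_eq[of UNIV] cube_emeasure_finite[OF R] B(2)
    by (intro outer_regular) (auto simp: N_def)
  ultimately have "set_nn_integral M B h / K \<le> emeasure N B"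
    by (auto intro: INF_greatest)
  then have "set_nn_integral M B h / K * K \<le> emeasure M B * K"
    using B N_eq[of B] by (intro mult_right_mono) (auto simp: Int_absorb2)
  moreover have "set_nn_integral M B h / K * K = set_nn_integral M B h"
    using K by (simp add: ennreal_divide_times)
  ultimately show ?thesis by (simp add: mult.commute)
qed

theorem AE_le_if_dyadic_averages_le:
  assumes R: "R \<in> D m" and A: "A \<subseteq> R" "A \<in> sets borel" and h [measurable]: "h \<in> borel_measurable borel"
    and K: "0 < K" "K < top"
    and averages_le: "\<And>x k Q. x \<in> A \<Longrightarrow> m \<le> k \<Longrightarrow> Q \<in> D k \<Longrightarrow> x \<in> Q \<Longrightarrow> set_nn_integral M Q h \<le> K * emeasure M Q"
  shows "AE x in M. x \<in> A \<longrightarrow> h x \<le> K"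
proof (rule AE_le_if_set_nn_integral_le)
  show "emeasure M A < top"
    using emeasure_mono[OF A(1), of M] cube_sets[OF R] cube_emeasure_finite[OF R]
    by (auto intro: le_less_trans)
  show "set_nn_integral M B h \<le> K * emeasure M B" if "B \<in> sets M" "B \<subseteq> A" for B
  proof (rule set_nn_integral_le_if_averages_le[OF R _ _ h K])
    show "B \<subseteq> R" "B \<in> sets borel" using that A(1) by auto
    show "set_nn_integral M Q h \<le> K * emeasure M Q" if "x \<in> B" "m \<le> k" "Q \<in> D k" "x \<in> Q" for x k Q
      using averages_le[of x k Q] that \<open>B \<subseteq> A\<close> by auto
  qed
qed (use A K in auto)

end

section \<open>Stopping cubes of a function of bounded mean oscillation\<close>

definition set_average :: "'a measure \<Rightarrow> 'a set \<Rightarrow> ('a \<Rightarrow> real) \<Rightarrow> real" where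
  "set_average M Q b = (\<integral>t\<in>Q. b t \<partial>M) / measure M Q"

lemma set_nn_integral_abs_diff_triangle:
  fixes b :: "'a \<Rightarrow> real"
  assumes [measurable]: "Q \<in> sets M" "b \<in> borel_measurable M"
  shows "(\<integral>\<^sup>+t\<in>Q. ennreal \<bar>b t - a\<bar> \<partial>M) \<le> (\<integral>\<^sup>+t\<in>Q. ennreal \<bar>b t - c\<bar> \<partial>M) + ennreal \<bar>c - a\<bar> * emeasure M Q"
proof -
  have "(\<integral>\<^sup>+t\<in>Q. ennreal \<bar>b t - a\<bar> \<partial>M) \<le> (\<integral>\<^sup>+t\<in>Q. ennreal \<bar>b t - c\<bar> + ennreal \<bar>c - a\<bar> \<partial>M)"
    by (intro nn_integral_mono) (auto simp: indicator_def simp flip: ennreal_plus intro!: ennreal_leI)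
  also have "\<dots> = (\<integral>\<^sup>+t\<in>Q. ennreal \<bar>b t - c\<bar> \<partial>M) + ennreal \<bar>c - a\<bar> * emeasure M Q"
    by (simp add: nn_set_integral_add nn_integral_cmult_indicator)
  finally show ?thesis .
qed

lemma ennreal_abs_set_integral_le:
  fixes h :: "'a \<Rightarrow> real"
  shows "ennreal \<bar>\<integral>t\<in>Q. h t \<partial>M\<bar> \<le> (\<integral>\<^sup>+t\<in>Q. ennreal \<bar>h t\<bar> \<partial>M)"
proof (cases "set_integrable M Q h")
  case True
  have "ennreal (norm (\<integral>t. indicator Q t *\<^sub>R h t \<partial>M)) \<le> (\<integral>\<^sup>+t. ennreal (norm (indicator Q t *\<^sub>R h t)) \<partial>M)"
    using True unfolding set_integrable_def by (rule integral_norm_bound_ennreal)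
  also have "\<dots> = (\<integral>\<^sup>+t\<in>Q. ennreal \<bar>h t\<bar> \<partial>M)"
    by (intro nn_integral_cong) (auto simp: indicator_def)
  finally show ?thesis by (simp add: set_lebesgue_integral_def)
next
  case False
  then show ?thesis
    by (simp add: set_lebesgue_integral_def set_integrable_def not_integrable_integral_eq)
qed

lemma set_average_diff_le:
  fixes b :: "'a \<Rightarrow> real"
  assumes [measurable]: "Q \<in> sets M" and Q: "0 < emeasure M Q" "emeasure M Q < top"
    and b: "set_integrable M Q b"
  shows "ennreal \<bar>set_average M Q b - c\<bar> * emeasure M Q \<le> (\<integral>\<^sup>+t\<in>Q. ennreal \<bar>b t - c\<bar> \<partial>M)"
proof -
  obtain m where m: "0 < m" "emeasure M Q = ennreal m"
    using ennreal_positive_finiteE[OF Q] .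
  then have measure: "measure M Q = m" by (simp add: measure_def)
  have c: "set_integrable M Q (\<lambda>t. c)"
    using Q(2) by (auto simp: set_integrable_def integrable_indicator_iff)
  have "(\<integral>t\<in>Q. b t - c \<partial>M) = (\<integral>t\<in>Q. b t \<partial>M) - c * m"
    using set_integral_diff(2)[OF b c] Q(2) by (simp add: set_lebesgue_integral_def measure mult.commute)
  also have "\<dots> = (set_average M Q b - c) * m"
    using m(1) by (simp add: set_average_def measure field_simps)
  finally have "ennreal \<bar>set_average M Q b - c\<bar> * emeasure M Q = ennreal \<bar>\<integral>t\<in>Q. b t - c \<partial>M\<bar>"
    using m by (simp add: abs_mult ennreal_mult)
  then show ?thesis using ennreal_abs_set_integral_le[of M Q "\<lambda>t. b t - c"] by simp
qed

lemma mean_oscillation_le_twice: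
  fixes b :: "'a \<Rightarrow> real"
  assumes "Q \<in> sets M" "0 < emeasure M Q" "emeasure M Q < top" "set_integrable M Q b" "b \<in> borel_measurable M"
  shows "(\<integral>\<^sup>+t\<in>Q. ennreal \<bar>b t - set_average M Q b\<bar> \<partial>M) \<le> 2 * (\<integral>\<^sup>+t\<in>Q. ennreal \<bar>b t - c\<bar> \<partial>M)"
proof -
  have "(\<integral>\<^sup>+t\<in>Q. ennreal \<bar>b t - set_average M Q b\<bar> \<partial>M)
      \<le> (\<integral>\<^sup>+t\<in>Q. ennreal \<bar>b t - c\<bar> \<partial>M) + ennreal \<bar>c - set_average M Q b\<bar> * emeasure M Q"
    using assms by (intro set_nn_integral_abs_diff_triangle)
  also have "\<dots> \<le> (\<integral>\<^sup>+t\<in>Q. ennreal \<bar>b t - c\<bar> \<partial>M) + (\<integral>\<^sup>+t\<in>Q. ennreal \<bar>b t - c\<bar> \<partial>M)"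
    using assms by (subst abs_minus_commute) (intro add_left_mono set_average_diff_le)
  finally show ?thesis by (simp add: mult_2)
qed

locale bmo_tree = dyadic_tree M D X \<kappa>
  for M :: "'a::{second_countable_topology, complete_space} measure" and D X \<kappa> +
  fixes b :: "'a \<Rightarrow> real" and B :: real
  assumes b_measurable [measurable]: "b \<in> borel_measurable borel"
    and b_integrable: "\<And>k Q. Q \<in> D k \<Longrightarrow> set_integrable M Q b"
    and B_pos: "0 < B"
    and oscillation: "\<And>k Q. Q \<in> D k \<Longrightarrow>
      (\<integral>\<^sup>+t\<in>Q. ennreal \<bar>b t - set_average M Q b\<bar> \<partial>M) \<le> ennreal B * emeasure M Q"
begin

abbreviation avg :: "'a set \<Rightarrow> real" where "avg Q \<equiv> set_average M Q b"

lemma cube_oscillation: "Q \<in> cubes \<Longrightarrow> (\<integral>\<^sup>+t\<in>Q. ennreal \<bar>b t - avg Q\<bar> \<partial>M) \<le> ennreal B * emeasure M Q"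
  using oscillation by (auto elim: cubesE)

lemma avg_diff_le: "Q \<in> cubes \<Longrightarrow> ennreal \<bar>avg Q - c\<bar> * emeasure M Q \<le> (\<integral>\<^sup>+t\<in>Q. ennreal \<bar>b t - c\<bar> \<partial>M)"
  using b_integrable cube_emeasure cube_measurable by (intro set_average_diff_le) (auto elim: cubesE)

lemma avg_parent_diff_le:
  assumes P: "P \<in> cubes" and Q: "Q \<in> cubes" and parent: "P \<subseteq> Q" "emeasure M Q \<le> ennreal \<kappa> * emeasure M P"
  shows "\<bar>avg P - avg Q\<bar> \<le> \<kappa> * B"
proof -
  have "ennreal \<bar>avg P - avg Q\<bar> * emeasure M P \<le> (\<integral>\<^sup>+t\<in>P. ennreal \<bar>b t - avg Q\<bar> \<partial>M)"
    using P by (rule avg_diff_le)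
  also have "\<dots> \<le> (\<integral>\<^sup>+t\<in>Q. ennreal \<bar>b t - avg Q\<bar> \<partial>M)"
    using parent(1) by (rule nn_set_integral_set_mono)
  also have "\<dots> \<le> ennreal B * emeasure M Q"
    using Q by (rule cube_oscillation)
  also have "\<dots> \<le> ennreal B * (ennreal \<kappa> * emeasure M P)"
    using parent(2) by (intro mult_left_mono) auto
  finally have "ennreal (\<bar>avg P - avg Q\<bar> * measure M P) \<le> ennreal (\<kappa> * B * measure M P)"
    using B_pos \<kappa>_ge_1 by (simp add: cube_emeasure_eq[OF P] ennreal_mult mult_ac)
  then show ?thesis
    using cube_measure_pos[OF P] B_pos \<kappa>_ge_1 by simp
qed

definition stopped :: "'a set \<Rightarrow> 'a set set" where
  "stopped R = {P\<in>cubes. P \<subseteq> R \<and> 2 * B < \<bar>avg P - avg R\<bar>}"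

definition stopping_children :: "'a set \<Rightarrow> 'a set set" where
  "stopping_children R = maximal_members (stopped R)"

definition stopping_part :: "'a set \<Rightarrow> 'a set" where
  "stopping_part R = R - \<Union>(stopping_children R)"

lemma stopping_children_stopped: "stopping_children R \<subseteq> stopped R"
  unfolding stopping_children_def by (rule maximal_members_subset)

lemma stopping_children_cubes: "stopping_children R \<subseteq> cubes"
  using stopping_children_stopped by (auto simp: stopped_def)

lemma stopping_child_psubset: "P \<in> stopping_children R \<Longrightarrow> P \<subset> R"
  using stopping_children_stopped B_pos by (fastforce simp: stopped_def)

lemma Union_stopping_children_subset: "\<Union>(stopping_children R) \<subseteq> R"
  using stopping_child_psubset by blast

lemma disjoint_stopping_children: "disjoint (stopping_children R)"
  unfolding stopping_children_def
  by (intro disjoint_maximal_members laminar_subset[OF laminar_cubes]) (auto simp: stopped_def)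

lemma countable_stopping_children: "countable (stopping_children R)"
  using stopping_children_cubes countable_cubes by (rule countable_subset)

lemma Union_stopping_children_measurable [measurable]: "\<Union>(stopping_children R) \<in> sets borel"
  using countable_stopping_children stopping_children_cubes cube_measurable
  by (intro sets.countable_Union) blast+

lemma emeasure_Union_stopping_children_le:
  assumes R: "R \<in> cubes"
  shows "2 * emeasure M (\<Union>(stopping_children R)) \<le> emeasure M R"
proof -
  let ?C = "stopping_children R"
  have C_sets: "?C \<subseteq> sets M" using stopping_children_cubes[of R] cube_measurable by auto
  have "ennreal (2 * B) * emeasure M (\<Union>?C) = (\<integral>\<^sup>+Q. ennreal (2 * B) * emeasure M Q \<partial>count_space ?C)"
    using emeasure_Union_disjoint[OF countable_stopping_children disjoint_stopping_children C_sets]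
    by (simp add: nn_integral_cmult)
  also have "\<dots> \<le> (\<integral>\<^sup>+Q. (\<integral>\<^sup>+t\<in>Q. ennreal \<bar>b t - avg R\<bar> \<partial>M) \<partial>count_space ?C)"
  proof (rule nn_integral_mono)
    fix Q assume "Q \<in> space (count_space ?C)"
    then have Q: "Q \<in> cubes" "2 * B < \<bar>avg Q - avg R\<bar>"
      using stopping_children_stopped[of R] by (auto simp: stopped_def)
    then have "ennreal (2 * B) * emeasure M Q \<le> ennreal \<bar>avg Q - avg R\<bar> * emeasure M Q"
      by (intro mult_right_mono ennreal_leI) auto
    also have "\<dots> \<le> (\<integral>\<^sup>+t\<in>Q. ennreal \<bar>b t - avg R\<bar> \<partial>M)" using Q(1) by (rule avg_diff_le)
    finally show "ennreal (2 * B) * emeasure M Q \<le> (\<integral>\<^sup>+t\<in>Q. ennreal \<bar>b t - avg R\<bar> \<partial>M)" .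
  qed
  also have "\<dots> = (\<integral>\<^sup>+t\<in>\<Union>?C. ennreal \<bar>b t - avg R\<bar> \<partial>M)"
    using countable_stopping_children disjoint_stopping_children C_sets
    by (intro nn_integral_Union_disjoint[symmetric]) simp_all
  also have "\<dots> \<le> (\<integral>\<^sup>+t\<in>R. ennreal \<bar>b t - avg R\<bar> \<partial>M)"
    by (intro nn_set_integral_set_mono Union_stopping_children_subset)
  also have "\<dots> \<le> ennreal B * emeasure M R" using R by (rule cube_oscillation)
  finally have "ennreal B * (2 * emeasure M (\<Union>?C)) \<le> ennreal B * emeasure M R"
    using B_pos by (simp add: ennreal_mult mult_ac)
  then show ?thesis using B_pos by (subst (asm) ennreal_mult_le_mult_iff) auto
qed

lemma emeasure_stopping_part_ge:
  assumes R: "R \<in> cubes"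
  shows "ennreal (1 / 2) * emeasure M R \<le> emeasure M (stopping_part R)"
proof -
  let ?U = "\<Union>(stopping_children R)"
  obtain r where r: "0 < r" "emeasure M R = ennreal r"
    using ennreal_positive_finiteE[OF cube_emeasure[OF R]] .
  have "emeasure M ?U \<le> ennreal r"
    using emeasure_mono[OF Union_stopping_children_subset, of R M] R r by simp
  then obtain u where u: "0 \<le> u" "emeasure M ?U = ennreal u"
    by (cases "emeasure M ?U") (auto simp: top_unique)
  have "2 * ennreal u \<le> ennreal r"
    using emeasure_Union_stopping_children_le[OF R] r u by simp
  then have "2 * u \<le> r" using u r by (simp add: ennreal_le_iff flip: ennreal_numeral ennreal_mult)
  moreover have "emeasure M (stopping_part R) = ennreal r - ennreal u"
    unfolding stopping_part_def using R r u Union_stopping_children_subset by (subst emeasure_Diff) auto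
  ultimately show ?thesis
    using r u by (simp add: ennreal_minus flip: ennreal_mult del: ennreal_half)
qed

lemma avg_stopping_child_diff_le:
  assumes R: "R \<in> cubes" and P: "P \<in> stopping_children R"
  shows "\<bar>avg P - avg R\<bar> \<le> 3 * \<kappa> * B"
proof -
  have P_cube: "P \<in> cubes" and P_psubset_R: "P \<subset> R"
    using P stopping_children_cubes stopping_child_psubset by auto
  obtain Q where Q: "Q \<in> cubes" "P \<subset> Q" "Q \<subseteq> R" "emeasure M Q \<le> ennreal \<kappa> * emeasure M P"
    using cube_parent[OF P_cube R P_psubset_R] .
  have "Q \<notin> stopped R" using P Q(2) by (auto simp: stopping_children_def maximal_members_def)
  then have "\<bar>avg Q - avg R\<bar> \<le> 2 * B" using Q by (auto simp: stopped_def)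
  moreover have "\<bar>avg P - avg Q\<bar> \<le> \<kappa> * B" using P_cube Q by (intro avg_parent_diff_le) auto
  moreover have "2 * B \<le> 2 * \<kappa> * B" using B_pos \<kappa>_ge_1 by simp
  ultimately show ?thesis by linarith
qed

lemma avg_diff_le_outside_stopping_children:
  assumes R: "R \<in> cubes" and Q: "Q \<in> cubes" "Q \<subseteq> R" and outside: "\<And>C. C \<in> stopping_children R \<Longrightarrow> \<not> Q \<subseteq> C"
  shows "\<bar>avg Q - avg R\<bar> \<le> 2 * B"
proof (rule ccontr)
  assume "\<not> ?thesis"
  then have "Q \<in> stopped R" using Q by (simp add: stopped_def)
  moreover have "finite {P\<in>stopped R. Q \<subseteq> P}"
    by (rule finite_subset[OF _ finite_cubes_between[OF Q(1) R]]) (auto simp: stopped_def)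
  ultimately obtain C where "C \<in> stopping_children R" "Q \<subseteq> C"
    unfolding stopping_children_def by (rule maximal_member_above)
  then show False using outside by blast
qed

definition regular_point :: "'a \<Rightarrow> bool" where
  "regular_point x \<longleftrightarrow> (\<forall>R\<in>cubes. x \<in> stopping_part R \<longrightarrow> \<bar>b x - avg R\<bar> \<le> 3 * B)"

lemma AE_regular_point: "AE x in M. regular_point x"
  unfolding regular_point_def
proof (rule AE_ball_countable[THEN iffD2, OF countable_cubes], rule ballI)
  fix R assume R: "R \<in> cubes"
  then obtain m where m: "R \<in> D m" by (rule cubesE)
  have "AE x in M. x \<in> stopping_part R \<longrightarrow> ennreal \<bar>b x - avg R\<bar> \<le> ennreal (3 * B)"
  proof (rule AE_le_if_dyadic_averages_le[OF m])
    fix x k Q assume x: "x \<in> stopping_part R" and Q: "m \<le> k" "Q \<in> D k" "x \<in> Q"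
    have Q_cube: "Q \<in> cubes" using Q(2) by (rule cubesI)
    have Q_subset_R: "Q \<subseteq> R" using Q x finer_subset[of m k Q R] m by (auto simp: stopping_part_def)
    have "(\<integral>\<^sup>+t\<in>Q. ennreal \<bar>b t - avg R\<bar> \<partial>M)
        \<le> (\<integral>\<^sup>+t\<in>Q. ennreal \<bar>b t - avg Q\<bar> \<partial>M) + ennreal \<bar>avg Q - avg R\<bar> * emeasure M Q"
      using Q_cube by (intro set_nn_integral_abs_diff_triangle) auto
    also have "\<dots> \<le> ennreal B * emeasure M Q + ennreal (2 * B) * emeasure M Q"
    proof (intro add_mono mult_right_mono ennreal_leI)
      show "\<bar>avg Q - avg R\<bar> \<le> 2 * B"
        using x Q
        by (intro avg_diff_le_outside_stopping_children R Q_cube Q_subset_R) (auto simp: stopping_part_def)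
    qed (use Q_cube cube_oscillation in auto)
    also have "\<dots> = ennreal (3 * B) * emeasure M Q"
      using B_pos by (simp flip: distrib_right ennreal_plus)
    finally show "(\<integral>\<^sup>+t\<in>Q. ennreal \<bar>b t - avg R\<bar> \<partial>M) \<le> ennreal (3 * B) * emeasure M Q" .
  qed (use R B_pos in \<open>auto simp: stopping_part_def\<close>)
  then show "AE x in M. x \<in> stopping_part R \<longrightarrow> \<bar>b x - avg R\<bar> \<le> 3 * B"
    by (rule AE_mp) (use B_pos in auto)
qed

primrec generation :: "'a set set \<Rightarrow> nat \<Rightarrow> 'a set set" where
  "generation T0 0 = T0"
| "generation T0 (Suc n) = (\<Union>R\<in>generation T0 n. stopping_children R)"

definition stopping_family :: "'a set set \<Rightarrow> 'a set set" where
  "stopping_family T0 = (\<Union>n. generation T0 n)"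

definition stopping_closed :: "'a set set \<Rightarrow> bool" where
  "stopping_closed T \<longleftrightarrow> T \<subseteq> cubes \<and> (\<forall>R\<in>T. stopping_children R \<subseteq> T)"

lemma stopping_family_supset: "T0 \<subseteq> stopping_family T0"
  unfolding stopping_family_def using generation.simps(1)[of T0] by blast

lemma stopping_closed_stopping_family:
  assumes "T0 \<subseteq> cubes"
  shows "stopping_closed (stopping_family T0)"
proof -
  have "generation T0 n \<subseteq> cubes" for n
    using assms stopping_children_cubes by (induction n) auto
  moreover have "stopping_children R \<subseteq> stopping_family T0" if "R \<in> generation T0 n" for R n
    unfolding stopping_family_def using that generation.simps(2)[of T0 n] by blast
  ultimately show ?thesis
    by (auto simp: stopping_closed_def stopping_family_def)
qed

lemma disjoint_generation:
  assumes "disjoint T0"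
  shows "disjoint (generation T0 n)"
proof (induction n)
  case (Suc n)
  show ?case
  proof (rule disjointI)
    fix P Q assume "P \<in> generation T0 (Suc n)" "Q \<in> generation T0 (Suc n)" "P \<noteq> Q"
    then obtain R R' where R: "R \<in> generation T0 n" "P \<in> stopping_children R"
      "R' \<in> generation T0 n" "Q \<in> stopping_children R'" by auto
    show "P \<inter> Q = {}"
    proof (cases "R = R'")
      case True
      then show ?thesis using disjointD[OF disjoint_stopping_children] R \<open>P \<noteq> Q\<close> by metis
    next
      case False
      then have "R \<inter> R' = {}" using disjointD[OF Suc.IH] R by blast
      then show ?thesis using stopping_child_psubset R by blast
    qed
  qed
qed (use assms in simp)

lemma generation_ancestor:
  "n < k \<Longrightarrow> Q \<in> generation T0 k \<Longrightarrow> \<exists>R\<in>generation T0 n. \<exists>C\<in>stopping_children R. Q \<subseteq> C"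
proof (induction k arbitrary: Q)
  case (Suc k)
  then obtain R where R: "R \<in> generation T0 k" "Q \<in> stopping_children R" by auto
  show ?case
  proof (cases "n = k")
    case True
    then show ?thesis using R by blast
  next
    case False
    then obtain R' C where "R' \<in> generation T0 n" "C \<in> stopping_children R'" "R \<subseteq> C"
      using Suc.IH[OF _ R(1)] Suc.prems by auto
    then show ?thesis using stopping_child_psubset[OF R(2)] by blast
  qed
qed simp

lemma stopping_parts_disjoint:
  assumes T0: "disjoint T0"
  shows "disjoint_family_on stopping_part (stopping_family T0)"
proof -
  have meet: "P = Q" if "n \<le> k" and P: "P \<in> generation T0 n" "x \<in> stopping_part P"
    and Q: "Q \<in> generation T0 k" "x \<in> stopping_part Q" for P Q n k x
  proof (cases "n = k")
    case True
    then show ?thesis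
      using disjointD[OF disjoint_generation[OF T0], of P n Q] P Q by (auto simp: stopping_part_def)
  next
    case False
    then obtain R C where R: "R \<in> generation T0 n" "C \<in> stopping_children R" "Q \<subseteq> C"
      using generation_ancestor[of n k Q T0] Q(1) \<open>n \<le> k\<close> by auto
    then have x: "x \<in> C" "x \<in> R" using Q(2) stopping_child_psubset by (auto simp: stopping_part_def)
    then have "R = P"
      using disjointD[OF disjoint_generation[OF T0] R(1) P(1)] P(2) by (auto simp: stopping_part_def)
    then show ?thesis using P(2) R(2) x(1) by (auto simp: stopping_part_def)
  qed
  have "P = Q"
    if "P \<in> stopping_family T0" "Q \<in> stopping_family T0" "x \<in> stopping_part P" "x \<in> stopping_part Q" for P Q x
  proof -
    obtain n k where "P \<in> generation T0 n" "Q \<in> generation T0 k"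
      using \<open>P \<in> _\<close> \<open>Q \<in> _\<close> by (auto simp: stopping_family_def)
    then show ?thesis
      using meet[of n k P x Q] meet[of k n Q x P] that(3,4) by (cases "n \<le> k") auto
  qed
  then show ?thesis by (auto simp: disjoint_family_on_def)
qed

lemma sparse_stopping_family:
  assumes "T0 \<subseteq> cubes" "disjoint T0"
  shows "sparse_family M (1 / 2) 1 (stopping_family T0)"
proof -
  have T: "stopping_family T0 \<subseteq> cubes"
    using stopping_closed_stopping_family[OF assms(1)] by (simp add: stopping_closed_def)
  have "bounded_overlap 1 (stopping_family T0) stopping_part"
    using stopping_parts_disjoint[OF assms(2)] by (rule bounded_overlap_if_disjoint_family_on)
  moreover have "stopping_part Q \<in> sets M" "stopping_part Q \<subseteq> Q"
    "ennreal (1 / 2) * emeasure M Q \<le> emeasure M (stopping_part Q)" if "Q \<in> stopping_family T0" for Q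
    using that T emeasure_stopping_part_ge by (auto simp: stopping_part_def)
  ultimately have "sparse_parts M (1 / 2) 1 (stopping_family T0) stopping_part"
    by (auto simp: sparse_parts_def)
  then show ?thesis
    using cube_family_subset[OF cube_family_cubes T] by (auto simp: sparse_family_def)
qed

end

definition cubes_through :: "'a set set \<Rightarrow> 'a \<Rightarrow> 'a set \<Rightarrow> 'a set set" where
  "cubes_through T x Q = {R\<in>T. x \<in> R \<and> R \<subseteq> Q}"

definition cube_count :: "'a set set \<Rightarrow> 'a set \<Rightarrow> 'a \<Rightarrow> ennreal" where
  "cube_count T Q x = (\<integral>\<^sup>+R. indicator R x \<partial>count_space {R\<in>T. R \<subseteq> Q})"

lemma cube_count_eq:
  "cube_count T Q x = (if finite (cubes_through T x Q) then of_nat (card (cubes_through T x Q)) else top)"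
proof -
  let ?Y = "{R\<in>T. R \<subseteq> Q}"
  have through_subset: "cubes_through T x Q \<subseteq> ?Y" by (auto simp: cubes_through_def)
  have "cube_count T Q x = (\<integral>\<^sup>+R. indicator (cubes_through T x Q) R \<partial>count_space ?Y)"
    unfolding cube_count_def by (intro nn_integral_cong) (auto simp: cubes_through_def indicator_def)
  also have "\<dots> = emeasure (count_space ?Y) (cubes_through T x Q)"
    using through_subset by (intro nn_integral_indicator) auto
  finally show ?thesis using through_subset by (simp add: emeasure_count_space)
qed

definition deviation :: "'a measure \<Rightarrow> ('a \<Rightarrow> real) \<Rightarrow> 'a set \<Rightarrow> 'a \<Rightarrow> ennreal" where
  "deviation M b Q x = ennreal \<bar>b x - set_average M Q b\<bar>"

lemma borel_measurable_deviation [measurable]: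
  assumes [measurable]: "b \<in> borel_measurable M"
  shows "deviation N b Q \<in> borel_measurable M"
proof -
  have "(\<lambda>x. ennreal \<bar>b x - c\<bar>) \<in> borel_measurable M" for c by measurable
  then show ?thesis by (simp add: deviation_def[abs_def])
qed

context bmo_tree
begin

abbreviation osc :: "'a set \<Rightarrow> 'a \<Rightarrow> ennreal" where "osc \<equiv> deviation M b"

lemma cubes_through_stopping_child:
  assumes R: "R \<in> T" "x \<in> R" and P: "P \<in> stopping_children R" and R_finite: "finite (cubes_through T x R)"
  shows "finite (cubes_through T x P)" and "card (cubes_through T x P) < card (cubes_through T x R)"
proof -
  have psubset: "cubes_through T x P \<subset> cubes_through T x R"
    using R stopping_child_psubset[OF P] by (auto simp: cubes_through_def)
  then show "finite (cubes_through T x P)" using R_finite by (auto intro: finite_subset)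
  show "card (cubes_through T x P) < card (cubes_through T x R)"
    using R_finite psubset by (rule psubset_card_mono)
qed

text \<open>Telescope along the chain of stopping cubes through \<open>x\<close>: each step costs at most \<open>3 \<kappa> B\<close>.\<close>

lemma deviation_le_card_stopping_cubes:
  assumes T: "stopping_closed T" and x: "regular_point x"
  shows "R \<in> T \<Longrightarrow> x \<in> R \<Longrightarrow> finite (cubes_through T x R)
    \<Longrightarrow> \<bar>b x - avg R\<bar> \<le> 3 * \<kappa> * B * real (card (cubes_through T x R))"
proof (induction "card (cubes_through T x R)" arbitrary: R rule: less_induct)
  case less
  have R_cube: "R \<in> cubes" using less.prems(1) T by (auto simp: stopping_closed_def)
  show ?case
  proof (cases "x \<in> stopping_part R")
    case True
    have "R \<in> cubes_through T x R" using less.prems by (simp add: cubes_through_def)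
    then have card_pos: "1 \<le> card (cubes_through T x R)"
      using less.prems(3) by (metis One_nat_def Suc_leI card_gt_0_iff empty_iff)
    have "\<bar>b x - avg R\<bar> \<le> 3 * B * 1" using True x R_cube by (simp add: regular_point_def)
    also have "\<dots> \<le> 3 * \<kappa> * B * real (card (cubes_through T x R))"
      using B_pos \<kappa>_ge_1 card_pos by (intro mult_mono) auto
    finally show ?thesis .
  next
    case False
    then obtain P where P: "P \<in> stopping_children R" "x \<in> P"
      using less.prems(2) by (auto simp: stopping_part_def)
    have P_in_T: "P \<in> T" using T less.prems(1) P(1) by (auto simp: stopping_closed_def)
    note through_P = cubes_through_stopping_child[OF less.prems(1,2) P(1) less.prems(3)]
    have "\<bar>b x - avg P\<bar> \<le> 3 * \<kappa> * B * real (card (cubes_through T x P))"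
      using less.hyps[OF through_P(2) P_in_T P(2) through_P(1)] .
    moreover have "\<bar>avg P - avg R\<bar> \<le> 3 * \<kappa> * B" using avg_stopping_child_diff_le[OF R_cube P(1)] .
    ultimately have "\<bar>b x - avg R\<bar> \<le> 3 * \<kappa> * B * (real (card (cubes_through T x P)) + 1)"
      by (simp add: algebra_simps)
    also have "\<dots> \<le> 3 * \<kappa> * B * real (card (cubes_through T x R))"
      using through_P(2) B_pos \<kappa>_ge_1 by (intro mult_left_mono) auto
    finally show ?thesis .
  qed
qed

lemma smallest_cube_above:
  assumes T: "T \<subseteq> cubes" and Q: "Q \<in> cubes" and P: "P \<in> T" "Q \<subseteq> P"
  obtains R where "R \<in> T" "Q \<subseteq> R" "\<And>R'. R' \<in> T \<Longrightarrow> Q \<subseteq> R' \<Longrightarrow> R' \<subseteq> R \<Longrightarrow> R' = R"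
proof -
  let ?Z = "{R\<in>T. Q \<subseteq> R \<and> R \<subseteq> P}"
  have Z: "finite ?Z" "P \<in> ?Z"
    using T P by (intro finite_subset[OF _ finite_cubes_between[OF Q, of P]], auto)
  obtain R where R: "R \<in> ?Z" and R_minimal: "\<forall>R'\<in>?Z. R' \<subseteq> R \<longrightarrow> R = R'"
    by (rule bexE[OF finite_has_minimal2[OF Z]]) (elim conjE, rule that)
  show ?thesis
  proof (rule that)
    show "R \<in> T" "Q \<subseteq> R" using R by simp_all
    show "R' = R" if "R' \<in> T" "Q \<subseteq> R'" "R' \<subseteq> R" for R'
    proof -
      have "R' \<in> ?Z" using that R by blast
      from bspec[OF R_minimal this] that(3) show ?thesis by simp
    qed
  qed
qed

text \<open>Compare \<open>Q\<close> with the smallest stopping cube \<open>R\<close> around it: every other stopping cube inside \<open>R\<close> that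
  meets \<open>Q\<close> lies inside \<open>Q\<close>.\<close>

lemma deviation_le_card_stopping_cubes_inside:
  assumes T: "stopping_closed T" and x: "regular_point x" and Q: "Q \<in> cubes" "x \<in> Q"
    and P: "P \<in> T" "Q \<subseteq> P" and through_finite: "finite (cubes_through T x Q)"
  shows "\<bar>b x - avg Q\<bar> \<le> 6 * \<kappa> * B * (1 + real (card (cubes_through T x Q)))"
proof -
  have T_cubes: "T \<subseteq> cubes" using T by (simp add: stopping_closed_def)
  obtain R where R: "R \<in> T" "Q \<subseteq> R" and R_minimal: "\<And>R'. R' \<in> T \<Longrightarrow> Q \<subseteq> R' \<Longrightarrow> R' \<subseteq> R \<Longrightarrow> R' = R"
    by (rule smallest_cube_above[OF T_cubes Q(1) P]) (rule that)
  have R_cube: "R \<in> cubes" using R(1) T_cubes by blast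
  have "\<bar>avg Q - avg R\<bar> \<le> 2 * B"
  proof (rule avg_diff_le_outside_stopping_children[OF R_cube Q(1) R(2)])
    fix C assume C: "C \<in> stopping_children R"
    then have "C \<in> T" using T R(1) by (auto simp: stopping_closed_def)
    then show "\<not> Q \<subseteq> C" using R_minimal[of C] stopping_child_psubset[OF C] by blast
  qed
  moreover have "\<bar>b x - avg R\<bar> \<le> 3 * \<kappa> * B * (1 + real (card (cubes_through T x Q)))"
  proof -
    have through_subset: "cubes_through T x R \<subseteq> insert R (cubes_through T x Q)"
    proof
      fix P assume P: "P \<in> cubes_through T x R"
      then have "P \<in> cubes" "x \<in> P \<inter> Q" using T_cubes Q(2) by (auto simp: cubes_through_def)
      then have "P \<subseteq> Q \<or> Q \<subseteq> P" using laminarD[OF laminar_cubes _ Q(1), of P] by blast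
      then show "P \<in> insert R (cubes_through T x Q)" using P R_minimal[of P] by (auto simp: cubes_through_def)
    qed
    then have "finite (cubes_through T x R)" by (rule finite_subset) (use through_finite in simp)
    moreover have "card (cubes_through T x R) \<le> Suc (card (cubes_through T x Q))"
      using card_mono[OF _ through_subset] through_finite by (simp add: card_insert_if split: if_splits)
    ultimately have "\<bar>b x - avg R\<bar> \<le> 3 * \<kappa> * B * real (card (cubes_through T x R))"
      "3 * \<kappa> * B * real (card (cubes_through T x R)) \<le> 3 * \<kappa> * B * (1 + real (card (cubes_through T x Q)))"
      using deviation_le_card_stopping_cubes[OF T x R(1)] Q(2) R(2) B_pos \<kappa>_ge_1
      by (auto intro!: mult_left_mono)
    then show ?thesis by (rule order_trans)
  qed
  moreover have "2 * B * 1 \<le> 3 * \<kappa> * B * (1 + real (card (cubes_through T x Q)))"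
    using B_pos \<kappa>_ge_1 by (intro mult_mono) auto
  ultimately show ?thesis by (simp add: algebra_simps)
qed

lemma osc_domination:
  assumes F: "finite F" "F \<subseteq> cubes"
  obtains T where "T \<subseteq> cubes" "sparse_family M (1 / 2) 1 T"
    "AE x in M. \<forall>Q\<in>F. x \<in> Q \<longrightarrow> osc Q x \<le> ennreal (6 * \<kappa> * B) * (1 + cube_count T Q x)"
proof -
  define T where "T = stopping_family (maximal_members F)"
  have T0: "maximal_members F \<subseteq> cubes" "disjoint (maximal_members F)"
    using F(2) maximal_members_subset disjoint_maximal_members[OF laminar_subset[OF laminar_cubes F(2)]]
    by auto
  have T: "stopping_closed T"
    unfolding T_def using T0(1) by (rule stopping_closed_stopping_family)
  have "AE x in M. \<forall>Q\<in>F. x \<in> Q \<longrightarrow> osc Q x \<le> ennreal (6 * \<kappa> * B) * (1 + cube_count T Q x)"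
    using AE_regular_point
  proof (rule AE_mp, intro AE_I2 impI ballI)
    fix x Q assume x: "regular_point x" "x \<in> Q" and Q: "Q \<in> F"
    show "osc Q x \<le> ennreal (6 * \<kappa> * B) * (1 + cube_count T Q x)"
    proof (cases "finite (cubes_through T x Q)")
      case False
      then show ?thesis using B_pos \<kappa>_ge_1 by (simp add: cube_count_eq ennreal_mult_top)
    next
      case True
      obtain P where "P \<in> maximal_members F" "Q \<subseteq> P"
        using maximal_member_above[OF Q] F(1) by auto
      then have "\<bar>b x - avg Q\<bar> \<le> 6 * \<kappa> * B * (1 + real (card (cubes_through T x Q)))"
        using T x Q F(2) True stopping_family_supset[of "maximal_members F"]
        by (intro deviation_le_card_stopping_cubes_inside) (auto simp: T_def)
      then have "osc Q x \<le> ennreal (6 * \<kappa> * B * (1 + real (card (cubes_through T x Q))))"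
        unfolding deviation_def by (rule ennreal_leI)
      then show ?thesis
        using True B_pos \<kappa>_ge_1 by (simp add: cube_count_eq ennreal_mult ennreal_of_nat_eq_real_of_nat)
    qed
  qed
  moreover have "T \<subseteq> cubes" "sparse_family M (1 / 2) 1 T"
    using T sparse_stopping_family[OF T0] unfolding T_def by (simp_all only: stopping_closed_def)
  ultimately show ?thesis using that by blast
qed

end

lemma nn_integral_cube_count_le:
  assumes T: "cube_family M T" and Q [measurable]: "Q \<in> sets M" and f [measurable]: "f \<in> borel_measurable M"
  shows "(\<integral>\<^sup>+x\<in>Q. cube_count T Q x * f x \<partial>M) \<le> (\<integral>\<^sup>+x\<in>Q. sparse_op M T f x \<partial>M)"
proof -
  let ?Y = "{R\<in>T. R \<subseteq> Q}"
  have Y: "cube_family M ?Y" using T by (rule cube_family_subset) auto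
  note Y_cubes = cube_familyD[OF Y]
  have inside: "(\<integral>\<^sup>+x. indicator R x * (g x * indicator Q x) \<partial>M) = set_nn_integral M R g"
    if "R \<in> ?Y" for R g
    using that by (intro nn_integral_cong) (auto simp: indicator_def)
  have "(\<integral>\<^sup>+x\<in>Q. cube_count T Q x * f x \<partial>M)
      = (\<integral>\<^sup>+x. (\<integral>\<^sup>+R. 1 * indicator R x \<partial>count_space ?Y) * (f x * indicator Q x) \<partial>M)"
    by (simp add: cube_count_def mult.assoc)
  also have "\<dots> = (\<integral>\<^sup>+R. 1 * (\<integral>\<^sup>+x. indicator R x * (f x * indicator Q x) \<partial>M) \<partial>count_space ?Y)"
    using Y_cubes by (intro nn_integral_count_space_kernel) auto
  also have "\<dots> = (\<integral>\<^sup>+R. set_nn_integral M R f * emeasure M R / emeasure M R \<partial>count_space ?Y)"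
  proof (rule nn_integral_cong)
    fix R assume R: "R \<in> space (count_space ?Y)"
    then show "1 * (\<integral>\<^sup>+x. indicator R x * (f x * indicator Q x) \<partial>M)
        = set_nn_integral M R f * emeasure M R / emeasure M R"
      using Y_cubes(5,6)[of R] by (simp add: inside mult_divide_eq_ennreal less_top)
  qed
  also have "\<dots> = sparse_form M ?Y f (indicator Q)"
    using Y_cubes inside[of _ "\<lambda>_. 1"] unfolding weighted_sparse_form_def
    by (intro nn_integral_cong) (simp add: Int_absorb2 mult.commute flip: nn_integral_indicator)
  also have "\<dots> = (\<integral>\<^sup>+x\<in>Q. sparse_op M ?Y f x \<partial>M)"
    using Y_cubes by (intro nn_integral_weighted_sparse_op[symmetric]) auto
  also have "\<dots> \<le> (\<integral>\<^sup>+x\<in>Q. sparse_op M T f x \<partial>M)"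
    unfolding weighted_sparse_op_def
    by (intro nn_integral_mono mult_right_mono nn_integral_count_space_mono_set) auto
  finally show ?thesis .
qed

section \<open>Commutator forms\<close>

locale weighted_bmo_tree = bmo_tree M D X \<kappa> b B + dual_weights M p q v s
  for M :: "'a::{second_countable_topology, complete_space} measure" and D X \<kappa> b B p q v s
begin

lemma nn_integral_osc_le:
  assumes T: "T \<subseteq> cubes" and Q: "Q \<in> cubes"
    and osc_le: "AE x in M. x \<in> Q \<longrightarrow> osc Q x \<le> ennreal L * (1 + cube_count T Q x)"
    and f [measurable]: "f \<in> borel_measurable M"
  shows "(\<integral>\<^sup>+t\<in>Q. osc Q t * f t \<partial>M)
      \<le> ennreal L * (set_nn_integral M Q f + set_nn_integral M Q (sparse_op M T f))"
proof -
  have [measurable]: "Q \<in> sets borel" using Q by (rule cube_measurable)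
  have T_family: "cube_family M T" using cube_family_cubes T by (rule cube_family_subset)
  have [measurable]: "cube_count T Q \<in> borel_measurable M"
    unfolding cube_count_def[abs_def] using cube_familyD[OF T_family]
    by (intro borel_measurable_nn_integral_count_space) (auto intro: countable_subset)
  have "(\<integral>\<^sup>+t\<in>Q. osc Q t * f t \<partial>M) \<le> (\<integral>\<^sup>+t\<in>Q. ennreal L * (f t + cube_count T Q t * f t) \<partial>M)"
    using osc_le
  proof (intro nn_integral_mono_AE, elim AE_mp, intro AE_I2 impI)
    fix t assume osc_t_le: "t \<in> Q \<longrightarrow> osc Q t \<le> ennreal L * (1 + cube_count T Q t)"
    show "osc Q t * f t * indicator Q t \<le> ennreal L * (f t + cube_count T Q t * f t) * indicator Q t"
    proof (cases "t \<in> Q")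
      case True
      then have "osc Q t * f t \<le> ennreal L * (1 + cube_count T Q t) * f t"
        using osc_t_le by (intro mult_right_mono) auto
      then show ?thesis using True by (simp add: distrib_left distrib_right mult.assoc)
    qed simp
  qed
  also have "\<dots> = ennreal L * (\<integral>\<^sup>+t\<in>Q. f t + cube_count T Q t * f t \<partial>M)"
    by (simp add: nn_integral_cmult mult.assoc)
  also have "\<dots> = ennreal L * (set_nn_integral M Q f + (\<integral>\<^sup>+t\<in>Q. cube_count T Q t * f t \<partial>M))"
    by (subst nn_set_integral_add) auto
  also have "\<dots> \<le> ennreal L * (set_nn_integral M Q f + set_nn_integral M Q (sparse_op M T f))"
    by (intro mult_left_mono add_left_mono nn_integral_cube_count_le T_family) auto
  finally show ?thesis .
qed

lemma finite_comm_form_le: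
  assumes F: "finite F" "F \<subseteq> cubes" "form_bounded (sparse_form M F) C"
    and T: "\<And>T. T \<subseteq> cubes \<Longrightarrow> sparse_family M (1 / 2) 1 T \<Longrightarrow> form_bounded (sparse_form M T) C'"
    and f: "f \<in> borel_measurable M" and g: "g \<in> borel_measurable M"
  shows "weighted_sparse_form M F osc (\<lambda>_ _. 1) f g
    \<le> ennreal (6 * \<kappa> * B) * (C * (1 + C')) * (nn_Lp_norm \<nu> p f * nn_Lp_norm \<sigma> q g)"
proof -
  let ?L = "ennreal (6 * \<kappa> * B)" and ?G = "\<lambda>Q. set_nn_integral M Q g / emeasure M Q"
  obtain T where T_cubes: "T \<subseteq> cubes" "sparse_family M (1 / 2) 1 T"
    and osc_le: "AE x in M. \<forall>Q\<in>F. x \<in> Q \<longrightarrow> osc Q x \<le> ?L * (1 + cube_count T Q x)"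
    using osc_domination[OF F(1,2)] .
  have T_family: "countable T" "T \<subseteq> sets M"
    using cube_familyD[OF cube_family_subset[OF cube_family_cubes T_cubes(1)]] by auto
  have "weighted_sparse_form M F osc (\<lambda>_ _. 1) f g = (\<Sum>Q\<in>F. (\<integral>\<^sup>+t\<in>Q. osc Q t * f t \<partial>M) * ?G Q)"
    using F(1) by (simp add: weighted_sparse_form_finite ennreal_times_divide)
  also have "\<dots> \<le> (\<Sum>Q\<in>F. ?L * (set_nn_integral M Q f + set_nn_integral M Q (sparse_op M T f)) * ?G Q)"
  proof (intro sum_mono mult_right_mono nn_integral_osc_le[OF T_cubes(1) _ _ f])
    fix Q assume Q: "Q \<in> F"
    then show "Q \<in> cubes" using F(2) by blast
    show "AE x in M. x \<in> Q \<longrightarrow> osc Q x \<le> ?L * (1 + cube_count T Q x)"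
      using osc_le by (rule AE_mp) (use Q in auto)
  qed simp
  also have "\<dots> = ?L * (sparse_form M F f g + sparse_form M F (sparse_op M T f) g)"
    using F(1)
    by (simp add: weighted_sparse_form_finite sum_distrib_left sum.distrib distrib_left distrib_right
        mult.assoc flip: ennreal_times_divide)
  also have "\<dots> \<le> ?L * (C * (nn_Lp_norm \<nu> p f * nn_Lp_norm \<sigma> q g)
      + C * C' * (nn_Lp_norm \<nu> p f * nn_Lp_norm \<sigma> q g))"
    by (intro mult_left_mono add_mono form_boundedD[OF F(3)] sparse_form_compose_le[OF F(3)]
        T_family T T_cubes f g) simp
  also have "\<dots> = ?L * (C * (1 + C')) * (nn_Lp_norm \<nu> p f * nn_Lp_norm \<sigma> q g)"
    by (simp add: distrib_left distrib_right mult_ac)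
  finally show ?thesis .
qed

theorem comm_form_bounded:
  assumes S: "S \<subseteq> cubes" "form_bounded (sparse_form M S) C"
    and T: "\<And>T. T \<subseteq> cubes \<Longrightarrow> sparse_family M (1 / 2) 1 T \<Longrightarrow> form_bounded (sparse_form M T) C'"
  shows "form_bounded (weighted_sparse_form M S osc (\<lambda>_ _. 1)) (ennreal (6 * \<kappa> * B) * (C * (1 + C')))"
proof (rule form_bounded_finite_subfamilies)
  show "countable S" using S(1) countable_cubes by (rule countable_subset)
  show "form_bounded (weighted_sparse_form M F osc (\<lambda>_ _. 1)) (ennreal (6 * \<kappa> * B) * (C * (1 + C')))"
    if "finite F" "F \<subseteq> S" for F
    unfolding form_bounded_def using that S(1) T form_bounded_subset[OF S(2) that(2)]
    by (intro ballI finite_comm_form_le) auto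
qed

lemma comm_form_bounded_transpose:
  assumes S: "S \<subseteq> cubes" "form_bounded (sparse_form M S) C"
    and T: "\<And>T. T \<subseteq> cubes \<Longrightarrow> sparse_family M (1 / 2) 1 T \<Longrightarrow> form_bounded (sparse_form M T) C'"
  shows "form_bounded (weighted_sparse_form M S (\<lambda>_ _. 1) osc) (ennreal (6 * \<kappa> * B) * (C * (1 + C')))"
proof -
  interpret transpose: weighted_bmo_tree M D X \<kappa> b B q p s v ..
  show ?thesis
    using transpose.comm_form_bounded[of S C C'] S T by (simp add: swap_form_bounded_iff)
qed

end

section \<open>The measure on the half-line\<close>

lemma sets_mu_lam [measurable_cong, simp]: "sets (mu_lam lam) = sets borel"
  by (simp add: mu_lam_def)

lemma sigma_finite_mu_lam: "sigma_finite_measure (mu_lam lam)"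
  unfolding mu_lam_def
  by (subst sigma_finite_measure.sigma_finite_iff_density_finite[OF sigma_finite_lborel]) auto

lemma AE_mu_lam_iff: "(AE x in mu_lam lam. P x) \<longleftrightarrow> (AE x in lborel. 0 < x \<longrightarrow> P x)"
  unfolding mu_lam_def by (subst AE_density) (auto simp: indicator_def intro!: AE_cong)

lemma nn_integral_mu_lam:
  assumes "f \<in> borel_measurable borel"
  shows "(\<integral>\<^sup>+x. f x \<partial>mu_lam lam) = (\<integral>\<^sup>+x\<in>{0<..}. ennreal (x powr (2 * lam)) * f x \<partial>lborel)"
  unfolding mu_lam_def using assms
  by (subst nn_integral_density) (auto intro!: nn_integral_cong simp: indicator_def)

lemma emeasure_mu_lam:
  assumes "A \<in> sets borel"
  shows "emeasure (mu_lam lam) A = (\<integral>\<^sup>+t\<in>A \<inter> {0<..}. ennreal (t powr (2 * lam)) \<partial>lborel)"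
  unfolding mu_lam_def using assms
  by (subst emeasure_density) (auto intro!: nn_integral_cong simp: indicator_def)

lemma emeasure_mu_lam_le:
  assumes A: "A \<in> sets borel" and c: "\<And>t. t \<in> A \<Longrightarrow> t \<le> c" and lam: "0 < lam"
  shows "emeasure (mu_lam lam) A \<le> ennreal (c powr (2 * lam)) * emeasure lborel A"
proof -
  have "emeasure (mu_lam lam) A \<le> (\<integral>\<^sup>+t. ennreal (c powr (2 * lam)) * indicator A t \<partial>lborel)"
    unfolding emeasure_mu_lam[OF A] using c lam
    by (intro nn_integral_mono) (auto simp: indicator_def intro!: ennreal_leI powr_mono2)
  then show ?thesis using A by (simp add: nn_integral_cmult_indicator)
qed

lemma emeasure_mu_lam_ge:
  assumes A: "A \<in> sets borel" and c: "\<And>t. t \<in> A \<Longrightarrow> c \<le> t" "0 < c" and lam: "0 < lam"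
  shows "ennreal (c powr (2 * lam)) * emeasure lborel A \<le> emeasure (mu_lam lam) A"
proof -
  have "(\<integral>\<^sup>+t. ennreal (c powr (2 * lam)) * indicator A t \<partial>lborel) \<le> emeasure (mu_lam lam) A"
    unfolding emeasure_mu_lam[OF A]
  proof (rule nn_integral_mono)
    fix t
    show "ennreal (c powr (2 * lam)) * indicator A t
        \<le> ennreal (t powr (2 * lam)) * indicator (A \<inter> {0<..}) t"
    proof (cases "t \<in> A")
      case True
      then have "c \<le> t" "0 < t" using c(1)[OF True] c(2) by auto
      then show ?thesis using True c(2) lam by (auto intro!: ennreal_leI powr_mono2)
    qed simp
  qed
  then show ?thesis using A by (simp add: nn_integral_cmult_indicator)
qed

definition doubling_const :: "real \<Rightarrow> real \<Rightarrow> real" where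
  "doubling_const lam \<rho> = 4 * \<rho> * (2 * \<rho>) powr (2 * lam)"

lemma one_le_doubling_const:
  assumes "0 < lam" "1 \<le> \<rho>"
  shows "1 \<le> doubling_const lam \<rho>"
proof -
  have "1 * 1 \<le> 4 * \<rho> * (2 * \<rho>) powr (2 * lam)"
    using assms by (intro mult_mono ge_one_powr_ge_zero) auto
  then show ?thesis by (simp add: doubling_const_def)
qed

text \<open>Compare with the outer quarter of the small ball, where the density is at least \<open>(z + r / 2)\<^sup>2\<^sup>\<lambda>\<close>.\<close>

lemma mu_lam_doubling:
  assumes lam: "0 < lam" and z: "0 < z" and r: "0 < r" and \<rho>: "1 \<le> \<rho>"
  shows "emeasure (mu_lam lam) (ball z (\<rho> * r))
      \<le> ennreal (doubling_const lam \<rho>) * emeasure (mu_lam lam) (ball z r \<inter> {0<..})"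
proof -
  let ?A = "{z + r / 2 <..< z + r}"
  have "z * 1 \<le> z * (2 * \<rho>)" using z \<rho> by (intro mult_left_mono) auto
  then have "z + \<rho> * r \<le> (2 * \<rho>) * (z + r / 2)" by (simp add: algebra_simps)
  then have "(z + \<rho> * r) powr (2 * lam) \<le> ((2 * \<rho>) * (z + r / 2)) powr (2 * lam)"
    using lam z r \<rho> by (intro powr_mono2) auto
  also have "\<dots> = (2 * \<rho>) powr (2 * lam) * (z + r / 2) powr (2 * lam)"
    using z r \<rho> by (simp add: powr_mult)
  finally have density_le: "(z + \<rho> * r) powr (2 * lam)
      \<le> (2 * \<rho>) powr (2 * lam) * (z + r / 2) powr (2 * lam)" .
  have "emeasure (mu_lam lam) (ball z (\<rho> * r))
      \<le> ennreal ((z + \<rho> * r) powr (2 * lam)) * emeasure lborel (ball z (\<rho> * r))"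
    using lam by (intro emeasure_mu_lam_le) (auto simp: ball_eq_greaterThanLessThan)
  also have "\<dots> = ennreal ((z + \<rho> * r) powr (2 * lam) * (2 * (\<rho> * r)))"
    using r \<rho> by (simp add: ball_eq_greaterThanLessThan ennreal_mult)
  also have "\<dots> \<le> ennreal ((2 * \<rho>) powr (2 * lam) * (z + r / 2) powr (2 * lam) * (4 * \<rho> * (r / 2)))"
    using r \<rho> by (intro ennreal_leI mult_mono[OF density_le]) auto
  also have "\<dots> = ennreal (doubling_const lam \<rho>)
      * (ennreal ((z + r / 2) powr (2 * lam)) * emeasure lborel ?A)"
    using r \<rho> by (simp add: doubling_const_def mult_ac flip: ennreal_mult)
  also have "\<dots> \<le> ennreal (doubling_const lam \<rho>) * emeasure (mu_lam lam) ?A"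
    using lam z r by (intro mult_left_mono emeasure_mu_lam_ge) auto
  also have "\<dots> \<le> ennreal (doubling_const lam \<rho>) * emeasure (mu_lam lam) (ball z r \<inter> {0<..})"
    using z r by (intro mult_left_mono emeasure_mono) (auto simp: ball_eq_greaterThanLessThan)
  finally show ?thesis .
qed

lemma emeasure_mu_lam_pos:
  assumes "0 < lam" "0 < z" "0 < r"
  shows "0 < emeasure (mu_lam lam) (ball z r \<inter> {0<..})"
proof -
  let ?A = "{z <..< z + r}"
  have "0 < ennreal (z powr (2 * lam)) * emeasure lborel ?A"
    using assms by (simp add: ennreal_zero_less_mult_iff)
  also have "\<dots> \<le> emeasure (mu_lam lam) ?A"
    using assms by (intro emeasure_mu_lam_ge) auto
  also have "\<dots> \<le> emeasure (mu_lam lam) (ball z r \<inter> {0<..})"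
    using assms by (intro emeasure_mono) (auto simp: ball_eq_greaterThanLessThan)
  finally show ?thesis .
qed

lemma emeasure_mu_lam_ball_finite:
  assumes "0 < lam"
  shows "emeasure (mu_lam lam) (ball z r) < top"
proof -
  have "emeasure (mu_lam lam) (ball z r) \<le> ennreal ((z + r) powr (2 * lam)) * emeasure lborel (ball z r)"
    using assms by (intro emeasure_mu_lam_le) (auto simp: ball_eq_greaterThanLessThan)
  also have "\<dots> < top"
    using emeasure_lborel_ball_finite[of z r] by (auto simp: ennreal_mult_less_top)
  finally show ?thesis .
qed

lemma intervals_Rplus_mu_lam:
  assumes lam: "0 < lam" and I: "I \<in> intervals_Rplus"
  shows "I \<in> sets borel" "I \<subseteq> {0<..}" "0 < emeasure (mu_lam lam) I" "emeasure (mu_lam lam) I < top"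
proof -
  obtain a c where ac: "I = {a<..<c}" "0 \<le> a" "a < c" using I by (auto simp: intervals_Rplus_def)
  have ball: "I = ball ((a + c) / 2) ((c - a) / 2)"
    unfolding ac ball_eq_greaterThanLessThan by (simp add: field_simps)
  show "I \<in> sets borel" and "I \<subseteq> {0<..}" using ac by auto
  then have "ball ((a + c) / 2) ((c - a) / 2) \<inter> {0<..} = I" unfolding ball by auto
  then show "0 < emeasure (mu_lam lam) I"
    using emeasure_mu_lam_pos[OF lam, of "(a + c) / 2" "(c - a) / 2"] ac by simp
  show "emeasure (mu_lam lam) I < top"
    unfolding ball using lam by (rule emeasure_mu_lam_ball_finite)
qed

lemma unit_interval_in_intervals_Rplus: "{0<..<1} \<in> intervals_Rplus"
  by (force simp: intervals_Rplus_def)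

locale half_line_dyadic =
  fixes lam \<delta> c0 C0 :: real and D :: "int \<Rightarrow> real set set"
  assumes lam_pos: "0 < lam" and dyadic_system: "dyadic_system \<delta> c0 C0 D"
begin

abbreviation \<mu> :: "real measure" where "\<mu> \<equiv> mu_lam lam"

definition \<rho> :: real where "\<rho> = 2 * C0 / (c0 * \<delta>)"

definition \<kappa> :: real where "\<kappa> = doubling_const lam \<rho>"

lemma dyadic_parameters: "0 < \<delta>" "\<delta> < 1" "0 < c0" "c0 \<le> C0" "0 < C0"
  using dyadic_system by (auto simp: dyadic_system_def)

lemma dilation_factor: "1 \<le> \<rho>" "C0 \<le> \<rho> * c0" "2 * C0 = \<rho> * (c0 * \<delta>)"
proof -
  have "c0 * \<delta> \<le> c0 * 1" "C0 * \<delta> \<le> C0 * 1"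
    using dyadic_parameters by (intro mult_left_mono; simp)+
  then have "c0 * \<delta> \<le> 2 * C0" "C0 * \<delta> \<le> 2 * C0"
    using dyadic_parameters by linarith+
  then show "1 \<le> \<rho>" "C0 \<le> \<rho> * c0" "2 * C0 = \<rho> * (c0 * \<delta>)"
    using dyadic_parameters by (simp_all add: \<rho>_def field_simps)
qed

lemma dyadic_cube_subset: "Q \<in> D k \<Longrightarrow> Q \<subseteq> {0<..}"
  and dyadic_cube_borel: "Q \<in> D k \<Longrightarrow> Q \<in> sets borel"
  using dyadic_system by (auto simp: dyadic_system_def)

lemma dyadic_cube_center:
  assumes "Q \<in> D k"
  obtains z where "z \<in> Q" "0 < z" "ball z (c0 * \<delta> powi k) \<inter> {0<..} \<subseteq> Q" "Q \<subseteq> ball z (C0 * \<delta> powi k)"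
proof -
  obtain z where "z \<in> Q" "ball z (c0 * \<delta> powi k) \<inter> {0<..} \<subseteq> Q" "Q \<subseteq> ball z (C0 * \<delta> powi k)"
    using dyadic_system assms unfolding dyadic_system_def by metis
  then show ?thesis using that dyadic_cube_subset[OF assms] by auto
qed

lemma dyadic_cube_dist:
  assumes "Q \<in> D k" "x \<in> Q" "y \<in> Q"
  shows "dist x y < 2 * (C0 * \<delta> powi k)"
proof -
  obtain z where "Q \<subseteq> ball z (C0 * \<delta> powi k)" using dyadic_cube_center[OF assms(1)] .
  then have "dist z x < C0 * \<delta> powi k" "dist z y < C0 * \<delta> powi k" using assms by auto
  then show ?thesis using dist_triangle3[of x y z] by linarith
qed

lemma radius_pos: "0 < c0 * \<delta> powi k" "0 < C0 * \<delta> powi k"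
  using dyadic_parameters by simp_all

lemma emeasure_dilated_ball_le:
  assumes Q: "Q \<in> D k" and z: "0 < z" "ball z (c0 * \<delta> powi k) \<inter> {0<..} \<subseteq> Q"
  shows "emeasure \<mu> (ball z (\<rho> * (c0 * \<delta> powi k))) \<le> ennreal \<kappa> * emeasure \<mu> Q"
proof -
  have "emeasure \<mu> (ball z (\<rho> * (c0 * \<delta> powi k)))
      \<le> ennreal \<kappa> * emeasure \<mu> (ball z (c0 * \<delta> powi k) \<inter> {0<..})"
    unfolding \<kappa>_def using z(1) radius_pos by (intro mu_lam_doubling lam_pos dilation_factor(1)) auto
  also have "\<dots> \<le> ennreal \<kappa> * emeasure \<mu> Q"
    using z(2) dyadic_cube_borel[OF Q] by (intro mult_left_mono emeasure_mono) auto
  finally show ?thesis .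
qed

lemma dyadic_cube_in_interval:
  assumes Q: "Q \<in> D k"
  obtains I where "I \<in> intervals_Rplus" "Q \<subseteq> I" "emeasure \<mu> I \<le> ennreal \<kappa> * emeasure \<mu> Q"
proof -
  obtain z where z: "z \<in> Q" "0 < z" "ball z (c0 * \<delta> powi k) \<inter> {0<..} \<subseteq> Q" "Q \<subseteq> ball z (C0 * \<delta> powi k)"
    using dyadic_cube_center[OF Q] .
  let ?r = "\<rho> * (c0 * \<delta> powi k)"
  let ?I = "{max 0 (z - ?r)<..<z + ?r}"
  have r: "C0 * \<delta> powi k \<le> ?r"
    using mult_right_mono[OF dilation_factor(2), of "\<delta> powi k"] dyadic_parameters(1)
    by (simp add: mult.assoc)
  show ?thesis
  proof (rule that)
    show "?I \<in> intervals_Rplus" unfolding intervals_Rplus_def mem_Collect_eq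
      using z(2) less_le_trans[OF radius_pos(2) r]
      by (intro exI[of _ "max 0 (z - ?r)"] exI[of _ "z + ?r"]) auto
    show "Q \<subseteq> ?I"
    proof
      fix t assume "t \<in> Q"
      then have "t \<in> ball z (C0 * \<delta> powi k)" "0 < t" using z(4) dyadic_cube_subset[OF Q] by auto
      then show "t \<in> ?I" using r by (auto simp: ball_eq_greaterThanLessThan)
    qed
    have "emeasure \<mu> ?I \<le> emeasure \<mu> (ball z ?r)"
      by (intro emeasure_mono) (auto simp: ball_eq_greaterThanLessThan)
    also have "\<dots> \<le> ennreal \<kappa> * emeasure \<mu> Q"
      using emeasure_dilated_ball_le[OF Q z(2,3)] .
    finally show "emeasure \<mu> ?I \<le> ennreal \<kappa> * emeasure \<mu> Q" .
  qed
qed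

lemma dyadic_cube_parent_doubling:
  assumes P: "P \<in> D (k + 1)" and Q: "Q \<in> D k" and P_subset_Q: "P \<subseteq> Q"
  shows "emeasure \<mu> Q \<le> ennreal \<kappa> * emeasure \<mu> P"
proof -
  obtain z where z: "z \<in> P" "0 < z" "ball z (c0 * \<delta> powi (k + 1)) \<inter> {0<..} \<subseteq> P"
    using dyadic_cube_center[OF P] .
  have "2 * (C0 * \<delta> powi k) = \<rho> * (c0 * \<delta>) * \<delta> powi k" by (simp flip: dilation_factor(3))
  also have "\<dots> = \<rho> * (c0 * \<delta> powi (k + 1))"
    using dyadic_parameters(1) by (simp add: power_int_add_1)
  finally have radius: "2 * (C0 * \<delta> powi k) = \<rho> * (c0 * \<delta> powi (k + 1))" .
  have "Q \<subseteq> ball z (\<rho> * (c0 * \<delta> powi (k + 1)))"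
    using dyadic_cube_dist[OF Q, of z] z(1) P_subset_Q unfolding radius by auto
  then have "emeasure \<mu> Q \<le> emeasure \<mu> (ball z (\<rho> * (c0 * \<delta> powi (k + 1))))"
    by (intro emeasure_mono) auto
  also have "\<dots> \<le> ennreal \<kappa> * emeasure \<mu> P" using emeasure_dilated_ball_le[OF P z(2,3)] .
  finally show ?thesis .
qed

lemma dyadic_cubes_shrink:
  assumes U: "open U" "x \<in> U"
  shows "\<exists>k. \<forall>j\<ge>k. \<forall>Q\<in>D j. x \<in> Q \<longrightarrow> Q \<subseteq> U"
proof -
  obtain e where e: "0 < e" "ball x e \<subseteq> U" using U openE by blast
  obtain n where n: "\<delta> ^ n < e / (2 * C0)"
    using real_arch_pow_inv[of "e / (2 * C0)" \<delta>] e dyadic_parameters by auto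
  have "Q \<subseteq> U" if j: "int n \<le> j" and Q: "Q \<in> D j" "x \<in> Q" for j Q
  proof -
    have "\<delta> powi j = \<delta> ^ nat j" using j by (simp add: power_int_def)
    also have "\<dots> \<le> \<delta> ^ n" using j dyadic_parameters by (intro power_decreasing) auto
    also have "\<dots> < e / (2 * C0)" by (fact n)
    finally have "2 * (C0 * \<delta> powi j) < e" using dyadic_parameters(5) by (simp add: field_simps)
    then have "Q \<subseteq> ball x e" using dyadic_cube_dist[OF Q] by fastforce
    then show ?thesis using e(2) by blast
  qed
  then show ?thesis by blast
qed

lemma countable_dyadic_level: "countable (D k)"
proof (rule countable_disjoint_nonempty_interior_subsets)
  show "disjoint (D k)"
    using dyadic_system by (auto simp: dyadic_system_def disjoint_def)
  fix Q assume Q: "Q \<in> D k" "interior Q = {}"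
  obtain z where z: "0 < z" "ball z (c0 * \<delta> powi k) \<inter> {0<..} \<subseteq> Q" using dyadic_cube_center[OF Q(1)] .
  then have "z \<in> interior Q"
    using radius_pos(1)[of k] by (intro interiorI[of "ball z (c0 * \<delta> powi k) \<inter> {0<..}"]) auto
  then show "Q = {}" using Q(2) by simp
qed

end

sublocale half_line_dyadic \<subseteq> dyadic_tree \<mu> D "{0<..}" \<kappa>
proof
  show "1 \<le> \<kappa>" unfolding \<kappa>_def by (intro one_le_doubling_const lam_pos dilation_factor(1))
  fix k Q assume Q: "Q \<in> D k"
  obtain z where z: "0 < z" "ball z (c0 * \<delta> powi k) \<inter> {0<..} \<subseteq> Q" "Q \<subseteq> ball z (C0 * \<delta> powi k)"
    using dyadic_cube_center[OF Q] .
  have "0 < emeasure \<mu> (ball z (c0 * \<delta> powi k) \<inter> {0<..})"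
    using z(1) by (intro emeasure_mu_lam_pos lam_pos radius_pos)
  also have "\<dots> \<le> emeasure \<mu> Q" using z(2) dyadic_cube_borel[OF Q] by (intro emeasure_mono) auto
  finally show "0 < emeasure \<mu> Q" .
  have "emeasure \<mu> Q \<le> emeasure \<mu> (ball z (C0 * \<delta> powi k))"
    using z(3) by (intro emeasure_mono) auto
  then show "emeasure \<mu> Q < top" using emeasure_mu_lam_ball_finite[OF lam_pos] by (rule le_less_trans)
qed (use dyadic_system countable_dyadic_level dyadic_cube_parent_doubling dyadic_cubes_shrink in
    \<open>auto simp: dyadic_system_def\<close>)

lemma set_nn_integral_eq_set_integral:
  fixes h :: "'a \<Rightarrow> real"
  assumes "set_integrable M I h" and "\<And>x. x \<in> I \<Longrightarrow> 0 \<le> h x"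
  shows "(\<integral>\<^sup>+x\<in>I. ennreal (h x) \<partial>M) = ennreal (\<integral>x\<in>I. h x \<partial>M)"
proof -
  have "(\<integral>\<^sup>+x\<in>I. ennreal (h x) \<partial>M) = (\<integral>\<^sup>+x. ennreal (indicator I x *\<^sub>R h x) \<partial>M)"
    by (intro nn_integral_cong) (auto simp: indicator_def)
  also have "\<dots> = ennreal (\<integral>x. indicator I x *\<^sub>R h x \<partial>M)"
    using assms by (intro nn_integral_eq_integral) (auto simp: set_integrable_def indicator_def)
  finally show ?thesis by (simp add: set_lebesgue_integral_def)
qed

lemma avg_mu_eq_set_average: "avg_mu lam Q f = set_average (mu_lam lam) Q f"
  by (simp add: avg_mu_def set_average_def)

lemma avg_mu_nonneg: "(\<And>t. 0 \<le> f t) \<Longrightarrow> 0 \<le> avg_mu lam Q f"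
  unfolding avg_mu_def set_lebesgue_integral_def
  by (intro divide_nonneg_nonneg Bochner_Integration.integral_nonneg) auto

lemma interval_oscillation_le_bmo_norm:
  assumes "in_BMO lam b" "I \<in> intervals_Rplus"
  shows "avg_mu lam I (\<lambda>t. \<bar>b t - avg_mu lam I b\<bar>) \<le> bmo_norm lam b"
  unfolding bmo_norm_def using assms by (intro cSUP_upper) (auto simp: in_BMO_def)

lemma bmo_norm_nonneg:
  assumes "in_BMO lam b"
  shows "0 \<le> bmo_norm lam b"
  using interval_oscillation_le_bmo_norm[OF assms unit_interval_in_intervals_Rplus]
    avg_mu_nonneg[of "\<lambda>t. \<bar>b t - avg_mu lam {0<..<1} b\<bar>"] by (meson abs_ge_zero order_trans)

lemma nn_interval_oscillation_le:
  assumes lam: "0 < lam" and b: "in_BMO lam b" and I: "I \<in> intervals_Rplus"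
  shows "(\<integral>\<^sup>+t\<in>I. ennreal \<bar>b t - avg_mu lam I b\<bar> \<partial>mu_lam lam)
      \<le> ennreal (bmo_norm lam b) * emeasure (mu_lam lam) I"
proof -
  let ?c = "avg_mu lam I b"
  note I_facts = intervals_Rplus_mu_lam[OF lam I]
  obtain m where m: "0 < m" "emeasure (mu_lam lam) I = ennreal m"
    using ennreal_positive_finiteE[OF I_facts(3,4)] .
  have "set_integrable (mu_lam lam) I (\<lambda>t. ?c)"
    using I_facts by (auto simp: set_integrable_def integrable_indicator_iff)
  then have integrable: "set_integrable (mu_lam lam) I (\<lambda>t. \<bar>b t - ?c\<bar>)"
    using b I by (intro set_integrable_abs set_integral_diff(1)) (auto simp: in_BMO_def)
  have "(\<integral>t\<in>I. \<bar>b t - ?c\<bar> \<partial>mu_lam lam) \<le> bmo_norm lam b * m"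
    using interval_oscillation_le_bmo_norm[OF b I] m
    unfolding avg_mu_def[of lam I "\<lambda>t. \<bar>b t - ?c\<bar>"] by (simp add: divide_le_eq measure_def)
  then show ?thesis
    using set_nn_integral_eq_set_integral[OF integrable] m bmo_norm_nonneg[OF b]
    by (simp add: ennreal_leI flip: ennreal_mult)
qed

lemma (in half_line_dyadic) bmo_tree_half_line:
  assumes b: "in_BMO lam b" and e: "0 < e"
  shows "bmo_tree \<mu> D {0<..} \<kappa> b (2 * \<kappa> * bmo_norm lam b + e)"
proof
  let ?n = "bmo_norm lam b"
  have n: "0 \<le> ?n" using b by (rule bmo_norm_nonneg)
  show b_borel: "b \<in> borel_measurable borel" using b by (simp add: in_BMO_def)
  show "0 < 2 * \<kappa> * ?n + e" using n e \<kappa>_ge_1 by (intro add_nonneg_pos mult_nonneg_nonneg) auto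
  fix k Q assume Q: "Q \<in> D k"
  obtain I where I: "I \<in> intervals_Rplus" "Q \<subseteq> I" "emeasure \<mu> I \<le> ennreal \<kappa> * emeasure \<mu> Q"
    using dyadic_cube_in_interval[OF Q] .
  show b_Q: "set_integrable \<mu> Q b"
    using b I(1,2) dyadic_cube_borel[OF Q]
    by (intro set_integrable_subset[of \<mu> I b Q]) (auto simp: in_BMO_def)
  have "(\<integral>\<^sup>+t\<in>Q. ennreal \<bar>b t - set_average \<mu> Q b\<bar> \<partial>\<mu>) \<le> 2 * (\<integral>\<^sup>+t\<in>Q. ennreal \<bar>b t - avg_mu lam I b\<bar> \<partial>\<mu>)"
    using Q b_Q b_borel cube_sets cube_emeasure_pos cube_emeasure_finite
    by (intro mean_oscillation_le_twice) auto
  also have "\<dots> \<le> 2 * (\<integral>\<^sup>+t\<in>I. ennreal \<bar>b t - avg_mu lam I b\<bar> \<partial>\<mu>)"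
    using I(2) by (intro mult_left_mono nn_set_integral_set_mono) auto
  also have "\<dots> \<le> 2 * (ennreal ?n * (ennreal \<kappa> * emeasure \<mu> Q))"
    using I(3) by (intro mult_left_mono order_trans[OF nn_interval_oscillation_le[OF lam_pos b I(1)]]) auto
  also have "\<dots> = ennreal (2 * \<kappa> * ?n) * emeasure \<mu> Q"
    using n \<kappa>_ge_1 by (simp add: ennreal_mult mult_ac)
  also have "\<dots> \<le> ennreal (2 * \<kappa> * ?n + e) * emeasure \<mu> Q"
    using e by (intro mult_right_mono ennreal_leI) auto
  finally show "(\<integral>\<^sup>+t\<in>Q. ennreal \<bar>b t - set_average \<mu> Q b\<bar> \<partial>\<mu>) \<le> ennreal (2 * \<kappa> * ?n + e) * emeasure \<mu> Q" .
qed

section \<open>Weights on the half-line\<close>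

text \<open>Where \<open>x \<le> 0\<close> or \<open>w x \<le> 0\<close>, a null set for the measure, the weight is set to 1 so that it never
  vanishes.\<close>

definition half_line_weight :: "real \<Rightarrow> (real \<Rightarrow> real) \<Rightarrow> real \<Rightarrow> ennreal" where
  "half_line_weight lam w x = ennreal (if 0 < x \<and> 0 < w x then w x * x powr (- 2 * lam) else 1)"

definition half_line_dual_weight :: "real \<Rightarrow> real \<Rightarrow> (real \<Rightarrow> real) \<Rightarrow> real \<Rightarrow> ennreal" where
  "half_line_dual_weight lam p w x = half_line_weight lam w x epowr (- 1 / (p - 1))"

lemma half_line_weight_pos: "0 < half_line_weight lam w x"
  by (simp add: half_line_weight_def)

lemma half_line_weight_finite: "half_line_weight lam w x < top"
  by (simp add: half_line_weight_def)

lemma half_line_weight_eq: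
  assumes "0 < x" "0 < w x"
  shows "ennreal (x powr (2 * lam)) * half_line_weight lam w x = ennreal (w x)"
  using assms by (simp add: half_line_weight_def powr_minus field_simps flip: ennreal_mult)

lemma half_line_dual_weight_eq:
  assumes "1 < p" "0 < x" "0 < w x"
  shows "ennreal (x powr (2 * lam)) * half_line_dual_weight lam p w x
    = ennreal (x powr (2 * lam * (p / (p - 1))) * w x powr (- 1 / (p - 1)))"
proof -
  have exponents: "2 * lam * (p / (p - 1)) = 2 * lam + 2 * lam / (p - 1)"
    using assms(1) by (simp add: field_simps)
  have "half_line_dual_weight lam p w x = ennreal (w x powr (- 1 / (p - 1)) * x powr (2 * lam / (p - 1)))"
    using assms by (simp add: half_line_dual_weight_def half_line_weight_def powr_mult powr_powr)
  then have "ennreal (x powr (2 * lam)) * half_line_dual_weight lam p w x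
      = ennreal (x powr (2 * lam) * x powr (2 * lam / (p - 1)) * w x powr (- 1 / (p - 1)))"
    by (simp add: ennreal_mult mult_ac)
  then show ?thesis by (simp only: exponents powr_add)
qed

lemma dual_weights_half_line:
  assumes p: "1 < p" and [measurable]: "w \<in> borel_measurable borel"
  shows "dual_weights (mu_lam lam) p (p / (p - 1)) (half_line_weight lam w) (half_line_dual_weight lam p w)"
proof -
  interpret sigma_finite_measure "mu_lam lam" by (rule sigma_finite_mu_lam)
  have v [measurable]: "half_line_weight lam w \<in> borel_measurable borel"
    unfolding half_line_weight_def[abs_def] by measurable
  have s: "half_line_dual_weight lam p w \<in> borel_measurable borel"
    unfolding half_line_dual_weight_def[abs_def] by measurable
  show ?thesis
  proof
    show "1 / p + 1 / (p / (p - 1)) = 1" "1 < p / (p - 1)" using p by (auto simp: field_simps)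
    fix x
    obtain r where r: "0 < r" "half_line_weight lam w x = ennreal r"
      using ennreal_positive_finiteE[OF half_line_weight_pos half_line_weight_finite] .
    have exponents: "1 / p + - 1 / (p - 1) * (1 / (p / (p - 1))) = 0" using p by (simp add: field_simps)
    have "half_line_weight lam w x epowr (1 / p) * half_line_dual_weight lam p w x epowr (1 / (p / (p - 1)))
        = ennreal r epowr 0"
      unfolding half_line_dual_weight_def epowr_epowr epowr_add[symmetric] exponents r(2) ..
    then show "half_line_weight lam w x epowr (1 / p)
        * half_line_dual_weight lam p w x epowr (1 / (p / (p - 1))) = 1"
      using r(1) by simp
  qed (use p v s in auto)
qed

locale weighted_half_line = half_line_dyadic +
  fixes p :: real and w :: "real \<Rightarrow> real"
  assumes exponent_gt_1: "1 < p" and weight: "in_Ap_tilde lam p w"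

sublocale weighted_half_line \<subseteq>
  dual_weights \<mu> p "p / (p - 1)" "half_line_weight lam w" "half_line_dual_weight lam p w"
  using exponent_gt_1 weight by (intro dual_weights_half_line) (auto simp: in_Ap_tilde_def)

context weighted_half_line
begin

lemma w_nonneg: "0 < x \<Longrightarrow> 0 \<le> w x"
  and AE_w_pos: "AE x in lborel. 0 < x \<longrightarrow> 0 < w x"
  using weight by (auto simp: in_Ap_tilde_def)

lemma AE_\<nu>_iff: "(AE x in \<nu>. P x) \<longleftrightarrow> (AE x in lborel. 0 < x \<longrightarrow> P x)"
  using v_pos by (simp add: AE_density AE_mu_lam_iff)

lemma nn_integral_\<nu>:
  assumes [measurable]: "h \<in> borel_measurable borel"
  shows "(\<integral>\<^sup>+x. h x \<partial>\<nu>) = (\<integral>\<^sup>+x\<in>{0<..}. h x * ennreal (w x) \<partial>lborel)"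
proof -
  have "(\<integral>\<^sup>+x. h x \<partial>\<nu>)
      = (\<integral>\<^sup>+x\<in>{0<..}. ennreal (x powr (2 * lam)) * (half_line_weight lam w x * h x) \<partial>lborel)"
    by (simp add: nn_integral_density nn_integral_mu_lam)
  also have "\<dots> = (\<integral>\<^sup>+x\<in>{0<..}. h x * ennreal (w x) \<partial>lborel)"
    using AE_w_pos
  proof (intro nn_integral_cong_AE, elim AE_mp, intro AE_I2 impI)
    fix x assume w: "0 < x \<longrightarrow> 0 < w x"
    have "ennreal (x powr (2 * lam)) * (half_line_weight lam w x * h x) = h x * ennreal (w x)" if "0 < x"
      using half_line_weight_eq[of x w lam] w that by (simp add: mult.commute[of "h x"] flip: mult.assoc)
    then show "ennreal (x powr (2 * lam)) * (half_line_weight lam w x * h x) * indicator {0<..} x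
        = h x * ennreal (w x) * indicator {0<..} x"
      by (auto simp: indicator_def)
  qed
  finally show ?thesis .
qed

lemma emeasure_\<nu>_half_line:
  assumes "I \<in> sets borel" "I \<subseteq> {0<..}"
  shows "emeasure \<nu> I = (\<integral>\<^sup>+x\<in>I. ennreal (w x) \<partial>lborel)"
proof -
  have "emeasure \<nu> I = (\<integral>\<^sup>+x. indicator I x \<partial>\<nu>)" using assms(1) by simp
  also have "\<dots> = (\<integral>\<^sup>+x\<in>{0<..}. indicator I x * ennreal (w x) \<partial>lborel)"
    using assms(1) by (intro nn_integral_\<nu>) auto
  also have "\<dots> = (\<integral>\<^sup>+x\<in>I. ennreal (w x) \<partial>lborel)"
    using assms(2) by (intro nn_integral_cong) (auto simp: indicator_def)
  finally show ?thesis .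
qed

lemma emeasure_\<sigma>_half_line:
  assumes [measurable]: "I \<in> sets borel" and I: "I \<subseteq> {0<..}"
  shows "emeasure \<sigma> I
      = (\<integral>\<^sup>+t\<in>I. ennreal (t powr (2 * lam * (p / (p - 1))) * w t powr (- 1 / (p - 1))) \<partial>lborel)"
proof -
  have "emeasure \<sigma> I
      = (\<integral>\<^sup>+x\<in>{0<..}. ennreal (x powr (2 * lam)) * (half_line_dual_weight lam p w x * indicator I x) \<partial>lborel)"
    by (simp add: emeasure_density nn_integral_mu_lam)
  also have "\<dots> = (\<integral>\<^sup>+t\<in>I. ennreal (t powr (2 * lam * (p / (p - 1))) * w t powr (- 1 / (p - 1))) \<partial>lborel)"
    using AE_w_pos I exponent_gt_1
    by (intro nn_integral_cong_AE, elim AE_mp) (auto simp: indicator_def half_line_dual_weight_eq intro!: AE_I2)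
  finally show ?thesis .
qed

lemma Ap_ratio_interval:
  assumes I: "I \<in> intervals_Rplus"
  shows "Ap_ratio I = ennreal (Ap_char lam p w I)"
proof -
  let ?s = "\<lambda>t. t powr (2 * lam * (p / (p - 1))) * w t powr (- 1 / (p - 1))"
  note I_facts = intervals_Rplus_mu_lam[OF lam_pos I]
  obtain m where m: "0 < m" "emeasure \<mu> I = ennreal m"
    using ennreal_positive_finiteE[OF I_facts(3,4)] .
  have integrable: "set_integrable lborel I w" "set_integrable lborel I ?s"
    using weight I by (auto simp: in_Ap_tilde_def)
  have nonneg: "0 \<le> w x" if "x \<in> I" for x using w_nonneg that I_facts(2) by auto
  have "emeasure \<nu> I = ennreal (\<integral>t\<in>I. w t \<partial>lborel)"
    unfolding emeasure_\<nu>_half_line[OF I_facts(1,2)]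
    by (rule set_nn_integral_eq_set_integral[OF integrable(1) nonneg])
  moreover have "emeasure \<sigma> I = ennreal (\<integral>t\<in>I. ?s t \<partial>lborel)"
    unfolding emeasure_\<sigma>_half_line[OF I_facts(1,2)]
    by (rule set_nn_integral_eq_set_integral[OF integrable(2)]) simp
  moreover have "0 \<le> (\<integral>t\<in>I. w t \<partial>lborel)" "0 \<le> (\<integral>t\<in>I. ?s t \<partial>lborel)"
    using nonneg unfolding set_lebesgue_integral_def
    by (auto intro!: Bochner_Integration.integral_nonneg simp: indicator_def)
  ultimately show ?thesis
    using m by (simp add: Ap_ratio_def Ap_char_def measure_def divide_ennreal flip: ennreal_mult)
qed

lemma Ap_ratio_interval_le: "I \<in> intervals_Rplus \<Longrightarrow> Ap_ratio I \<le> ennreal (Ap_const lam p w)"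
  unfolding Ap_ratio_interval Ap_const_def using weight
  by (intro ennreal_leI cSUP_upper) (auto simp: in_Ap_tilde_def)

lemma one_le_Ap_const: "1 \<le> Ap_const lam p w"
proof -
  have "1 \<le> Ap_ratio {0<..<1}"
    using intervals_Rplus_mu_lam[OF lam_pos unit_interval_in_intervals_Rplus]
    by (intro one_le_Ap_ratio) auto
  also have "\<dots> \<le> ennreal (Ap_const lam p w)"
    by (rule Ap_ratio_interval_le[OF unit_interval_in_intervals_Rplus])
  finally show ?thesis by simp
qed

lemma Ap_on_cubes: "Ap_on cubes (ennreal (\<kappa> powr p * Ap_const lam p w))"
  unfolding Ap_on_def
proof (intro conjI ballI)
  fix Q assume Q: "Q \<in> cubes"
  then obtain k where "Q \<in> D k" by (rule cubesE)
  then obtain I where I: "I \<in> intervals_Rplus" "Q \<subseteq> I" "emeasure \<mu> I \<le> ennreal \<kappa> * emeasure \<mu> Q"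
    by (rule dyadic_cube_in_interval)
  have "Ap_ratio Q \<le> ennreal \<kappa> epowr p * Ap_ratio I"
    using I intervals_Rplus_mu_lam[OF lam_pos I(1)] cube_emeasure(1)[OF Q]
    by (intro Ap_ratio_le_doubling) auto
  also have "\<dots> \<le> ennreal \<kappa> epowr p * ennreal (Ap_const lam p w)"
    by (intro mult_left_mono Ap_ratio_interval_le I) simp
  finally show "Ap_ratio Q \<le> ennreal (\<kappa> powr p * Ap_const lam p w)"
    using \<kappa>_ge_1 by (simp add: ennreal_mult')
qed simp

end

section \<open>The weighted commutator estimate\<close>

lemma ennreal_le_mult_limit:
  fixes c a :: real and x n :: ennreal
  assumes c: "0 \<le> c" and a: "0 \<le> a" and n: "n < top" and x_le: "\<And>e. 0 < e \<Longrightarrow> x \<le> ennreal (c * (a + e)) * n"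
  shows "x \<le> ennreal (c * a) * n"
proof (rule ennreal_le_epsilon)
  fix d :: real assume d: "0 < d"
  obtain r where r: "0 \<le> r" "n = ennreal r" using n by (cases n) auto
  let ?e = "d / (c * r + 1)"
  have e_pos: "0 < ?e" using c r d by (intro divide_pos_pos add_nonneg_pos) auto
  have "c * r * ?e \<le> (c * r + 1) * ?e" using e_pos by (intro mult_right_mono) auto
  also have "\<dots> = d" using c r by (simp add: add_nonneg_eq_0_iff)
  finally have "c * r * ?e \<le> d" .
  then have "c * (a + ?e) * r \<le> c * a * r + d" by (simp add: algebra_simps)
  have "x \<le> ennreal (c * (a + ?e)) * n" using e_pos by (rule x_le)
  also have "\<dots> = ennreal (c * (a + ?e) * r)"
    using c a r e_pos by (simp flip: ennreal_mult)
  also have "\<dots> \<le> ennreal (c * a * r + d)" by (intro ennreal_leI) fact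
  also have "\<dots> = ennreal (c * a) * n + ennreal d"
    using c a r d by (simp add: ennreal_mult)
  finally show "x \<le> ennreal (c * a) * n + ennreal d" .
qed

definition (in half_line_dyadic) comm_const :: "real \<Rightarrow> real \<Rightarrow> nat \<Rightarrow> real" where
  "comm_const p \<Lambda> N = 12 * \<kappa>\<^sup>2
     * ((1 + sparse_const p (p / (p - 1)) \<Lambda> N) * (1 + sparse_const p (p / (p - 1)) (1 / 2) 1))
     * (\<kappa> powr p) powr (2 * max 1 (1 / (p - 1)))"

lemma (in half_line_dyadic) comm_const_pos: "0 < comm_const p \<Lambda> N"
  unfolding comm_const_def using \<kappa>_ge_1 by (intro mult_pos_pos add_pos_nonneg sparse_const_nonneg) auto

context weighted_half_line
begin

abbreviation cube_Ap_power :: real where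
  "cube_Ap_power \<equiv> (\<kappa> powr p * Ap_const lam p w) powr max 1 (1 / (p - 1))"

definition comm_form_const :: "real \<Rightarrow> nat \<Rightarrow> real" where
  "comm_form_const \<Lambda> N = 6 * \<kappa>
     * ((1 + sparse_const p (p / (p - 1)) \<Lambda> N) * (1 + sparse_const p (p / (p - 1)) (1 / 2) 1))
     * cube_Ap_power\<^sup>2"

lemma comm_form_const_nonneg: "0 \<le> comm_form_const \<Lambda> N"
  unfolding comm_form_const_def using \<kappa>_ge_1 sparse_const_nonneg
  by (intro mult_nonneg_nonneg add_nonneg_nonneg) auto

lemma comm_form_const_eq_comm_const:
  "2 * \<kappa> * comm_form_const \<Lambda> N = comm_const p \<Lambda> N * Ap_const lam p w powr (2 * max 1 (1 / (p - 1)))"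
proof -
  have "cube_Ap_power\<^sup>2 = (\<kappa> powr p * Ap_const lam p w) powr (2 * max 1 (1 / (p - 1)))"
    by (simp only: power2_eq_square mult_2 powr_add)
  then have "cube_Ap_power\<^sup>2
      = (\<kappa> powr p) powr (2 * max 1 (1 / (p - 1))) * Ap_const lam p w powr (2 * max 1 (1 / (p - 1)))"
    by (simp only: powr_mult)
  then show ?thesis
    by (simp add: comm_form_const_def comm_const_def power2_eq_square)
qed

lemma sparse_form_bounded_cubes:
  assumes "sparse_family \<mu> \<Lambda> N S" "S \<subseteq> cubes" "0 < \<Lambda>"
  shows "form_bounded (sparse_form \<mu> S) (ennreal (sparse_const p (p / (p - 1)) \<Lambda> N * cube_Ap_power))"
proof -
  have "0 \<le> \<kappa> powr p * Ap_const lam p w" using one_le_Ap_const by simp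
  then show ?thesis
    using sparse_form_bounded[OF assms(1,3) Ap_on_subset[OF Ap_on_cubes assms(2)]]
    by (simp only: epowr_ennreal ennreal_mult[OF sparse_const_nonneg powr_ge_zero])
qed

lemma comm_forms_bounded:
  assumes b: "in_BMO lam b" and e: "0 < e"
    and S: "sparse_family \<mu> \<Lambda> N S" "S \<subseteq> cubes" "0 < \<Lambda>"
  defines "C \<equiv> ennreal (comm_form_const \<Lambda> N * (2 * \<kappa> * bmo_norm lam b + e))"
  shows "form_bounded (weighted_sparse_form \<mu> S (deviation \<mu> b) (\<lambda>_ _. 1)) C"
    and "form_bounded (weighted_sparse_form \<mu> S (\<lambda>_ _. 1) (deviation \<mu> b)) C"
proof -
  let ?B = "2 * \<kappa> * bmo_norm lam b + e" and ?P = cube_Ap_power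
  let ?c = "sparse_const p (p / (p - 1)) \<Lambda> N" and ?c' = "sparse_const p (p / (p - 1)) (1 / 2) 1"
  interpret bmo: bmo_tree \<mu> D "{0<..}" \<kappa> b ?B using b e by (rule bmo_tree_half_line)
  interpret weighted_bmo_tree \<mu> D "{0<..}" \<kappa> b ?B p "p / (p - 1)"
    "half_line_weight lam w" "half_line_dual_weight lam p w" ..
  have nonneg: "0 \<le> ?c" "0 \<le> ?c'" by (rule sparse_const_nonneg)+
  have "1 \<le> ?P"
    using one_le_Ap_const \<kappa>_ge_1 exponent_gt_1 mult_mono[of 1 "\<kappa> powr p" 1 "Ap_const lam p w"]
    by (intro ge_one_powr_ge_zero) (auto simp: ge_one_powr_ge_zero)
  then have "?c * ?P * (1 + ?c' * ?P) \<le> (1 + ?c) * ?P * (?P + ?c' * ?P)"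
    using nonneg by (intro mult_mono add_right_mono) auto
  then have "6 * \<kappa> * ?B * (?c * ?P * (1 + ?c' * ?P)) \<le> 6 * \<kappa> * ?B * ((1 + ?c) * ?P * (?P + ?c' * ?P))"
    using bmo.B_pos \<kappa>_ge_1 by (intro mult_left_mono) auto
  also have "\<dots> = comm_form_const \<Lambda> N * ?B"
    by (simp add: comm_form_const_def power2_eq_square algebra_simps)
  finally have "ennreal (6 * \<kappa> * ?B * (?c * ?P * (1 + ?c' * ?P))) \<le> C"
    unfolding C_def by (rule ennreal_leI)
  then have C: "ennreal (6 * \<kappa> * ?B) * (ennreal (?c * ?P) * (1 + ennreal (?c' * ?P))) \<le> C"
    using bmo.B_pos \<kappa>_ge_1 nonneg by (simp add: ennreal_mult)
  have T: "form_bounded (sparse_form \<mu> T) (ennreal (?c' * ?P))"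
    if "T \<subseteq> cubes" "sparse_family \<mu> (1 / 2) 1 T" for T
    using that by (intro sparse_form_bounded_cubes) auto
  note bounds = comm_form_bounded comm_form_bounded_transpose
  show "form_bounded (weighted_sparse_form \<mu> S (deviation \<mu> b) (\<lambda>_ _. 1)) C"
    "form_bounded (weighted_sparse_form \<mu> S (\<lambda>_ _. 1) (deviation \<mu> b)) C"
    using bounds[OF S(2) sparse_form_bounded_cubes[OF S] T, THEN form_bounded_mono, OF _ _ C] by auto
qed

lemma nn_comm_op_norms_le:
  assumes b: "in_BMO lam b" and S: "sparse_family \<mu> \<Lambda> N S" "S \<subseteq> cubes" "0 < \<Lambda>"
    and f: "f \<in> borel_measurable borel" "nn_Lp_norm \<nu> p f < top"
  defines "C \<equiv> ennreal (comm_const p \<Lambda> N * bmo_norm lam b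
      * Ap_const lam p w powr (2 * max 1 (1 / (p - 1))))"
  shows "nn_Lp_norm \<nu> p (weighted_sparse_op \<mu> S (deviation \<mu> b) (\<lambda>_ _. 1) f) \<le> C * nn_Lp_norm \<nu> p f"
    and "nn_Lp_norm \<nu> p (weighted_sparse_op \<mu> S (\<lambda>_ _. 1) (deviation \<mu> b) f) \<le> C * nn_Lp_norm \<nu> p f"
proof -
  have b_borel: "b \<in> borel_measurable borel" using b by (simp add: in_BMO_def)
  have "cube_family \<mu> S" using S(1) by (simp add: sparse_family_def)
  note S_sets = cube_familyD(1,3)[OF this]
  have C: "C = ennreal (comm_form_const \<Lambda> N * (2 * \<kappa> * bmo_norm lam b))"
    unfolding C_def using comm_form_const_eq_comm_const[of \<Lambda> N] by (simp add: mult_ac)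
  note limit = ennreal_le_mult_limit[OF comm_form_const_nonneg[of \<Lambda> N], of "2 * \<kappa> * bmo_norm lam b"]
  show "nn_Lp_norm \<nu> p (weighted_sparse_op \<mu> S (deviation \<mu> b) (\<lambda>_ _. 1) f) \<le> C * nn_Lp_norm \<nu> p f"
    unfolding C using bmo_norm_nonneg[OF b] \<kappa>_ge_1 f
    by (intro limit nn_Lp_norm_weighted_sparse_op_le S_sets comm_forms_bounded(1) b S) auto
  show "nn_Lp_norm \<nu> p (weighted_sparse_op \<mu> S (\<lambda>_ _. 1) (deviation \<mu> b) f) \<le> C * nn_Lp_norm \<nu> p f"
    unfolding C using bmo_norm_nonneg[OF b] \<kappa>_ge_1 f b_borel
    by (intro limit nn_Lp_norm_weighted_sparse_op_le S_sets comm_forms_bounded(2) b S) auto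
qed

lemma Lp_w_pow_eq_nn_Lp_norm:
  assumes [measurable]: "f \<in> borel_measurable borel"
  shows "Lp_w_pow p w f = nn_Lp_norm \<nu> p (\<lambda>x. ennreal \<bar>f x\<bar>) epowr p"
  using w_nonneg exponent_gt_1
  by (auto simp: Lp_w_pow_def nn_Lp_norm_powr nn_integral_\<nu> indicator_def ennreal_mult intro!: nn_integral_cong)

lemma Lp_w_pow_le_nn_Lp_norm:
  assumes [measurable]: "H \<in> borel_measurable borel" and h_le: "AE x in \<nu>. ennreal \<bar>h x\<bar> \<le> H x"
  shows "Lp_w_pow p w h \<le> nn_Lp_norm \<nu> p H epowr p"
proof -
  have "AE x in lborel. 0 < x \<longrightarrow> ennreal \<bar>h x\<bar> \<le> H x" using h_le by (simp add: AE_\<nu>_iff)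
  then have "Lp_w_pow p w h \<le> (\<integral>\<^sup>+x\<in>{0<..}. H x epowr p * ennreal (w x) \<partial>lborel)"
    unfolding Lp_w_pow_def
  proof (intro nn_integral_mono_AE, elim AE_mp, intro AE_I2 impI)
    fix x assume x: "0 < x \<longrightarrow> ennreal \<bar>h x\<bar> \<le> H x"
    have "ennreal \<bar>h x\<bar> epowr p * ennreal (w x) \<le> H x epowr p * ennreal (w x)" if "0 < x"
      using x that exponent_gt_1 by (intro mult_right_mono epowr_mono) auto
    then show "ennreal (\<bar>h x\<bar> powr p * w x) * indicator {0<..} x
        \<le> H x epowr p * ennreal (w x) * indicator {0<..} x"
      by (auto simp: indicator_def ennreal_mult')
  qed
  then show ?thesis
    using exponent_gt_1 by (simp add: nn_Lp_norm_powr nn_integral_\<nu>)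
qed

end

lemma summable_on_if_nn_integral_finite:
  fixes \<tau> :: "'i \<Rightarrow> real"
  assumes "(\<integral>\<^sup>+i. ennreal \<bar>\<tau> i\<bar> \<partial>count_space S) < top"
  shows "\<tau> summable_on S" and "ennreal \<bar>\<Sum>\<^sub>\<infinity>i\<in>S. \<tau> i\<bar> \<le> (\<integral>\<^sup>+i. ennreal \<bar>\<tau> i\<bar> \<partial>count_space S)"
proof -
  have integrable: "integrable (count_space S) \<tau>"
    using assms by (simp add: integrable_iff_bounded)
  then have abs_summable: "Infinite_Set_Sum.abs_summable_on \<tau> S" by (simp add: abs_summable_on_def)
  then show "\<tau> summable_on S"
    by (rule abs_summable_summable[OF abs_summable_equivalent[THEN iffD2]])
  have "(\<Sum>\<^sub>\<infinity>i\<in>S. \<tau> i) = (\<integral>i. \<tau> i \<partial>count_space S)"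
    by (simp add: infsetsum_infsum[OF abs_summable, symmetric] infsetsum_def)
  then show "ennreal \<bar>\<Sum>\<^sub>\<infinity>i\<in>S. \<tau> i\<bar> \<le> (\<integral>\<^sup>+i. ennreal \<bar>\<tau> i\<bar> \<partial>count_space S)"
    using integral_norm_bound_ennreal[OF integrable] by simp
qed

lemma real_sparse_term_le:
  fixes k f :: "'a \<Rightarrow> real"
  assumes Q: "0 < emeasure M Q" "emeasure M Q < top" and nonneg: "\<And>t. 0 \<le> k t" "0 \<le> y"
  shows "ennreal \<bar>1 / measure M Q * (\<integral>t\<in>Q. k t * f t \<partial>M) * y\<bar>
    \<le> nn_average M Q (\<lambda>t. ennreal (k t) * ennreal \<bar>f t\<bar>) * ennreal y"
proof -
  obtain m where m: "0 < m" "emeasure M Q = ennreal m"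
    using ennreal_positive_finiteE[OF Q] .
  have "ennreal \<bar>1 / measure M Q * (\<integral>t\<in>Q. k t * f t \<partial>M) * y\<bar>
      = ennreal \<bar>\<integral>t\<in>Q. k t * f t \<partial>M\<bar> / emeasure M Q * ennreal y"
    using m nonneg(2) by (simp add: measure_def abs_mult divide_ennreal flip: ennreal_mult)
  also have "\<dots> \<le> (\<integral>\<^sup>+t\<in>Q. ennreal \<bar>k t * f t\<bar> \<partial>M) / emeasure M Q * ennreal y"
    by (intro mult_right_mono divide_right_mono_ennreal ennreal_abs_set_integral_le) simp
  finally show ?thesis
    using nonneg(1) by (simp add: nn_average_def abs_mult ennreal_mult')
qed

context weighted_half_line
begin

lemma dominated_sum_bounds:
  fixes \<tau> :: "real \<Rightarrow> 'i \<Rightarrow> real"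
  assumes H [measurable]: "H \<in> borel_measurable borel" and H_finite: "nn_Lp_norm \<nu> p H < top"
    and dominated: "\<And>x. (\<integral>\<^sup>+i. ennreal \<bar>\<tau> x i\<bar> \<partial>count_space S) \<le> H x"
  shows "AE x in lborel. 0 < x \<longrightarrow> \<tau> x summable_on S"
    and "Lp_w_pow p w (\<lambda>x. \<Sum>\<^sub>\<infinity>i\<in>S. \<tau> x i) \<le> nn_Lp_norm \<nu> p H epowr p"
proof -
  have "(\<integral>\<^sup>+x. H x epowr p \<partial>\<nu>) \<noteq> \<infinity>"
    using H_finite exponent_gt_1 by (simp add: nn_Lp_norm_def)
  then have "AE x in \<nu>. H x epowr p \<noteq> \<infinity>" by (intro nn_integral_PInf_AE) measurable
  then have finite: "AE x in \<nu>. (\<integral>\<^sup>+i. ennreal \<bar>\<tau> x i\<bar> \<partial>count_space S) < top"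
  proof (rule AE_mp, intro AE_I2 impI)
    fix x assume "H x epowr p \<noteq> \<infinity>"
    then have "H x < top" by (simp add: less_top)
    then show "(\<integral>\<^sup>+i. ennreal \<bar>\<tau> x i\<bar> \<partial>count_space S) < top" by (rule le_less_trans[OF dominated])
  qed
  then have "AE x in \<nu>. \<tau> x summable_on S"
    by (rule AE_mp) (auto intro: summable_on_if_nn_integral_finite(1))
  then show "AE x in lborel. 0 < x \<longrightarrow> \<tau> x summable_on S" by (simp add: AE_\<nu>_iff)
  have "AE x in \<nu>. ennreal \<bar>\<Sum>\<^sub>\<infinity>i\<in>S. \<tau> x i\<bar> \<le> H x"
    using finite
    by (rule AE_mp) (auto intro: order_trans[OF summable_on_if_nn_integral_finite(2) dominated])
  then show "Lp_w_pow p w (\<lambda>x. \<Sum>\<^sub>\<infinity>i\<in>S. \<tau> x i) \<le> nn_Lp_norm \<nu> p H epowr p"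
    by (intro Lp_w_pow_le_nn_Lp_norm H)
qed

lemma real_sparse_sum_bounds:
  fixes S :: "real set set" and k h :: "real set \<Rightarrow> real \<Rightarrow> real" and \<tau> :: "real \<Rightarrow> real set \<Rightarrow> real"
  defines "T \<equiv> weighted_sparse_op \<mu> S (\<lambda>Q x. ennreal (k Q x)) (\<lambda>Q x. ennreal (h Q x))"
  assumes S: "S \<subseteq> cubes" and nonneg: "\<And>Q x. 0 \<le> k Q x" "\<And>Q x. 0 \<le> h Q x"
    and h: "\<And>Q. h Q \<in> borel_measurable borel"
    and \<tau>: "\<And>x Q. \<tau> x Q = 1 / measure \<mu> Q * (\<integral>t\<in>Q. k Q t * f t \<partial>\<mu>) * (h Q x * indicator Q x)"
    and f: "in_Lp_w p w f" and B: "0 \<le> B"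
    and T_bound: "nn_Lp_norm \<nu> p (T (\<lambda>x. ennreal \<bar>f x\<bar>)) \<le> ennreal B * nn_Lp_norm \<nu> p (\<lambda>x. ennreal \<bar>f x\<bar>)"
  shows "AE x in lborel. 0 < x \<longrightarrow> \<tau> x summable_on S"
    and "Lp_w_pow p w (\<lambda>x. \<Sum>\<^sub>\<infinity>Q\<in>S. \<tau> x Q) \<le> ennreal (B powr p) * Lp_w_pow p w f"
proof -
  let ?f = "\<lambda>x. ennreal \<bar>f x\<bar>"
  have [measurable]: "f \<in> borel_measurable borel" and f_finite: "nn_Lp_norm \<nu> p ?f epowr p < top"
    using f Lp_w_pow_eq_nn_Lp_norm[of f] by (auto simp: in_Lp_w_def Lp_w_pow_def)
  have family: "cube_family \<mu> S" using cube_family_cubes S by (rule cube_family_subset)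
  have T_borel: "T ?f \<in> borel_measurable borel"
    using borel_measurable_weighted_sparse_op[of S \<mu> "\<lambda>Q x. ennreal (h Q x)"] cube_familyD[OF family] h
    by (simp add: T_def)
  have dominated: "(\<integral>\<^sup>+Q. ennreal \<bar>\<tau> x Q\<bar> \<partial>count_space S) \<le> T ?f x" for x
    unfolding T_def weighted_sparse_op_def
  proof (rule nn_integral_mono)
    fix Q assume "Q \<in> space (count_space S)"
    then have Q: "0 < emeasure \<mu> Q" "emeasure \<mu> Q < top" using cube_familyD(5,6)[OF family] by auto
    have "ennreal \<bar>\<tau> x Q\<bar> \<le> nn_average \<mu> Q (\<lambda>t. ennreal (k Q t) * ?f t) * ennreal (h Q x * indicator Q x)"
      unfolding \<tau> using nonneg by (intro real_sparse_term_le Q) auto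
    then show "ennreal \<bar>\<tau> x Q\<bar>
        \<le> nn_average \<mu> Q (\<lambda>t. ennreal (k Q t) * ?f t) * (ennreal (h Q x) * indicator Q x)"
      using nonneg(2) by (simp add: ennreal_mult ennreal_indicator)
  qed
  have T_finite: "nn_Lp_norm \<nu> p (T ?f) < top"
    using f_finite by (intro le_less_trans[OF T_bound]) (simp add: ennreal_mult_less_top)
  show "AE x in lborel. 0 < x \<longrightarrow> \<tau> x summable_on S"
    by (rule dominated_sum_bounds(1)[OF T_borel T_finite dominated])
  have "Lp_w_pow p w (\<lambda>x. \<Sum>\<^sub>\<infinity>Q\<in>S. \<tau> x Q) \<le> nn_Lp_norm \<nu> p (T ?f) epowr p"
    by (rule dominated_sum_bounds(2)[OF T_borel T_finite dominated])
  also have "\<dots> \<le> (ennreal B * nn_Lp_norm \<nu> p ?f) epowr p"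
    using exponent_gt_1 T_bound by (intro epowr_mono) auto
  also have "\<dots> = ennreal (B powr p) * Lp_w_pow p w f"
    using B by (simp add: epowr_mult Lp_w_pow_eq_nn_Lp_norm)
  finally show "Lp_w_pow p w (\<lambda>x. \<Sum>\<^sub>\<infinity>Q\<in>S. \<tau> x Q) \<le> ennreal (B powr p) * Lp_w_pow p w f" .
qed

end

lemma (in half_line_dyadic) sparse_imp_sparse_family:
  assumes S: "sparse lam \<Lambda> N D S" and \<Lambda>: "0 < \<Lambda>"
  shows "sparse_family \<mu> \<Lambda> N S" "S \<subseteq> cubes"
proof -
  show cubes: "S \<subseteq> cubes" using S by (auto simp: sparse_def dyadic_cubes_def cubes_def)
  obtain E where parts: "\<forall>Q\<in>S. E Q \<subseteq> Q \<and> E Q \<in> sets borel \<and> \<Lambda> * measure \<mu> Q \<le> measure \<mu> (E Q)"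
    and overlap: "bounded_overlap N S E"
    using S unfolding sparse_def bounded_overlap_def by blast
  note E = bspec[OF parts]
  have "ennreal \<Lambda> * emeasure \<mu> Q \<le> emeasure \<mu> (E Q)" if Q: "Q \<in> S" for Q
  proof -
    have Q_cube: "Q \<in> cubes" using Q cubes by blast
    have "emeasure \<mu> (E Q) \<le> emeasure \<mu> Q"
      using E[OF Q] cube_measurable[OF Q_cube] by (intro emeasure_mono) auto
    then have "emeasure \<mu> (E Q) = ennreal (measure \<mu> (E Q))"
      using cube_emeasure(2)[OF Q_cube] by (intro emeasure_eq_ennreal_measure) (auto simp: top_unique)
    then show ?thesis
      using E[OF Q] \<Lambda> by (simp add: cube_emeasure_eq[OF Q_cube] ennreal_leI flip: ennreal_mult)
  qed
  then have "sparse_parts \<mu> \<Lambda> N S E" using E overlap by (simp add: sparse_parts_def)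
  then show "sparse_family \<mu> \<Lambda> N S"
    using cube_family_subset[OF cube_family_cubes cubes] by (auto simp: sparse_family_def)
qed

lemma (in weighted_half_line) sparse_comm_bounds:
  assumes S: "sparse lam \<Lambda> N D S" "0 < \<Lambda>" and b: "in_BMO lam b" and f: "in_Lp_w p w f"
  defines "B \<equiv> comm_const p \<Lambda> N * bmo_norm lam b * Ap_const lam p w powr (2 * max 1 (1 / (p - 1)))"
  shows "AE x in lborel. 0 < x \<longrightarrow> comm_term lam b f x summable_on S"
    and "Lp_w_pow p w (sparse_comm lam S b f) \<le> ennreal (B powr p) * Lp_w_pow p w f"
    and "AE x in lborel. 0 < x \<longrightarrow> comm_adj_term lam b f x summable_on S"
    and "Lp_w_pow p w (sparse_comm_adj lam S b f) \<le> ennreal (B powr p) * Lp_w_pow p w f"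
proof -
  note family = sparse_imp_sparse_family[OF S]
  have B: "0 \<le> B"
    unfolding B_def using comm_const_pos[of p \<Lambda> N] bmo_norm_nonneg[OF b] by simp
  have [measurable]: "b \<in> borel_measurable borel" using b by (simp add: in_BMO_def)
  have f_borel: "f \<in> borel_measurable borel" and f_fin: "Lp_w_pow p w f < top"
    using f by (auto simp: in_Lp_w_def Lp_w_pow_def)
  then have "nn_Lp_norm \<nu> p (\<lambda>x. ennreal \<bar>f x\<bar>) < top"
    by (simp add: Lp_w_pow_eq_nn_Lp_norm)
  note norms = nn_comm_op_norms_le[OF b family S(2) _ this, folded B_def]
  have deviation: "deviation \<mu> b = (\<lambda>Q x. ennreal \<bar>b x - avg_mu lam Q b\<bar>)"
    by (simp add: deviation_def[abs_def] avg_mu_eq_set_average)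
  note bounds = real_sparse_sum_bounds[OF family(2) _ _ _ _ f B]
  show "AE x in lborel. 0 < x \<longrightarrow> comm_term lam b f x summable_on S"
    "Lp_w_pow p w (sparse_comm lam S b f) \<le> ennreal (B powr p) * Lp_w_pow p w f"
    unfolding sparse_comm_def[abs_def] using norms(2) f_borel
    by (intro bounds[where k = "\<lambda>_ _. 1" and h = "\<lambda>Q x. \<bar>b x - avg_mu lam Q b\<bar>"];
        simp add: comm_term_def deviation mult_ac)+
  show "AE x in lborel. 0 < x \<longrightarrow> comm_adj_term lam b f x summable_on S"
    "Lp_w_pow p w (sparse_comm_adj lam S b f) \<le> ennreal (B powr p) * Lp_w_pow p w f"
    unfolding sparse_comm_adj_def[abs_def] using norms(1) f_borel
    by (intro bounds[where k = "\<lambda>Q x. \<bar>b x - avg_mu lam Q b\<bar>" and h = "\<lambda>_ _. 1"];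
        simp add: comm_adj_term_def deviation)+
qed

theorem theorem1p6:
  fixes lam p \<Lambda> \<delta> c0 C0 :: real and D :: "int \<Rightarrow> real set set" and N :: nat
  assumes "lam > 0" and "1 < p" and "0 < \<Lambda>" and "\<Lambda> < 1"
    and "dyadic_system \<delta> c0 C0 D"
  shows "\<exists>C>0. \<forall>S b w f.
           sparse lam \<Lambda> N D S \<and> in_BMO lam b \<and> in_Ap_tilde lam p w \<and> in_Lp_w p w f \<longrightarrow>
             (AE x in lborel. x > 0 \<longrightarrow> (comm_term lam b f x) summable_on S)
           \<and> (AE x in lborel. x > 0 \<longrightarrow> (comm_adj_term lam b f x) summable_on S)
           \<and> Lp_w_pow p w (sparse_comm lam S b f)
               \<le> ennreal ((C * bmo_norm lam b * Ap_const lam p w powr (2 * max 1 (1 / (p - 1)))) powr p)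
                   * Lp_w_pow p w f
           \<and> Lp_w_pow p w (sparse_comm_adj lam S b f)
               \<le> ennreal ((C * bmo_norm lam b * Ap_const lam p w powr (2 * max 1 (1 / (p - 1)))) powr p)
                   * Lp_w_pow p w f"
proof -
  interpret half_line_dyadic lam \<delta> c0 C0 D using assms by unfold_locales
  show ?thesis
  proof (intro exI[of _ "comm_const p \<Lambda> N"] conjI comm_const_pos allI impI; elim conjE)
    fix S b w f
    assume S: "sparse lam \<Lambda> N D S" and b: "in_BMO lam b" and w: "in_Ap_tilde lam p w" and f: "in_Lp_w p w f"
    interpret weighted_half_line lam \<delta> c0 C0 D p w using assms(2) w by unfold_locales
    note bounds = sparse_comm_bounds[OF S assms(3) b f]
    from bounds(1) show "AE x in lborel. x > 0 \<longrightarrow> (comm_term lam b f x) summable_on S" .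
    from bounds(3) show "AE x in lborel. x > 0 \<longrightarrow> (comm_adj_term lam b f x) summable_on S" .
    from bounds(2) show "Lp_w_pow p w (sparse_comm lam S b f)
        \<le> ennreal ((comm_const p \<Lambda> N * bmo_norm lam b * Ap_const lam p w powr (2 * max 1 (1 / (p - 1)))) powr p)
          * Lp_w_pow p w f" .
    from bounds(4) show "Lp_w_pow p w (sparse_comm_adj lam S b f)
        \<le> ennreal ((comm_const p \<Lambda> N * bmo_norm lam b * Ap_const lam p w powr (2 * max 1 (1 / (p - 1)))) powr p)
          * Lp_w_pow p w f" .
  qed
qed

end
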